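(* Let $f\in\mathbb{Q}[x]$ with $\deg f=d\ge1$ be cyclotomic-free, and let $t,c\in\mathbb{N}$ with $t\ge2$ be such that $f$ has a nonzero $t$-sparse multiple with height at most $c$. Let $n$ be the smallest degree of any such multiple of $f$. Then $$n\le 2(t-1)B\ln B,\qquad\text{where } B=\frac12 d^2\cdot\ln^3(3d)\cdot\ln\!\left(\hat c\,(t-1)^d\right)\text{ and }\hat c=\max(c,35).$$
   Context: $f$ is cyclotomic-free if no cyclotomic polynomial $\Phi_n$ ($n\ge1$) divides $f$. A polynomial is $t$-sparse if it has at most $t$ nonzero coefficients in the power basis. Height: for nonzero $g\in\mathbb{Q}[x]$, let $r$ be the least positive rational with $rg\in\mathbb{Z}[x]$; if $rg=\sum_i a_ix^{e_i}$ with $a_i\in\mathbb{Z}$, then $H(g)=\max_i|a_i|$. *)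

theory Defs
  imports "HOL-Analysis.Analysis" "HOL-Computational_Algebra.Polynomial"
begin

definition cyclotomic_poly :: "nat \<Rightarrow> complex poly" where
  "cyclotomic_poly n =
     (\<Prod>k\<in>{k. 1 \<le> k \<and> k \<le> n \<and> coprime k n}. [:- cis (2 * pi * real k / real n), 1:])"

definition cyclotomic_free :: "rat poly \<Rightarrow> bool" where
  "cyclotomic_free f \<longleftrightarrow>
     (\<forall>n\<ge>1. \<not> cyclotomic_poly n dvd map_poly of_rat f)"

definition sparse :: "nat \<Rightarrow> rat poly \<Rightarrow> bool" where
  "sparse t g \<longleftrightarrow> card {i. coeff g i \<noteq> 0} \<le> t"

definition int_scale :: "rat poly \<Rightarrow> rat" where
  "int_scale g = (LEAST r. r > 0 \<and> (\<forall>i. coeff (smult r g) i \<in> \<int>))"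

definition height :: "rat poly \<Rightarrow> rat" where
  "height g = Max ((\<lambda>i. \<bar>coeff (smult (int_scale g) g) i\<bar>) ` {..degree g})"

end

theory Submission
  imports Defs "HOL-Computational_Algebra.Computational_Algebra" "Jordan_Normal_Form.Schur_Decomposition"
begin

text \<open>Let \<open>g\<close> be a small multiple of minimal degree and suppose that its exponents have a large gap, say
  \<open>g = A + x ^ u * B\<close> with \<open>degree A\<close> much smaller than \<open>u\<close>. If \<open>f\<close> divided \<open>A\<close>, then \<open>A\<close> would be a smaller
  multiple. Otherwise some power of the Euler operator \<open>x d/dx\<close>, applied to \<open>g\<close>, yields a multiple of an
  irreducible factor \<open>F\<close> of \<open>f\<close> whose low part is not divisible by \<open>F\<close>, and the product formula
  bounds the gap by \<open>D * ln C / ln M\<close>, where \<open>D\<close> is the degree and \<open>M\<close> the Mahler measure of \<open>F\<close> and \<open>C\<close>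
  bounds the coefficient sums. As \<open>C\<close> is polynomial in the degree \<open>n\<close> of \<open>g\<close>, this bounds \<open>n\<close>.

  The lower bound for \<open>M\<close> is a one-prime version of Dobrowolski's argument. For a prime \<open>p\<close> the determinant
  of the Vandermonde matrix of the \<open>2 D\<close> numbers \<open>z\<close>, \<open>z ^ p\<close>, where \<open>z\<close> runs through the roots of a monic \<open>F\<close>,
  is at least \<open>p ^ D\<close>, because \<open>F (z ^ p)\<close> is divisible by \<open>p\<close>; by Hadamard's inequality it is at most
  \<open>(2 D) ^ D * M ^ ((2 D - 1) (p + 1))\<close>. Choosing \<open>p\<close> slightly larger than \<open>2 e D\<close> gives
  \<open>ln M \<ge> 5 / (12 D ln (3 D) ^ 3)\<close>.\<close>

section \<open>Norms of integer polynomials\<close>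

hide_const (open) Module.smult

text \<open>The polynomial \<open>F\<close> need not be monic, so the gap argument has to recover
  the leading coefficient as well: the product of the values of \<open>B\<close> over the roots has
  a priori a power of it in the denominator, yet must be shown divisible by its \<open>s\<close>-th
  power. Norms are therefore determinants of integer matrices, and integrality comes from bounded
  denominators of powers; no number fields or ideals are needed. The Vandermonde determinant is
  useful only if it is nonzero. This requires that the \<open>p\<close>-th powers of the roots be
  distinct, which holds once \<open>degree F < p - 1\<close>, and that none of them be a root of
  \<open>F\<close>. It yields \<open>ln (p / (2 D)) \<le> 2 (p + 1) ln M\<close>. The quotient
  \<open>ln x / x\<close> peaks at \<open>x = e\<close>, hence the factor \<open>2 e\<close>. A
  prime with \<open>p + 1 \<le> 6/5 D ln (3 D) ^ 3\<close> suffices, and this room is wide enough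
  for Chebyshev's elementary estimate; \<open>5/12\<close> is \<open>1 / (2 * 6/5)\<close>. Repeated
  factors of \<open>f\<close> cost \<open>k\<close> Euler operators and a factor
  \<open>n ^ k\<close> in the coefficients, but \<open>D (k + 1) \<le> d\<close> compensates for it.
  For \<open>d \<ge> 2\<close> the constant 35 gives \<open>B \<ge> 40\<close>, which the closing
  numerical comparison uses.\<close>

abbreviation ipoly :: "int poly \<Rightarrow> complex \<Rightarrow> complex" where
  "ipoly p z \<equiv> poly (of_int_poly p) z"

text \<open>\<open>H\<close> is a polynomial in \<open>z\<close> whose coefficients are polynomials
  in a parameter \<open>y\<close>. Norms run over values of \<open>z\<close> only, so a norm is
  again a polynomial in \<open>y\<close>.\<close>

abbreviation ipoly2 :: "int poly poly \<Rightarrow> complex \<Rightarrow> complex \<Rightarrow> complex" where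
  "ipoly2 H z y \<equiv> poly (map_poly (\<lambda>c. ipoly c y) H) z"

text \<open>The exponent is prescribed instead of depending on \<open>G\<close>: pseudo-division is
  padded with further powers of the leading coefficient. Thus all \<open>x ^ j * H\<close> can be
  reduced with one common factor.\<close>

lemma pseudo_remainder_exists:
  fixes F G :: "'a::idom poly"
  assumes "degree F \<ge> 1" and "degree G < degree F + k"
  shows "\<exists>Q S. smult (lead_coeff F ^ k) G = F * Q + S \<and> degree S < degree F"
proof -
  define e where "e = Suc (degree G) - degree F"
  obtain Q S where QS: "pseudo_divmod G F = (Q, S)" by force
  have F0: "F \<noteq> 0" using assms(1) by auto
  have eq: "smult (lead_coeff F ^ e) G = F * Q + S"
    using pseudo_divmod(1)[OF F0 QS] unfolding e_def .
  have dS: "degree S < degree F"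
    using pseudo_divmod(2)[OF F0 QS] assms(1) by auto
  have "e \<le> k" using assms(2) unfolding e_def by linarith
  then obtain j where j: "k = j + e" by (metis add.commute le_Suc_ex)
  have "smult (lead_coeff F ^ k) G = smult (lead_coeff F ^ j) (smult (lead_coeff F ^ e) G)"
    by (simp add: j power_add)
  also have "\<dots> = F * smult (lead_coeff F ^ j) Q + smult (lead_coeff F ^ j) S"
    by (simp add: eq smult_add_right)
  finally show ?thesis
    using dS degree_smult_le[of "lead_coeff F ^ j" S] by (meson le_less_trans)
qed

text \<open>A kernel vector would hold the coefficients of a nonzero polynomial of degree less than
  \<open>n\<close> with \<open>n\<close> distinct roots.\<close>

lemma det_vandermonde_nonzero:
  fixes zs :: "nat \<Rightarrow> 'a::idom"
  assumes "inj_on zs {..<n}"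
  shows "det (mat n n (\<lambda>(i, l). zs i ^ l)) \<noteq> 0"
proof
  let ?V = "mat n n (\<lambda>(i, l). zs i ^ l)"
  assume "det ?V = 0"
  then obtain v where v: "v \<in> carrier_vec n" "v \<noteq> 0\<^sub>v n" "?V *\<^sub>v v = 0\<^sub>v n"
    using det_0_iff_vec_prod_zero[of ?V n] by auto
  define p where "p = (\<Sum>l<n. monom (vec_index v l) l)"
  have cf: "coeff p l = (if l < n then vec_index v l else 0)" for l
    unfolding p_def by (simp add: coeff_sum if_distrib sum.delta cong: if_cong)
  have root: "poly p (zs i) = 0" if "i < n" for i
  proof -
    have "poly p (zs i) = (\<Sum>l<n. vec_index v l * zs i ^ l)"
      unfolding p_def by (simp add: poly_sum poly_monom)
    also have "\<dots> = vec_index (?V *\<^sub>v v) i"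
      using that v(1) by (auto simp: scalar_prod_def atLeast0LessThan mult.commute intro!: sum.cong)
    also have "\<dots> = 0" using that v(3) by simp
    finally show ?thesis .
  qed
  have "p \<noteq> 0"
  proof
    assume "p = 0"
    then have "v = 0\<^sub>v n" using cf v(1) by (intro eq_vecI) (auto, metis coeff_0)
    with v(2) show False by simp
  qed
  then have "n > 0" using cf by (metis leading_coeff_neq_0 less_nat_zero_code not_gr_zero)
  have "degree p < n"
    using cf by (metis \<open>p \<noteq> 0\<close> leading_coeff_neq_0)
  moreover have "card (zs ` {..<n}) \<le> degree p"
  proof -
    have "zs ` {..<n} \<subseteq> {x. poly p x = 0}" using root by auto
    then show ?thesis
      using card_mono[OF poly_roots_finite[OF \<open>p \<noteq> 0\<close>]] card_poly_roots_bound[OF \<open>p \<noteq> 0\<close>]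
      by (meson le_trans)
  qed
  ultimately show False using card_image[OF assms] by simp
qed

lemma comm_ring_hom_ipoly: "comm_ring_hom (\<lambda>c. ipoly c y)"
  by unfold_locales (auto simp: hom_distribs)

lemma poly_eq_sum_lessThan:
  fixes p :: "'a::comm_ring_1 poly"
  assumes "degree p < n" shows "poly p x = (\<Sum>l<n. coeff p l * x ^ l)"
proof -
  have "poly p x = (\<Sum>l\<le>degree p. coeff p l * x ^ l)" by (simp add: poly_altdef)
  also have "\<dots> = (\<Sum>l<n. coeff p l * x ^ l)"
    using assms by (intro sum.mono_neutral_left) (auto simp: coeff_eq_0)
  finally show ?thesis .
qed

text \<open>The product over the roots is the determinant of multiplication by \<open>H\<close> on the quotient by
  \<open>F\<close>, up to the powers of the leading coefficient that pseudo-division introduces.\<close>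

lemma norm_integral2:
  fixes F :: "int poly" and H :: "int poly poly"
  assumes D: "degree F = card R" "finite R" "card R \<ge> 1"
    and R: "\<And>z. z \<in> R \<Longrightarrow> ipoly F z = 0"
    and H: "degree H \<le> k"
  shows "\<exists>W. \<forall>y. ipoly W y = of_int (lead_coeff F) ^ (k * card R) * (\<Prod>z\<in>R. ipoly2 H z y)"
proof -
  define D where "D = card R"
  define a where "a = lead_coeff F"
  obtain zs where zs: "bij_betw zs {..<D} R"
    using ex_bij_betw_nat_finite[OF D(2)] unfolding D_def by (auto simp: atLeast0LessThan)
  define F' where "F' = map_poly (\<lambda>c. [:c:]) F"
  have hom: "inj_comm_ring_hom (\<lambda>c::int. [:c:])"
    by unfold_locales (auto simp: one_pCons)
  interpret c: inj_comm_ring_hom "\<lambda>c::int. [:c:]" by fact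
  have dF': "degree F' = D" unfolding F'_def using D(1) D_def by simp
  have lF': "lead_coeff F' = [:a:]"
    unfolding F'_def a_def by simp
  have "\<exists>Q S. smult ([:a:] ^ k) (monom 1 j * H) = F' * Q + S \<and> degree S < D" if "j < D" for j
  proof -
    have "degree (monom 1 j * H) < D + k"
    proof -
      have "degree (monom (1::int poly) j * H) \<le> j + degree H"
        using degree_mult_le[of "monom (1::int poly) j" H] degree_monom_le[of "1::int poly" j]
        by linarith
      with H that show ?thesis by linarith
    qed
    then show ?thesis
      using pseudo_remainder_exists[of F' "monom 1 j * H" k] dF' lF' that by auto
  qed
  then obtain Q S where QS: "\<And>j. j < D \<Longrightarrow> smult ([:a:] ^ k) (monom 1 j * H) = F' * Q j + S j"
    "\<And>j. j < D \<Longrightarrow> degree (S j) < D" by metis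
  define M where "M = mat D D (\<lambda>(j, l). coeff (S j) l)"
  have "ipoly (det M) y = of_int a ^ (k * D) * (\<Prod>z\<in>R. ipoly2 H z y)" for y
  proof -
    interpret e: comm_ring_hom "\<lambda>c. ipoly c y" by (rule comm_ring_hom_ipoly)
    interpret m: map_poly_comm_ring_hom "\<lambda>c. ipoly c y" ..
    define V where "V = mat D D (\<lambda>(i, l). zs i ^ l)"
    define h where "h i = of_int a ^ k * ipoly2 H (zs i) y" for i
    define N where "N = mat D D (\<lambda>(i, j). if i = j then h i else 0)"
    let ?M = "map_mat (\<lambda>c. ipoly c y) M"
    have F'0: "ipoly2 F' z y = ipoly F z" for z
      unfolding F'_def by (subst map_poly_map_poly) (auto simp: o_def of_int_hom.map_poly_pCons_hom)
    \<comment> \<open>At a root the multiple of \<open>F'\<close> vanishes, so row \<open>j\<close>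
      of \<open>M\<close> expresses \<open>h i * zs i ^ j\<close> through the powers below
      \<open>D\<close>.\<close>
    have key: "(\<Sum>l<D. ipoly (coeff (S j) l) y * zs i ^ l) = h i * zs i ^ j" if "i < D" "j < D" for i j
    proof -
      have r: "ipoly F (zs i) = 0" using R zs that by (auto simp: bij_betw_def)
      have "(\<Sum>l<D. ipoly (coeff (S j) l) y * zs i ^ l) = ipoly2 (S j) (zs i) y"
        using QS(2)[OF that(2)] degree_map_poly_le[of "\<lambda>c. ipoly c y" "S j"]
        by (subst poly_eq_sum_lessThan[of _ D]) auto
      also have "\<dots> = ipoly2 (F' * Q j + S j) (zs i) y"
        by (simp add: m.hom_add m.hom_mult F'0 r)
      also have "\<dots> = ipoly2 (smult ([:a:] ^ k) (monom 1 j * H)) (zs i) y"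
        using QS(1)[OF that(2)] by simp
      also have "\<dots> = h i * zs i ^ j"
        by (simp add: e.map_poly_hom_smult m.hom_mult e.map_poly_hom_monom poly_monom h_def hom_distribs)
      finally show ?thesis .
    qed
    \<comment> \<open>The Vandermonde matrix diagonalizes multiplication by \<open>H\<close>. As the
      roots are distinct, \<open>det V\<close> cancels and the determinant is the product of the
      values \<open>h i\<close>.\<close>
    have "V * transpose_mat ?M = N * V"
    proof (rule eq_matI)
      fix i j assume "i < dim_row (N * V)" "j < dim_col (N * V)"
      then have ij: "i < D" "j < D" by (auto simp: N_def V_def)
      have "(V * transpose_mat ?M) $$ (i, j) = (\<Sum>l<D. zs i ^ l * ipoly (coeff (S j) l) y)"
        using ij by (auto simp: V_def M_def scalar_prod_def atLeast0LessThan)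
      also have "\<dots> = h i * zs i ^ j" using key[OF ij] by (simp add: mult.commute)
      also have "\<dots> = (\<Sum>l\<in>{0..<D}. if i = l then h l * zs l ^ j else 0)"
        using ij by simp
      also have "\<dots> = (\<Sum>l\<in>{0..<D}. (if i = l then h i else 0) * zs l ^ j)"
        by (intro sum.cong) auto
      also have "\<dots> = (N * V) $$ (i, j)"
        using ij by (simp add: N_def V_def scalar_prod_def)
      finally show "(V * transpose_mat ?M) $$ (i, j) = (N * V) $$ (i, j)" .
    qed (auto simp: N_def V_def M_def)
    then have "det V * det ?M = det N * det V"
      using det_mult[of V D "transpose_mat ?M"] det_mult[of N D V] det_transpose[of ?M D]
      by (auto simp: N_def V_def M_def)
    moreover have "det V \<noteq> 0"
      unfolding V_def using zs by (intro det_vandermonde_nonzero) (auto simp: bij_betw_def)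
    ultimately have "det ?M = det N" by simp
    also have "\<dots> = prod_list (diag_mat N)"
      by (rule det_upper_triangular) (auto simp: N_def upper_triangular_def)
    also have "diag_mat N = map h [0..<D]"
      by (auto simp: diag_mat_def N_def)
    also have "prod_list \<dots> = (\<Prod>i<D. h i)"
      by (simp add: prod.distinct_set_conv_list[symmetric] atLeast0LessThan)
    also have "\<dots> = (\<Prod>z\<in>R. of_int a ^ k * ipoly2 H z y)"
      unfolding h_def by (rule prod.reindex_bij_betw[OF zs])
    also have "\<dots> = of_int a ^ (k * D) * (\<Prod>z\<in>R. ipoly2 H z y)"
      by (simp add: prod.distrib D_def power_mult)
    finally show ?thesis by (simp add: M_def e.hom_det)
  qed
  then show ?thesis unfolding a_def D_def by blast
qed

lemma norm_integral:
  fixes F H :: "int poly"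
  assumes "degree F = card R" "finite R" "card R \<ge> 1"
    and "\<And>z. z \<in> R \<Longrightarrow> ipoly F z = 0"
    and "degree H \<le> k"
  shows "\<exists>w. of_int w = of_int (lead_coeff F) ^ (k * card R) * (\<Prod>z\<in>R. ipoly H z)"
proof -
  interpret c: inj_comm_ring_hom "\<lambda>c::int. [:c:]"
    by unfold_locales (auto simp: one_pCons)
  define H' where "H' = map_poly (\<lambda>c. [:c:]) H"
  have "degree H' \<le> k" unfolding H'_def using assms(5) by simp
  from norm_integral2[OF assms(1-4) this] obtain W where
    W: "ipoly W 0 = of_int (lead_coeff F) ^ (k * card R) * (\<Prod>z\<in>R. ipoly2 H' z 0)" by blast
  have "ipoly2 H' z y = ipoly H z" for z y
    unfolding H'_def by (subst map_poly_map_poly) (auto simp: o_def of_int_hom.map_poly_pCons_hom)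
  with W have "ipoly W 0 = of_int (lead_coeff F) ^ (k * card R) * (\<Prod>z\<in>R. ipoly H z)" by (simp only:)
  moreover have "ipoly W 0 = of_int (coeff W 0)" by (simp add: poly_0_coeff_0)
  ultimately show ?thesis by metis
qed

abbreviation iroots :: "int poly \<Rightarrow> complex set" where
  "iroots F \<equiv> {z. ipoly F z = 0}"

lemma norm_integral_monic:
  fixes F H :: "int poly"
  assumes "degree F = card R" "finite R" "card R \<ge> 1"
    and "\<And>z. z \<in> R \<Longrightarrow> ipoly F z = 0" and a: "\<bar>lead_coeff F\<bar> = 1"
  shows "\<exists>w. of_int w = (\<Prod>z\<in>R. ipoly H z)"
proof -
  obtain w where w: "of_int w = of_int (lead_coeff F) ^ (degree H * card R) * (\<Prod>z\<in>R. ipoly H z)"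
    using norm_integral[OF assms(1-4) order.refl] by metis
  define u where "u = lead_coeff F ^ (degree H * card R)"
  have "\<bar>u\<bar> = 1" by (simp add: u_def power_abs a)
  then have "u * u = 1" by (metis abs_mult_self_eq mult_1)
  then have "of_int u * of_int u = (1::complex)" by (metis of_int_1 of_int_mult)
  moreover have "of_int w = of_int u * (\<Prod>z\<in>R. ipoly H z)" using w by (simp add: u_def)
  ultimately have "of_int (u * w) = (\<Prod>z\<in>R. ipoly H z)"
    by (simp add: mult.assoc[symmetric])
  then show ?thesis by blast
qed

lemma norm_integral2_monic:
  fixes F :: "int poly" and H :: "int poly poly"
  assumes "degree F = card R" "finite R" "card R \<ge> 1"
    and "\<And>z. z \<in> R \<Longrightarrow> ipoly F z = 0" and a: "\<bar>lead_coeff F\<bar> = 1"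
  shows "\<exists>W. \<forall>y. ipoly W y = (\<Prod>z\<in>R. ipoly2 H z y)"
proof -
  obtain W where W: "\<And>y. ipoly W y = of_int (lead_coeff F) ^ (degree H * card R) * (\<Prod>z\<in>R. ipoly2 H z y)"
    using norm_integral2[OF assms(1-4) order.refl] by metis
  define u where "u = lead_coeff F ^ (degree H * card R)"
  have "\<bar>u\<bar> = 1" by (simp add: u_def power_abs a)
  then have "u * u = 1" by (metis abs_mult_self_eq mult_1)
  then have "of_int u * of_int u = (1::complex)" by (metis of_int_1 of_int_mult)
  moreover have "ipoly W y = of_int u * (\<Prod>z\<in>R. ipoly2 H z y)" for y using W by (simp add: u_def)
  ultimately have "ipoly (smult u W) y = (\<Prod>z\<in>R. ipoly2 H z y)" for y
    by (simp add: mult.assoc[symmetric] hom_distribs)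
  then show ?thesis by blast
qed

section \<open>Roots of irreducible integer polynomials\<close>

text \<open>Integer polynomials have no division with remainder, so a nonzero \<open>G\<close> of
  least degree vanishing at \<open>z\<close> replaces the minimal polynomial: up to constants it
  divides everything that vanishes at \<open>z\<close>. Since \<open>F\<close> is prime and not
  constant, these constants can be cancelled, and \<open>F\<close> divides \<open>G\<close>.\<close>

lemma irreducible_dvd_of_common_root:
  fixes F H :: "int poly"
  assumes F: "irreducible F" and z: "ipoly F z = 0" and H: "ipoly H z = 0"
  shows "F dvd H"
proof -
  have F0: "F \<noteq> 0" using F by auto
  have P: "prime_elem F" using F by (rule irreducible_imp_prime_elem)
  define G where "G = (ARG_MIN degree G. G \<noteq> 0 \<and> ipoly G z = 0)"
  have G: "G \<noteq> 0 \<and> ipoly G z = 0" and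
    Gmin: "\<And>K. K \<noteq> 0 \<and> ipoly K z = 0 \<Longrightarrow> degree G \<le> degree K"
    using arg_min_nat_lemma[of "\<lambda>G. G \<noteq> 0 \<and> ipoly G z = 0" F degree] F0 z unfolding G_def by auto
  have dG: "degree G \<ge> 1"
  proof (rule ccontr)
    assume "\<not> degree G \<ge> 1"
    then have "degree G = 0" by simp
    then obtain c where "G = [:c:]" by (rule degree_eq_zeroE)
    with G show False by (auto simp: of_int_hom.map_poly_pCons_hom)
  qed
  have div: "\<exists>Q e. smult (lead_coeff G ^ e) K = G * Q" if "ipoly K z = 0" for K
  proof -
    obtain Q S where QS: "smult (lead_coeff G ^ Suc (degree K)) K = G * Q + S" "degree S < degree G"
      using pseudo_remainder_exists[OF dG, of K "Suc (degree K)"] by auto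
    have "ipoly (smult (lead_coeff G ^ Suc (degree K)) K) z = ipoly (G * Q + S) z" by (simp only: QS)
    then have "ipoly S z = 0" using G that by (simp add: hom_distribs)
    then have "S = 0" using Gmin[of S] QS(2) by force
    then have "smult (lead_coeff G ^ Suc (degree K)) K = G * Q" using QS(1) by (simp only: add_0_right)
    then show ?thesis by blast
  qed
  have const: "F dvd K" if "F dvd smult c K" "c \<noteq> 0" for c K
  proof -
    have "F dvd [:c:] * K" using that by simp
    then have "F dvd [:c:] \<or> F dvd K" using P by (meson prime_elem_dvd_mult_iff)
    moreover have "\<not> F dvd [:c:]"
    proof
      assume "F dvd [:c:]"
      then have "degree F = 0" using dvd_imp_degree_le[of F "[:c:]"] that(2) by simp
      then obtain b where "F = [:b:]" by (rule degree_eq_zeroE)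
      with z F0 show False by (auto simp: of_int_hom.map_poly_pCons_hom)
    qed
    ultimately show ?thesis by blast
  qed
  obtain Q e where Q: "smult (lead_coeff G ^ e) F = G * Q" using div[OF z] by blast
  have "F dvd G * Q" unfolding Q[symmetric] by (rule dvd_smult) simp
  then have "F dvd G \<or> F dvd Q" using P by (meson prime_elem_dvd_mult_iff)
  \<comment> \<open>Otherwise \<open>G\<close>, of positive degree, would divide a nonzero
    constant.\<close>
  moreover have "\<not> F dvd Q"
  proof
    assume "F dvd Q"
    then obtain K where K: "Q = F * K" by (elim dvdE)
    have "F * [:lead_coeff G ^ e:] = F * (G * K)" using Q K by (simp add: mult_ac)
    then have *: "[:lead_coeff G ^ e:] = G * K" by (simp only: mult_left_cancel[OF F0])
    have "G * K \<noteq> 0" unfolding *[symmetric] using G by simp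
    then have "G dvd G * K" "degree G \<le> degree (G * K)" by (auto intro: dvd_imp_degree_le)
    moreover have "degree (G * K) = 0" unfolding *[symmetric] by simp
    ultimately show False using dG by simp
  qed
  ultimately have FG: "F dvd G" by blast
  obtain Q' e' where Q': "smult (lead_coeff G ^ e') H = G * Q'" using div[OF H] by blast
  have "F dvd smult (lead_coeff G ^ e') H" unfolding Q' using FG by (rule dvd_mult2)
  then show ?thesis by (rule const) (use G in simp)
qed

lemma irreducible_degree_pos:
  fixes F :: "int poly"
  assumes "irreducible F" "ipoly F z = 0" shows "degree F \<ge> 1"
proof (rule ccontr)
  assume "\<not> degree F \<ge> 1"
  then have "degree F = 0" by simp
  then obtain c where "F = [:c:]" by (rule degree_eq_zeroE)
  with assms show False by (auto simp: of_int_hom.map_poly_pCons_hom)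
qed

text \<open>A double root would be a root of \<open>pderiv F\<close> too, and \<open>F\<close> would
  divide a nonzero polynomial of smaller degree. So the set of roots loses no
  multiplicities.\<close>

lemma irreducible_factorization:
  fixes F :: "int poly"
  assumes F: "irreducible F" and d: "degree F \<ge> 1"
  shows "of_int_poly F = smult (of_int (lead_coeff F)) (\<Prod>z\<in>iroots F. [:-z, 1:])"
    and "finite (iroots F)" and "card (iroots F) = degree F"
proof -
  let ?p = "of_int_poly F :: complex poly"
  have p0: "?p \<noteq> 0" using d by (metis of_int_poly_hom.hom_0_iff degree_0 not_one_le_zero)
  have "rsquarefree ?p"
  proof (subst rsquarefree_roots, intro allI notI)
    fix z assume z: "poly ?p z = 0 \<and> poly (pderiv ?p) z = 0"
    then have "ipoly (pderiv F) z = 0" by (simp add: of_int_hom.map_poly_pderiv)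
    with z F have "F dvd pderiv F" by (intro irreducible_dvd_of_common_root) auto
    moreover have "pderiv F \<noteq> 0" using d by (simp add: pderiv_eq_0_iff)
    ultimately have "degree F \<le> degree (pderiv F)" by (rule dvd_imp_degree_le)
    then show False using d by (simp add: degree_pderiv)
  qed
  from complex_poly_decompose_rsquarefree[OF this]
  show *: "?p = smult (of_int (lead_coeff F)) (\<Prod>z\<in>iroots F. [:-z, 1:])" by simp
  show "finite (iroots F)" using poly_roots_finite[OF p0] .
  have "degree ?p = degree (\<Prod>z\<in>iroots F. [:-z, 1:])"
    using d by (subst *) (auto simp del: of_int_hom.degree_map_poly_hom)
  also have "\<dots> = card (iroots F)" by (subst degree_prod_sum_eq) auto
  finally show "card (iroots F) = degree F" by simp
qed

lemma exists_irreducible_factor_of_root: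
  fixes G :: "int poly"
  assumes "G \<noteq> 0" "ipoly G z = 0"
  shows "\<exists>F. irreducible F \<and> F dvd G \<and> ipoly F z = 0"
  using assms
proof (induction G rule: prime_divisors_induct)
  case zero then show ?case by simp
next
  case (unit x)
  then obtain y where "1 = x * y" by auto
  then have "ipoly (x * y) z = 1" by (metis of_int_poly_hom.hom_one poly_1)
  with unit show ?case by (simp add: hom_distribs)
next
  case (factor p x)
  show ?case
  proof (cases "ipoly p z = 0")
    case True
    have "irreducible p" using factor(1) by (intro prime_elem_imp_irreducible prime_imp_prime_elem)
    with True show ?thesis by auto
  next
    case False
    then have "ipoly x z = 0" "x \<noteq> 0" using factor by (auto simp: hom_distribs)
    then show ?thesis using factor by (meson dvd_mult)
  qed
qed

section \<open>The Frobenius congruence modulo a prime\<close>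

lemma freshman_dvd:
  fixes x y :: "'a::comm_ring_1"
  assumes "prime q"
  shows "of_nat q dvd (x + y) ^ q - x ^ q - y ^ q"
proof -
  have q: "q > 0" using assms prime_gt_0_nat by blast
  have "(x + y) ^ q = (\<Sum>k\<le>q. of_nat (q choose k) * x ^ k * y ^ (q - k))" by (rule binomial_ring)
  also have "\<dots> = (\<Sum>k\<in>{0, q}. of_nat (q choose k) * x ^ k * y ^ (q - k)) +
      (\<Sum>k\<in>{..q} - {0, q}. of_nat (q choose k) * x ^ k * y ^ (q - k))"
    by (subst add.commute, rule sum.subset_diff) auto
  finally have "(x + y) ^ q - x ^ q - y ^ q = (\<Sum>k\<in>{..q} - {0, q}. of_nat (q choose k) * x ^ k * y ^ (q - k))"
    using q by simp
  moreover have "of_nat q dvd of_nat (q choose k) * x ^ k * y ^ (q - k)" if "k \<in> {..q} - {0, q}" for k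
  proof -
    have "q dvd (q choose k)" using that assms by (intro dvd_choose_prime) auto
    then show ?thesis by (auto elim!: dvdE simp: mult.assoc)
  qed
  ultimately show ?thesis by (simp only: dvd_sum)
qed

lemma fermat_int_dvd:
  assumes "prime q" shows "int q dvd a ^ q - a"
proof (induction a rule: int_induct[where k = 0])
  case base show ?case using prime_gt_0_nat[OF assms] by (simp add: zero_power)
next
  case (step1 i)
  from freshman_dvd[OF assms, of i 1] have "int q dvd (i + 1) ^ q - i ^ q - 1" by simp
  from dvd_add[OF this step1(2)] show ?case by (simp add: algebra_simps)
next
  case (step2 i)
  from freshman_dvd[OF assms, of "i - 1" 1] have "int q dvd i ^ q - (i - 1) ^ q - 1" by simp
  from dvd_diff[OF step2(2) this] show ?case by (simp add: algebra_simps)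
qed

text \<open>Induction on the coefficients: Fermat's little theorem treats the constant term,
  \<open>freshman_dvd\<close> the sum.\<close>

lemma frobenius_poly_dvd:
  fixes F :: "int poly"
  assumes q: "prime q"
  shows "of_nat q dvd F \<circ>\<^sub>p monom 1 q - F ^ q"
proof (induction F)
  case 0 show ?case using prime_gt_0_nat[OF q] by (simp add: power_0_left)
next
  case (pCons a F)
  have "int q dvd a - a ^ q" using fermat_int_dvd[OF q, of a] by (metis dvd_minus_iff minus_diff_eq)
  then obtain b where b: "a - a ^ q = int q * b" by (elim dvdE)
  have "[:a - a ^ q:] = of_nat q * [:b:]" unfolding b by (simp add: of_nat_poly)
  then have 1: "(of_nat q :: int poly) dvd [:a - a ^ q:]" by (rule dvdI)
  have 2: "of_nat q dvd monom 1 q * (F \<circ>\<^sub>p monom 1 q - F ^ q)" using pCons(2) by simp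
  have 3: "of_nat q dvd ([:a:] + monom 1 1 * F) ^ q - [:a:] ^ q - (monom 1 1 * F) ^ q"
    by (rule freshman_dvd[OF q])
  have pc: "pCons a F = [:a:] + monom 1 1 * F"
    by (simp add: monom_altdef)
  have "pCons a F \<circ>\<^sub>p monom 1 q - pCons a F ^ q = [:a - a ^ q:] + monom 1 q * (F \<circ>\<^sub>p monom 1 q - F ^ q)
     - (([:a:] + monom 1 1 * F) ^ q - [:a:] ^ q - (monom 1 1 * F) ^ q)"
    unfolding pc[symmetric] pcompose_pCons
    by (simp add: algebra_simps power_mult_distrib monom_power poly_const_pow)
  then show ?case using 1 2 3 by simp
qed

lemma ipoly_pcompose_monom: "ipoly (F \<circ>\<^sub>p monom 1 q) z = ipoly F (z ^ q)"
  by (simp add: of_int_hom.map_poly_pcompose poly_pcompose poly_monom)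

text \<open>At a root the congruence reads \<open>F (z ^ q) = q * E z\<close>, so every root
  contributes one factor \<open>q\<close>, and the remaining product over \<open>E\<close> is an
  integer.\<close>

lemma norm_frobenius_dvd:
  fixes F :: "int poly"
  assumes q: "prime q" and F: "degree F = card R" "finite R" "card R \<ge> 1"
    and R: "\<And>z. z \<in> R \<Longrightarrow> ipoly F z = 0" and a: "\<bar>lead_coeff F\<bar> = 1"
  shows "\<exists>w. of_int (int q ^ card R * w) = (\<Prod>z\<in>R. ipoly F (z ^ q))"
proof -
  obtain E where E: "F \<circ>\<^sub>p monom 1 q - F ^ q = of_nat q * E"
    using frobenius_poly_dvd[OF q, of F] by (elim dvdE)
  have z: "ipoly F (z ^ q) = of_nat q * ipoly E z" if "z \<in> R" for z
  proof -
    have "F \<circ>\<^sub>p monom 1 q = F ^ q + of_nat q * E" using E by (simp add: algebra_simps)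
    then have "ipoly F (z ^ q) = ipoly (F ^ q + of_nat q * E) z" by (simp flip: ipoly_pcompose_monom)
    then show ?thesis using R[OF that] prime_gt_0_nat[OF q] by (simp add: hom_distribs)
  qed
  obtain w where "of_int w = (\<Prod>z\<in>R. ipoly E z)" using norm_integral_monic[OF F R a] by blast
  then have "of_int (int q ^ card R * w) = (\<Prod>z\<in>R. ipoly F (z ^ q))"
    by (simp add: z prod.distrib)
  then show ?thesis by blast
qed

section \<open>Conjugates of roots of unity and of prime powers\<close>

text \<open>This replaces Galois conjugation: an integral relation for one root holds for all of
  them.\<close>

lemma irreducible_root_transfer:
  fixes F :: "int poly"
  assumes "irreducible F" "ipoly F z = 0" "ipoly F w = 0" "ipoly H z = 0"
  shows "ipoly H w = 0"
  using irreducible_dvd_of_common_root[OF assms(1,2,4)] assms(3) by (auto simp: hom_distribs)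

text \<open>Dedekind's argument: if \<open>\<zeta> ^ q\<close> is not a root of \<open>F\<close>, it is a root of the cofactor of \<open>F\<close>
  in \<open>x ^ n - 1\<close>, so that \<open>F (\<zeta> ^ q)\<close> divides the derivative \<open>n \<zeta> ^ (q * (n - 1))\<close>; taking norms,
  \<open>q\<close> divides \<open>n\<close>.\<close>

lemma irreducible_root_of_unity_prime_power:
  fixes F :: "int poly"
  assumes F: "irreducible F" "ipoly F \<zeta> = 0" and n: "n > 0" "\<zeta> ^ n = 1"
    and q: "prime q" "\<not> q dvd n"
  shows "ipoly F (\<zeta> ^ q) = 0"
proof (rule ccontr)
  assume nz: "ipoly F (\<zeta> ^ q) \<noteq> 0"
  define P :: "int poly" where "P = monom 1 n - 1"
  have P: "ipoly P z = z ^ n - 1" for z by (simp add: P_def hom_distribs poly_monom)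
  have FP: "F dvd P" using F n by (intro irreducible_dvd_of_common_root[of F \<zeta>]) (auto simp: P)
  then obtain W where W: "P = F * W" by (elim dvdE)
  let ?R = "iroots F"
  have d: "degree F \<ge> 1" using irreducible_degree_pos F by blast
  note fac = irreducible_factorization[OF F(1) d]
  have lP: "lead_coeff P = 1"
  proof -
    have "coeff P n = 1" using n by (simp add: P_def)
    moreover have "degree P \<le> n" unfolding P_def by (intro degree_diff_le) (auto simp: degree_monom_le)
    ultimately have "degree P = n" by (simp add: le_antisym le_degree)
    then show ?thesis using n by (simp add: P_def)
  qed
  then have "lead_coeff F * lead_coeff W = 1" using W lead_coeff_mult[of F W] by simp
  then have a: "\<bar>lead_coeff F\<bar> = 1" by (metis dvdI zdvd1_eq)
  have R: "z \<in> ?R \<Longrightarrow> ipoly F z = 0" for z by simp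
  have root1: "z ^ n = 1" if "z \<in> ?R" for z
    using that W P[of z] by (auto simp: hom_distribs)
  have nz': "ipoly F (z ^ q) \<noteq> 0" if "z \<in> ?R" for z
    using irreducible_root_transfer[OF F(1), of z \<zeta> "F \<circ>\<^sub>p monom 1 q"] that F(2) nz
    by (auto simp: ipoly_pcompose_monom)
  have key: "ipoly F (z ^ q) * ipoly (pderiv W) (z ^ q) = of_nat n * (z ^ q) ^ (n - 1)" if "z \<in> ?R" for z
  proof -
    have "ipoly P (z ^ q) = 0" using root1[OF that] by (metis P cancel_comm_monoid_add_class.diff_cancel mult.commute power_mult power_one)
    then have "ipoly W (z ^ q) = 0" using nz'[OF that] W by (auto simp: hom_distribs)
    then have "ipoly (pderiv P) (z ^ q) = ipoly F (z ^ q) * ipoly (pderiv W) (z ^ q)"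
      by (simp add: W pderiv_mult hom_distribs)
    moreover have "pderiv P = monom (int n) (n - 1)" by (simp add: P_def pderiv_diff pderiv_monom)
    ultimately show ?thesis by (simp add: poly_monom)
  qed
  have card: "card ?R \<ge> 1" using d fac(3) by simp
  obtain w where w: "of_int (int q ^ card ?R * w) = (\<Prod>z\<in>?R. ipoly F (z ^ q))"
    using norm_frobenius_dvd[OF q(1) fac(3)[symmetric] fac(2) card R a] by blast
  obtain v where v: "of_int v = (\<Prod>z\<in>?R. ipoly (pderiv W \<circ>\<^sub>p monom 1 q) z)"
    using norm_integral_monic[OF fac(3)[symmetric] fac(2) card R a] by blast
  have "complex_of_int (int q ^ card ?R * w) * of_int v = (\<Prod>z\<in>?R. of_nat n * (z ^ q) ^ (n - 1))"
    unfolding w v ipoly_pcompose_monom prod.distrib[symmetric] by (intro prod.cong) (auto simp: key)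
  then have "norm (complex_of_int (int q ^ card ?R * w * v)) = norm (\<Prod>z\<in>?R. of_nat n * (z ^ q) ^ (n - 1))"
    by (metis of_int_mult)
  also have "\<dots> = (\<Prod>z\<in>?R. real n)"
  proof -
    have "norm (of_nat n * (z ^ q) ^ (n - 1)) = real n" if "z \<in> ?R" for z
    proof -
      have "norm z ^ n = 1" using root1[OF that] by (metis norm_one norm_power)
      then have "norm z ^ n = 1 ^ n" by simp
      then have "norm z = 1" by (rule power_eq_imp_eq_base) (use n in auto)
      then show ?thesis by (simp add: norm_mult norm_power)
    qed
    then show ?thesis unfolding prod_norm[symmetric] by (intro prod.cong) auto
  qed
  finally have *: "norm (complex_of_int (int q ^ card ?R * w * v)) = (\<Prod>z\<in>?R. real n)" .
  have "real_of_int \<bar>int q ^ card ?R * w * v\<bar> = real_of_int (int n ^ card ?R)"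
    using *[unfolded norm_of_int] by simp
  then have "\<bar>int q ^ card ?R * w * v\<bar> = int n ^ card ?R" by (metis of_int_eq_iff)
  then have "int q ^ card ?R dvd int n ^ card ?R"
    by (metis dvd_abs_iff dvd_mult2 dvd_triv_left)
  then have "int q dvd int n" using card by (simp add: pow_divides_pow_iff)
  then show False using q(2) by simp
qed

text \<open>Primes are split off \<open>k\<close> one at a time. They do not divide
  \<open>n\<close>, and every intermediate power is again an \<open>n\<close>-th root of
  unity.\<close>

lemma irreducible_root_of_unity_coprime_power:
  fixes F :: "int poly"
  assumes F: "irreducible F" "ipoly F \<zeta> = 0" and n: "n > 0" "\<zeta> ^ n = 1"
    and k: "k > 0" "coprime k n"
  shows "ipoly F (\<zeta> ^ k) = 0"
  using k
proof (induction k rule: less_induct)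
  case (less k)
  show ?case
  proof (cases "k = 1")
    case True then show ?thesis using F by simp
  next
    case False
    then obtain q where q: "prime q" "q dvd k" using prime_factor_nat by blast
    then obtain j where j: "k = q * j" by (elim dvdE)
    have "j > 0" "j < k" using j less(2) prime_gt_1_nat[OF q(1)] by auto
    moreover have "coprime j n" using less(3) j by simp
    ultimately have "ipoly F (\<zeta> ^ j) = 0" using less(1) by blast
    moreover have "(\<zeta> ^ j) ^ n = 1" by (metis n(2) mult.commute power_mult power_one)
    moreover have "\<not> q dvd n" using less(3) j q(1) prime_gt_1_nat[OF q(1)]
      by (metis coprime_common_divisor dvd_triv_left nat_dvd_1_iff_1 less_irrefl)
    ultimately have "ipoly F ((\<zeta> ^ j) ^ q) = 0"
      using irreducible_root_of_unity_prime_power[OF F(1) _ n(1) _ q(1)] by blast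
    then show ?thesis by (simp add: j power_mult[symmetric] mult.commute)
  qed
qed

text \<open>The powers \<open>\<omega> ^ k\<close> with \<open>1 \<le> k < p\<close> are distinct,
  and all of them are conjugates of \<open>\<omega>\<close>.\<close>

lemma root_of_unity_prime_degree:
  fixes G :: "int poly"
  assumes "G \<noteq> 0" "ipoly G \<omega> = 0" "prime p" "\<omega> ^ p = 1" "\<omega> \<noteq> 1"
  shows "degree G \<ge> p - 1"
proof -
  obtain F where F: "irreducible F" "F dvd G" "ipoly F \<omega> = 0"
    using exists_irreducible_factor_of_root assms by blast
  have p: "p > 1" using assms(3) prime_gt_1_nat by blast
  have d: "degree F \<ge> 1" using irreducible_degree_pos F by blast
  have cop: "coprime k p" if "k \<in> {1..<p}" for k
  proof -
    have "\<not> p dvd k" using that by (auto dest: dvd_imp_le)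
    then show ?thesis using assms(3) prime_imp_coprime coprime_commute by blast
  qed
  have ne: "\<omega> ^ k \<noteq> 1" if k: "k \<in> {1..<p}" for k
  proof
    assume 1: "\<omega> ^ k = 1"
    have "gcd k p = 1" using cop[OF k] by simp
    then obtain x y where xy: "k * x = p * y + 1" using bezout_nat[of k p] k by auto
    have "\<omega> ^ (k * x) = 1" using 1 by (simp add: power_mult)
    moreover have "\<omega> ^ (p * y + 1) = \<omega>" using assms(4) by (simp add: power_mult)
    ultimately show False using xy assms(5) by simp
  qed
  have w0: "\<omega> \<noteq> 0" using assms(4) p by (metis power_0_left zero_neq_one not_one_less_zero)
  have inj: "inj_on (\<lambda>k. \<omega> ^ k) {1..<p}"
  proof (rule linorder_inj_onI')
    fix i j assume ij: "i \<in> {1..<p}" "j \<in> {1..<p}" "i < j"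
    show "\<omega> ^ i \<noteq> \<omega> ^ j"
    proof
      assume "\<omega> ^ i = \<omega> ^ j"
      then have "\<omega> ^ (j - i) = 1" using ij(3) w0 by (simp add: power_diff)
      moreover have "j - i \<in> {1..<p}" using ij by auto
      ultimately show False using ne by blast
    qed
  qed
  have "(\<lambda>k. \<omega> ^ k) ` {1..<p} \<subseteq> iroots F"
    using irreducible_root_of_unity_coprime_power[OF F(1,3) _ assms(4)] cop p by auto
  from card_mono[OF irreducible_factorization(2)[OF F(1) d] this]
  have "p - 1 \<le> degree F" using inj irreducible_factorization(3)[OF F(1) d] by (simp add: card_image)
  also have "\<dots> \<le> degree G" using F(2) assms(1) by (rule dvd_imp_degree_le)
  finally show ?thesis .
qed

text \<open>The field generated by \<open>g\<close> over the rationals, for arbitrary complex \<open>g\<close>.\<close>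

definition ifrac :: "complex \<Rightarrow> complex set" where
  "ifrac g = {ipoly w g / ipoly v g |w v. ipoly v g \<noteq> 0}"

lemma ipoly_diff: "ipoly (A - B) z = ipoly A z - ipoly B z"
  by (simp add: hom_distribs)

lemma ipoly_mult: "ipoly (A * B) z = ipoly A z * ipoly B z"
  by (simp add: hom_distribs)

lemma ifracI: "ipoly v g \<noteq> 0 \<Longrightarrow> x = ipoly w g / ipoly v g \<Longrightarrow> x \<in> ifrac g"
  unfolding ifrac_def by blast

lemma ifracE:
  assumes "x \<in> ifrac g" obtains w v where "ipoly v g \<noteq> 0" "x = ipoly w g / ipoly v g"
  using assms unfolding ifrac_def by blast

lemma ipoly_in_ifrac: "ipoly w g \<in> ifrac g"
  by (rule ifracI[of 1 _ _ w]) auto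

lemma of_int_in_ifrac: "of_int k \<in> ifrac g"
  using ipoly_in_ifrac[of "[:k:]" g] by (simp add: of_int_hom.map_poly_pCons_hom)

lemma self_in_ifrac: "g \<in> ifrac g"
  using ipoly_in_ifrac[of "[:0, 1:]" g] by (simp add: of_int_hom.map_poly_pCons_hom)

lemma ifrac_mult: "x \<in> ifrac g \<Longrightarrow> y \<in> ifrac g \<Longrightarrow> x * y \<in> ifrac g"
proof (elim ifracE)
  fix w v w' v' assume "ipoly v g \<noteq> 0" "x = ipoly w g / ipoly v g" "ipoly v' g \<noteq> 0" "y = ipoly w' g / ipoly v' g"
  then show ?thesis by (intro ifracI[of "v * v'" g _ "w * w'"]) (auto simp: hom_distribs)
qed

lemma ifrac_add: "x \<in> ifrac g \<Longrightarrow> y \<in> ifrac g \<Longrightarrow> x + y \<in> ifrac g"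
proof (elim ifracE)
  fix w v w' v' assume "ipoly v g \<noteq> 0" "x = ipoly w g / ipoly v g" "ipoly v' g \<noteq> 0" "y = ipoly w' g / ipoly v' g"
  then show ?thesis
    by (intro ifracI[of "v * v'" g _ "w * v' + w' * v"]) (auto simp: hom_distribs add_frac_eq)
qed

lemma ifrac_uminus: "x \<in> ifrac g \<Longrightarrow> - x \<in> ifrac g"
  using ifrac_mult[OF of_int_in_ifrac[of "-1"]] by simp

lemma ifrac_inverse: "x \<in> ifrac g \<Longrightarrow> inverse x \<in> ifrac g"
proof (elim ifracE)
  fix w v assume *: "ipoly v g \<noteq> 0" "x = ipoly w g / ipoly v g"
  show ?thesis
  proof (cases "ipoly w g = 0")
    case True then show ?thesis using * of_int_in_ifrac[of 0 g] by simp
  next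
    case False then show ?thesis using * by (intro ifracI[of w g _ v]) auto
  qed
qed

lemma ifrac_divide: "x \<in> ifrac g \<Longrightarrow> y \<in> ifrac g \<Longrightarrow> x / y \<in> ifrac g"
  by (simp add: divide_inverse ifrac_mult ifrac_inverse)

lemma ifrac_power: "x \<in> ifrac g \<Longrightarrow> x ^ n \<in> ifrac g"
  using of_int_in_ifrac[of 1 g] by (induction n) (auto intro: ifrac_mult)

text \<open>The field is merely a set of complex numbers, so the division algorithm is run by hand
  to see that the remainder stays over it.\<close>

lemma ifrac_polynomial_division:
  assumes "\<forall>i. coeff Q i \<in> ifrac g" "Q \<noteq> 0" "\<forall>i. coeff A i \<in> ifrac g"
  shows "\<exists>q r. A = Q * q + r \<and> (r = 0 \<or> degree r < degree Q) \<and> (\<forall>i. coeff r i \<in> ifrac g)"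
  using assms(3)
proof (induction "degree A" arbitrary: A rule: less_induct)
  case less
  show ?case
  proof (cases "A = 0 \<or> degree A < degree Q")
    case True
    then show ?thesis using less(2) by (intro exI[of _ 0] exI[of _ A]) auto
  next
    case False
    define e where "e = degree A - degree Q"
    define c where "c = lead_coeff A / lead_coeff Q"
    define A' where "A' = A - monom c e * Q"
    have c: "c \<in> ifrac g" unfolding c_def using less(2) assms(1) by (simp add: ifrac_divide)
    have e: "degree A = degree Q + e" using False by (simp add: e_def)
    have cA': "coeff A' i \<in> ifrac g" for i
    proof -
      have "coeff (monom c e * Q) i \<in> ifrac g"
        using c assms(1) of_int_in_ifrac[of 0 g] by (auto simp: coeff_monom_mult intro: ifrac_mult)
      then have "coeff A i + - coeff (monom c e * Q) i \<in> ifrac g"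
        using less(2) by (intro ifrac_add ifrac_uminus) auto
      then show ?thesis by (simp add: A'_def)
    qed
    have A: "A = Q * monom c e + A'" by (simp add: A'_def mult.commute)
    show ?thesis
    proof (cases "A' = 0")
      case True
      then show ?thesis using A of_int_in_ifrac[of 0 g] by (intro exI[of _ "monom c e"] exI[of _ 0]) auto
    next
      case A'0: False
      have "degree A' < degree A"
      proof (rule ccontr)
        assume "\<not> degree A' < degree A"
        moreover have "degree A' \<le> degree A" unfolding A'_def
          by (intro degree_diff_le order.trans[OF degree_mult_le])
            (use e degree_monom_le[of c e] in auto)
        ultimately have "degree A' = degree A" by simp
        then have "lead_coeff A' = 0"
          using assms(2) by (simp add: A'_def coeff_monom_mult c_def e)
        then show False using A'0 by simp
      qed
      from less(1)[OF this] cA' obtain q r where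
        "A' = Q * q + r" "r = 0 \<or> degree r < degree Q" "\<forall>i. coeff r i \<in> ifrac g" by blast
      then show ?thesis using A
        by (intro exI[of _ "monom c e + q"] exI[of _ r]) (auto simp: algebra_simps)
    qed
  qed
qed

text \<open>The norm of \<open>y * V - W\<close> over the roots of \<open>F\<close> is a nonzero
  integer polynomial in \<open>y\<close> of degree at most \<open>degree F\<close>, and the ratio is
  one of its roots. A nontrivial \<open>p\<close>-th root of unity would need degree at least
  \<open>p - 1\<close>.\<close>

lemma ratio_root_of_unity_eq_1:
  fixes F V W :: "int poly"
  assumes F: "irreducible F" "ipoly F \<alpha> = 0" and p: "prime p" "degree F < p - 1"
    and V: "ipoly V \<alpha> \<noteq> 0" and \<omega>: "(ipoly W \<alpha> / ipoly V \<alpha>) ^ p = 1"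
  shows "ipoly W \<alpha> = ipoly V \<alpha>"
proof (rule ccontr)
  assume ne: "ipoly W \<alpha> \<noteq> ipoly V \<alpha>"
  define \<omega> where "\<omega> = ipoly W \<alpha> / ipoly V \<alpha>"
  have d: "degree F \<ge> 1" using irreducible_degree_pos F by blast
  note fac = irreducible_factorization[OF F(1) d]
  have card: "card (iroots F) \<ge> 1" using d fac(3) by simp
  define H where "H = smult [:0, 1:] (map_poly (\<lambda>c::int. [:c:]) V) - map_poly (\<lambda>c. [:c:]) W"
  have H: "ipoly2 H z y = y * ipoly V z - ipoly W z" for z y
  proof -
    interpret e: comm_ring_hom "\<lambda>c. ipoly c y" by (rule comm_ring_hom_ipoly)
    interpret m: map_poly_comm_ring_hom "\<lambda>c. ipoly c y" ..
    have "ipoly2 (map_poly (\<lambda>c. [:c:]) U) z y = ipoly U z" for U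
      by (subst map_poly_map_poly) (auto simp: o_def of_int_hom.map_poly_pCons_hom)
    then show ?thesis
      by (simp add: H_def m.hom_minus e.map_poly_hom_smult of_int_hom.map_poly_pCons_hom)
  qed
  obtain G where G: "\<And>y. ipoly G y = of_int (lead_coeff F) ^ (degree H * card (iroots F)) * (\<Prod>z\<in>iroots F. ipoly2 H z y)"
    using norm_integral2[of F "iroots F" H, OF fac(3)[symmetric] fac(2) card _ order.refl] by auto
  let ?C = "(of_int (lead_coeff F) :: complex) ^ (degree H * card (iroots F))"
  have C: "?C \<noteq> 0" using F(1) by auto
  have "poly (of_int_poly G) = poly (smult ?C (\<Prod>z\<in>iroots F. [:- ipoly W z, ipoly V z:]))"
    by (rule ext) (simp add: G H poly_prod algebra_simps)
  then have eq: "of_int_poly G = smult ?C (\<Prod>z\<in>iroots F. [:- ipoly W z, ipoly V z:])"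
    by (simp add: poly_eq_poly_eq_iff)
  have Vz: "ipoly V z \<noteq> 0" if "z \<in> iroots F" for z
    using irreducible_root_transfer[OF F(1), of z \<alpha> V] F(2) V that by auto
  have "of_int_poly G \<noteq> (0 :: complex poly)"
    unfolding eq using C Vz fac(2) by auto
  then have G0: "G \<noteq> 0" by auto
  have "degree (of_int_poly G :: complex poly) \<le> (\<Sum>z\<in>iroots F. degree [:- ipoly W z, ipoly V z:])"
    unfolding eq
    using order.trans[OF degree_smult_le degree_prod_sum_le[OF fac(2), of "\<lambda>z. [:- ipoly W z, ipoly V z:]"], of ?C]
    by (simp only: o_def)
  also have "\<dots> \<le> (\<Sum>z\<in>iroots F. 1)" by (intro sum_mono) auto
  finally have dG: "degree G \<le> degree F" using fac(3) by simp
  have "ipoly2 H \<alpha> \<omega> = 0" using V by (simp add: H \<omega>_def)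
  then have "ipoly G \<omega> = 0" using F(2) fac(2) by (auto simp: G)
  from root_of_unity_prime_degree[OF G0 this p(1)] \<omega> ne V dG p(2)
  show False by (auto simp: \<omega>_def)
qed

text \<open>Let \<open>Q\<close> be the minimal polynomial of \<open>\<alpha>\<close> over the field generated by \<open>\<gamma> = \<alpha> ^ p\<close>. It divides
  \<open>x ^ p - \<gamma>\<close>, so up to sign its constant term is \<open>\<omega> \<alpha> ^ m\<close> with \<open>\<omega> ^ p = 1\<close> and \<open>m = degree Q < p\<close>.
  As \<open>\<omega>\<close> lies in a field of degree less than \<open>p - 1\<close>, it is 1; so \<open>\<alpha> ^ m\<close> and \<open>\<alpha> ^ p\<close>, hence \<open>\<alpha>\<close>,
  are rational functions of \<open>\<gamma>\<close>.\<close>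

lemma root_in_ifrac_power:
  fixes F :: "int poly"
  assumes F: "irreducible F" "ipoly F \<alpha> = 0" and \<alpha>: "\<alpha> \<noteq> 0"
    and p: "prime p" "degree F < p - 1"
  shows "\<alpha> \<in> ifrac (\<alpha> ^ p)"
proof -
  define g where "g = \<alpha> ^ p"
  have d: "degree F \<ge> 1" using irreducible_degree_pos F by blast
  let ?P = "\<lambda>Q. Q \<noteq> 0 \<and> poly Q \<alpha> = 0 \<and> (\<forall>i. coeff Q i \<in> ifrac g)"
  have PF: "?P (of_int_poly F)" using F by (auto simp: of_int_in_ifrac)
  define Q0 where "Q0 = (ARG_MIN degree Q. ?P Q)"
  have Q0: "?P Q0" and Qmin: "\<And>K. ?P K \<Longrightarrow> degree Q0 \<le> degree K"
    using arg_min_nat_lemma[of ?P, OF PF, of degree] unfolding Q0_def by auto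
  define Q where "Q = smult (inverse (lead_coeff Q0)) Q0"
  define m where "m = degree Q"
  have Q: "?P Q" "lead_coeff Q = 1" "degree Q = degree Q0"
    using Q0 by (auto simp: Q_def ifrac_mult ifrac_inverse)
  have m: "m \<le> degree F" using Qmin[OF PF] Q(3) by (simp add: m_def)
  have m1: "m \<ge> 1"
  proof (rule ccontr)
    assume "\<not> m \<ge> 1" then have "degree Q = 0" by (simp add: m_def)
    then obtain c where "Q = [:c:]" by (rule degree_eq_zeroE)
    with Q(1) show False by auto
  qed
  define A where "A = monom 1 p - [:g:]"
  have cA: "\<forall>i. coeff A i \<in> ifrac g"
  proof
    fix i
    have "p \<noteq> 0" using p by auto
    then have "coeff A i = (if i = p then 1 else 0) + - (if i = 0 then g else 0)"
      by (auto simp: A_def coeff_pCons split: nat.splits)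
    moreover have "(if i = p then 1 else 0) + - (if i = 0 then g else 0) \<in> ifrac g"
      using of_int_in_ifrac[of 1 g] of_int_in_ifrac[of 0 g] self_in_ifrac[of g]
      by (intro ifrac_add ifrac_uminus) auto
    ultimately show "coeff A i \<in> ifrac g" by (simp only:)
  qed
  obtain q r where qr: "A = Q * q + r" "r = 0 \<or> degree r < degree Q" "\<forall>i. coeff r i \<in> ifrac g"
    using ifrac_polynomial_division[OF _ _ cA, of Q] Q(1) by blast
  have "poly A \<alpha> = 0" by (simp add: A_def g_def poly_monom)
  then have "poly r \<alpha> = 0" using qr(1) Q(1) by simp
  then have "r = 0" using Qmin[of r] qr Q(3) by force
  then have A: "A = Q * q" using qr by simp
  obtain root where root: "smult (lead_coeff Q) (\<Prod>i<degree Q. [:- root i, 1:]) = Q"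
    using complex_poly_decompose' by blast
  then have root: "Q = (\<Prod>i<m. [:- root i, 1:])" using Q(2) by (simp add: m_def)
  have rp: "root i ^ p = g" if "i < m" for i
  proof -
    have "poly Q (root i) = 0" unfolding root poly_prod using that by (intro prod_zero) auto
    then have "poly A (root i) = 0" by (simp add: A)
    then show ?thesis by (simp add: A_def poly_monom)
  qed
  define c where "c = coeff Q 0"
  have c: "c \<in> ifrac g" using Q(1) by (simp add: c_def)
  have "c = poly Q 0" by (simp add: c_def poly_0_coeff_0)
  also have "\<dots> = (\<Prod>i<m. - root i)" unfolding root poly_prod by simp
  finally have "c ^ p = (\<Prod>i<m. (- root i) ^ p)" by (simp add: prod_power_distrib)
  also have "\<dots> = (\<Prod>i<m. (-1) ^ p * g)"
  proof (intro prod.cong refl)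
    fix i assume "i \<in> {..<m}"
    then show "(- root i) ^ p = (- 1) ^ p * g" using rp[of i] by (subst power_minus) simp
  qed
  also have "\<dots> = ((-1) ^ p * g) ^ m" by simp
  also have "\<dots> = ((- \<alpha>) ^ m) ^ p"
    unfolding g_def power_minus[of \<alpha> p, symmetric] by (simp add: power_mult[symmetric] mult.commute)
  finally have cp: "c ^ p = ((- \<alpha>) ^ m) ^ p" .
  obtain w v where wv: "ipoly v g \<noteq> 0" "c = ipoly w g / ipoly v g" using ifracE[OF c] by blast
  \<comment> \<open>The denominator absorbs \<open>(- \<alpha>) ^ m\<close>, so that
    \<open>W / V\<close> at \<open>\<alpha>\<close> is the root of unity by which the constant term
    \<open>c\<close> differs from \<open>(- \<alpha>) ^ m\<close>.\<close>
  define V where "V = (- monom 1 1) ^ m * (v \<circ>\<^sub>p monom 1 p)"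
  define W where "W = w \<circ>\<^sub>p monom 1 p"
  have V: "ipoly V \<alpha> = (- \<alpha>) ^ m * ipoly v g"
    unfolding V_def ipoly_mult ipoly_pcompose_monom by (simp add: g_def hom_distribs poly_monom)
  have W: "ipoly W \<alpha> = ipoly w g" by (simp add: W_def ipoly_pcompose_monom g_def)
  have WV: "ipoly W \<alpha> / ipoly V \<alpha> = c / (- \<alpha>) ^ m" using wv by (simp add: V W)
  have "(ipoly W \<alpha> / ipoly V \<alpha>) ^ p = 1" unfolding WV using cp \<alpha> by (simp add: power_divide)
  moreover have V0: "ipoly V \<alpha> \<noteq> 0" using wv \<alpha> by (simp add: V)
  ultimately have "ipoly W \<alpha> = ipoly V \<alpha>" using ratio_root_of_unity_eq_1[OF F p] by blast
  then have "c = (- \<alpha>) ^ m" using WV V0 \<alpha> by simp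
  then have "(-1) ^ m * c = ((-1) * (- \<alpha>)) ^ m" by (simp only: power_mult_distrib)
  then have "\<alpha> ^ m = (-1) ^ m * c" by simp
  moreover have "(-1) ^ m * c \<in> ifrac g"
    using c of_int_in_ifrac[of "-1" g] by (intro ifrac_mult ifrac_power) auto
  ultimately have am: "\<alpha> ^ m \<in> ifrac g" by simp
  have "\<not> p dvd m" using m m1 p(2) by (auto dest: dvd_imp_le)
  then have "gcd m p = 1" using p(1) prime_imp_coprime coprime_commute coprime_iff_gcd_eq_1 by blast
  then obtain x y where xy: "m * x = p * y + 1" using bezout_nat[of m p] m1 by auto
  have "(\<alpha> ^ m) ^ x = g ^ y * \<alpha>" unfolding power_mult[symmetric] xy by (simp add: g_def power_mult)
  then have "\<alpha> = (\<alpha> ^ m) ^ x / g ^ y" using \<alpha> by (simp add: g_def)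
  moreover have "(\<alpha> ^ m) ^ x / g ^ y \<in> ifrac g"
    by (rule ifrac_divide[OF ifrac_power[OF am] ifrac_power[OF self_in_ifrac]])
  ultimately show ?thesis unfolding g_def by simp
qed

text \<open>One root is a rational function of its \<open>p\<close>-th power; the same formula holds
  for every conjugate and therefore inverts the power map on all roots.\<close>

lemma inj_on_power_roots:
  fixes F :: "int poly"
  assumes F: "irreducible F" "degree F \<ge> 1" "coeff F 0 \<noteq> 0"
    and p: "prime p" "degree F < p - 1"
  shows "inj_on (\<lambda>z. z ^ p) (iroots F)"
proof (cases "iroots F = {}")
  case False
  then obtain \<alpha> where \<alpha>: "ipoly F \<alpha> = 0" by auto
  have "\<alpha> \<noteq> 0" using \<alpha> F(3) by (auto simp: poly_0_coeff_0)
  from root_in_ifrac_power[OF F(1) \<alpha> this p] obtain w v where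
    wv: "ipoly v (\<alpha> ^ p) \<noteq> 0" "\<alpha> = ipoly w (\<alpha> ^ p) / ipoly v (\<alpha> ^ p)" by (elim ifracE)
  have "ipoly v (z ^ p) \<noteq> 0 \<and> z = ipoly w (z ^ p) / ipoly v (z ^ p)" if z: "ipoly F z = 0" for z
  proof -
    have "ipoly (v \<circ>\<^sub>p monom 1 p) z \<noteq> 0"
      using irreducible_root_transfer[OF F(1) z \<alpha>] wv(1) by (metis ipoly_pcompose_monom)
    moreover have "ipoly (monom 1 1 * (v \<circ>\<^sub>p monom 1 p) - w \<circ>\<^sub>p monom 1 p) \<alpha> = 0"
      unfolding ipoly_diff ipoly_mult ipoly_pcompose_monom using wv by (simp add: poly_monom field_simps)
    from irreducible_root_transfer[OF F(1) \<alpha> z this]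
    have "z * ipoly v (z ^ p) = ipoly w (z ^ p)"
      unfolding ipoly_diff ipoly_mult ipoly_pcompose_monom by (simp add: poly_monom)
    ultimately show ?thesis unfolding ipoly_pcompose_monom by (simp add: field_simps)
  qed
  note * = this
  show ?thesis
  proof (rule inj_onI)
    fix x y assume "x \<in> iroots F" "y \<in> iroots F" and eq: "x ^ p = y ^ p"
    then have xy: "ipoly F x = 0" "ipoly F y = 0" by simp_all
    have "x = ipoly w (x ^ p) / ipoly v (x ^ p)" using *[OF xy(1)] by (rule conjunct2)
    also have "\<dots> = ipoly w (y ^ p) / ipoly v (y ^ p)" by (simp only: eq)
    also have "\<dots> = y" using *[OF xy(2)] by (auto dest: sym)
    finally show "x = y" .
  qed
qed auto

section \<open>Vandermonde determinants\<close>

lemma trace_mult_commute: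
  fixes A B :: "'a::comm_ring_1 mat"
  assumes "A \<in> carrier_mat n n" "B \<in> carrier_mat n n"
  shows "(\<Sum>i<n. (A * B) $$ (i, i)) = (\<Sum>i<n. (B * A) $$ (i, i))"
proof -
  have "(\<Sum>i<n. (A * B) $$ (i, i)) = (\<Sum>i<n. \<Sum>j<n. A $$ (i, j) * B $$ (j, i))"
    using assms by (intro sum.cong) (auto simp: scalar_prod_def atLeast0LessThan)
  also have "\<dots> = (\<Sum>j<n. \<Sum>i<n. A $$ (i, j) * B $$ (j, i))" by (rule sum.swap)
  also have "\<dots> = (\<Sum>i<n. (B * A) $$ (i, i))"
    using assms by (intro sum.cong) (auto simp: scalar_prod_def atLeast0LessThan mult.commute)
  finally show ?thesis .
qed

text \<open>For an eigenvector \<open>v\<close>, \<open>e\<close> times the squared length of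
  \<open>v\<close> equals the squared length of the conjugate transpose of \<open>A\<close> applied
  to \<open>v\<close>.\<close>

lemma gram_eigenvalue_nonneg:
  fixes A :: "complex mat"
  assumes A: "A \<in> carrier_mat n n"
    and B: "B = mat n n (\<lambda>(i, k). \<Sum>j<n. A $$ (i, j) * cnj (A $$ (k, j)))"
    and e: "eigenvalue B e"
  shows "e = of_real (norm e)"
proof -
  have Bc: "B \<in> carrier_mat n n" by (simp add: B)
  obtain v where v: "v \<in> carrier_vec n" "v \<noteq> 0\<^sub>v n" "B *\<^sub>v v = e \<cdot>\<^sub>v v"
    using e Bc unfolding eigenvalue_def eigenvector_def by auto
  define u where "u i = vec_index v i" for i
  define w where "w j = (\<Sum>k<n. cnj (A $$ (k, j)) * u k)" for j
  have row: "(\<Sum>j<n. A $$ (i, j) * w j) = e * u i" if "i < n" for i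
  proof -
    have "e * u i = vec_index (B *\<^sub>v v) i" unfolding v(3) u_def using that v(1) by simp
    also have "\<dots> = (\<Sum>k<n. (\<Sum>j<n. A $$ (i, j) * cnj (A $$ (k, j))) * u k)"
      using that v(1) by (auto simp: B u_def scalar_prod_def atLeast0LessThan)
    also have "\<dots> = (\<Sum>k<n. \<Sum>j<n. A $$ (i, j) * (cnj (A $$ (k, j)) * u k))"
      by (simp add: sum_distrib_right mult.assoc)
    also have "\<dots> = (\<Sum>j<n. \<Sum>k<n. A $$ (i, j) * (cnj (A $$ (k, j)) * u k))" by (rule sum.swap)
    also have "\<dots> = (\<Sum>j<n. A $$ (i, j) * w j)" by (simp add: w_def sum_distrib_left)
    finally show ?thesis by simp
  qed
  have "e * (\<Sum>i<n. u i * cnj (u i)) = (\<Sum>i<n. (e * u i) * cnj (u i))"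
    by (simp add: sum_distrib_left mult.assoc)
  also have "\<dots> = (\<Sum>i<n. (\<Sum>j<n. A $$ (i, j) * w j) * cnj (u i))" using row by simp
  also have "\<dots> = (\<Sum>i<n. \<Sum>j<n. w j * (A $$ (i, j) * cnj (u i)))"
    unfolding sum_distrib_right by (intro sum.cong refl) (simp add: mult_ac)
  also have "\<dots> = (\<Sum>j<n. \<Sum>i<n. w j * (A $$ (i, j) * cnj (u i)))" by (rule sum.swap)
  also have "\<dots> = (\<Sum>j<n. w j * cnj (w j))" by (simp add: w_def sum_distrib_left)
  finally have eq: "e * (\<Sum>i<n. u i * cnj (u i)) = (\<Sum>j<n. w j * cnj (w j))" .
  define S where "S = (\<Sum>i<n. (norm (u i))\<^sup>2)"
  define T where "T = (\<Sum>i<n. (norm (w i))\<^sup>2)"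
  have "(\<Sum>i<n. u i * cnj (u i)) = of_real S" "(\<Sum>j<n. w j * cnj (w j)) = of_real T"
    by (simp_all only: S_def T_def of_real_sum complex_norm_square)
  with eq have eq: "e * of_real S = of_real T" by simp
  obtain i where i: "i < n" "u i \<noteq> 0"
    using v(1,2) unfolding u_def by (metis eq_vecI carrier_vecD index_zero_vec(1) index_zero_vec(2))
  have "0 < (norm (u i))\<^sup>2" using i by simp
  also have "\<dots> \<le> S" unfolding S_def by (rule member_le_sum) (use i in auto)
  finally have S: "S > 0" .
  have "T \<ge> 0" by (simp add: T_def sum_nonneg)
  have e: "e = of_real (T / S)" using eq S by (simp add: field_simps)
  show ?thesis unfolding e norm_of_real using S \<open>T \<ge> 0\<close> by simp
qed

text \<open>From the arithmetic-geometric mean inequality for the eigenvalues of the Gram matrix.\<close>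

lemma hadamard_bound:
  fixes A :: "complex mat"
  assumes A: "A \<in> carrier_mat n n" and n: "n > 0"
    and bd: "\<And>i j. i < n \<Longrightarrow> j < n \<Longrightarrow> norm (A $$ (i, j)) \<le> 1"
  shows "(norm (det A))\<^sup>2 \<le> real n ^ n"
proof -
  interpret cnj: comm_ring_hom cnj by unfold_locales auto
  define B where "B = mat n n (\<lambda>(i, k). \<Sum>j<n. A $$ (i, j) * cnj (A $$ (k, j)))"
  have Bc: "B \<in> carrier_mat n n" by (simp add: B_def)
  have "B = A * transpose_mat (map_mat cnj A)"
    using A by (intro eq_matI) (auto simp: B_def scalar_prod_def atLeast0LessThan intro!: sum.cong)
  then have "det B = det A * det (transpose_mat (map_mat cnj A))"
    using A by (simp add: det_mult[of _ n])
  also have "det (transpose_mat (map_mat cnj A)) = cnj (det A)"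
    using A by (subst det_transpose[of _ n]) (auto simp: cnj.hom_det)
  finally have detB: "det B = of_real ((norm (det A))\<^sup>2)" by (simp only: complex_norm_square)
  obtain es where es: "char_poly B = (\<Prod>a\<leftarrow>es. [:- a, 1:])" "length es = n"
    using char_poly_factorized[OF Bc] by blast
  obtain T P Q where TPQ: "schur_decomposition B es = (T, P, Q)" by (cases "schur_decomposition B es")
  from schur_decomposition[OF Bc es(1) TPQ] have
    sim: "similar_mat_wit B T P Q" and ut: "upper_triangular T" and diag: "diag_mat T = es" by auto
  note c = similar_mat_witD2(2,3,5-7)[OF Bc sim]
  have "det B = det T" by (rule det_similar) (use sim in \<open>auto simp: similar_mat_def\<close>)
  also have "\<dots> = prod_list es" using det_upper_triangular[OF ut c(3)] diag by simp
  finally have dB: "det B = prod_list es" .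
  \<comment> \<open>The trace is invariant under similarity. So the eigenvalues add up to the sum of
    the squared entry norms of \<open>A\<close>, which is at most \<open>n * n\<close>.\<close>
  have "(\<Sum>i<n. B $$ (i, i)) = (\<Sum>i<n. (Q * (P * T)) $$ (i, i))"
    unfolding c(2) by (intro trace_mult_commute mult_carrier_mat[OF c(4,3)] c(5))
  also have "Q * (P * T) = T"
    using assoc_mult_mat[OF c(5,4,3)] c(1) left_mult_one_mat[OF c(3)] by simp
  also have "(\<Sum>i<n. T $$ (i, i)) = (\<Sum>i<n. es ! i)"
    using c(3) by (intro sum.cong) (auto simp: diag[symmetric] diag_mat_def)
  finally have trB: "(\<Sum>i<n. B $$ (i, i)) = (\<Sum>i<n. es ! i)" .
  define r where "r i = norm (es ! i)" for i
  have r: "es ! i = of_real (r i)" if "i < n" for i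
  proof -
    have "poly (char_poly B) (es ! i) = 0"
      unfolding es(1) poly_prod_list using that es(2)
      by (auto simp: prod_list_zero_iff intro!: bexI[of _ "es ! i"])
    then have "eigenvalue B (es ! i)" using eigenvalue_root_char_poly[OF Bc] by simp
    from gram_eigenvalue_nonneg[OF A B_def this] show ?thesis unfolding r_def .
  qed
  have "prod_list es = (\<Prod>i<n. es ! i)"
    using es(2) by (simp add: prod.list_conv_set_nth atLeast0LessThan)
  also have "\<dots> = of_real (\<Prod>i<n. r i)" using r by simp
  finally have "of_real ((norm (det A))\<^sup>2) = (of_real (\<Prod>i<n. r i) :: complex)"
    using detB dB by simp
  then have det: "(norm (det A))\<^sup>2 = (\<Prod>i<n. r i)" by (simp only: of_real_eq_iff)
  have "complex_of_real (\<Sum>i<n. r i) = (\<Sum>i<n. B $$ (i, i))" using trB r by simp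
  also have "\<dots> = of_real (\<Sum>i<n. \<Sum>j<n. (norm (A $$ (i, j)))\<^sup>2)"
    unfolding of_real_sum complex_norm_square by (simp add: B_def)
  finally have "(\<Sum>i<n. r i) = (\<Sum>i<n. \<Sum>j<n. (norm (A $$ (i, j)))\<^sup>2)" by (simp only: of_real_eq_iff)
  also have "\<dots> \<le> (\<Sum>i<n. \<Sum>j<n. 1)"
    using bd by (intro sum_mono) (auto simp: power_le_one)
  finally have tr: "(\<Sum>i<n. r i) \<le> real n * real n" by simp
  have r0: "r i \<ge> 0" for i by (simp add: r_def)
  have "(\<Prod>i<n. r i) powr (1 / real n) \<le> (\<Sum>i<n. r i / real n)"
    using arith_geom_mean[of "{..<n}" r] n r0 by auto
  also have "\<dots> = (\<Sum>i<n. r i) / real n" by (simp add: sum_divide_distrib)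
  also have "\<dots> \<le> real n" using tr n by (simp add: field_simps)
  finally have "(\<Prod>i<n. r i) powr (1 / real n) \<le> real n" .
  then have b: "((\<Prod>i<n. r i) powr (1 / real n)) ^ n \<le> real n ^ n" by (intro power_mono) auto
  have pow: "(q powr (1 / real n)) ^ n = q" if "q \<ge> 0" for q
  proof (cases "q = 0")
    case True then show ?thesis using n by simp
  next
    case False
    then have "(q powr (1 / real n)) ^ n = (q powr (1 / real n)) powr real n"
      using that by (intro powr_realpow[symmetric]) auto
    then show ?thesis using n that by (simp add: powr_powr)
  qed
  have "((\<Prod>i<n. r i) powr (1 / real n)) ^ n = (\<Prod>i<n. r i)"
    by (rule pow) (intro prod_nonneg ballI r0)
  then show ?thesis using b unfolding det by (rule subst)
qed

text \<open>The two leading coefficients by Vieta. The vanishing of the higher ones is carried along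
  because the induction step needs it.\<close>

lemma coeff_prod_linear_sum:
  fixes f :: "'b \<Rightarrow> 'a::comm_ring_1"
  assumes "finite S"
  shows "coeff (\<Prod>z\<in>S. [:- f z, 1:]) (card S) = 1 \<and>
    (S \<noteq> {} \<longrightarrow> coeff (\<Prod>z\<in>S. [:- f z, 1:]) (card S - 1) = - (\<Sum>z\<in>S. f z)) \<and>
    (\<forall>i>card S. coeff (\<Prod>z\<in>S. [:- f z, 1:]) i = 0)"
  using assms
proof (induction S rule: finite_induct)
  case empty
  show ?case by simp
next
  case (insert x S)
  let ?P = "\<Prod>z\<in>S. [:- f z, 1:]"
  have P: "(\<Prod>z\<in>insert x S. [:- f z, 1:]) = smult (- f x) ?P + pCons 0 ?P"
    using insert by simp
  show ?case
  proof (cases "S = {}")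
    case True then show ?thesis by (auto simp: coeff_pCons split: nat.splits)
  next
    case False
    then obtain n where n: "card S = Suc n" using insert(1) by (metis card_eq_0_iff not0_implies_Suc)
    then show ?thesis using insert unfolding P by (auto simp: coeff_pCons split: nat.splits)
  qed
qed

text \<open>The norm of \<open>y - z ^ k\<close> is an integer polynomial in \<open>y\<close>, and
  its second coefficient is minus the power sum; Newton's identities are avoided.\<close>

lemma power_sum_roots_integral:
  fixes F :: "int poly"
  assumes F: "irreducible F" "degree F \<ge> 1" "\<bar>lead_coeff F\<bar> = 1"
  shows "\<exists>w. of_int w = (\<Sum>z\<in>iroots F. z ^ k)"
proof -
  note fac = irreducible_factorization[OF F(1,2)]
  have card: "card (iroots F) \<ge> 1" using F(2) fac(3) by simp
  define H :: "int poly poly" where "H = [:[:0, 1:]:] - monom 1 k"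
  have H: "ipoly2 H z y = y - z ^ k" for z y
  proof -
    interpret e: comm_ring_hom "\<lambda>c. ipoly c y" by (rule comm_ring_hom_ipoly)
    interpret m: map_poly_comm_ring_hom "\<lambda>c. ipoly c y" ..
    show ?thesis
      by (simp add: H_def m.hom_minus e.map_poly_hom_monom e.map_poly_pCons_hom poly_monom of_int_hom.map_poly_pCons_hom)
  qed
  obtain W where W: "\<And>y. ipoly W y = (\<Prod>z\<in>iroots F. ipoly2 H z y)"
    using norm_integral2_monic[of F "iroots F" H, OF fac(3)[symmetric] fac(2) card _ F(3)] by auto
  have "poly (of_int_poly W) = poly (\<Prod>z\<in>iroots F. [:- (z ^ k), 1:])"
    by (rule ext) (simp add: W H poly_prod algebra_simps)
  then have "of_int_poly W = (\<Prod>z\<in>iroots F. [:- (z ^ k), 1:])" by (simp add: poly_eq_poly_eq_iff)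
  then have "coeff (of_int_poly W) (card (iroots F) - 1) = - (\<Sum>z\<in>iroots F. z ^ k)"
    using coeff_prod_linear_sum[OF fac(2), of "\<lambda>z. z ^ k"] card by auto
  then have "of_int (- coeff W (card (iroots F) - 1)) = (\<Sum>z\<in>iroots F. z ^ k)" by simp
  then show ?thesis by blast
qed

text \<open>The squared determinant is the discriminant, the determinant of a matrix of power sums,
  and hence a nonzero integer.\<close>

lemma vandermonde_norm_ge_1:
  fixes zs :: "nat \<Rightarrow> complex"
  assumes inj: "inj_on zs {..<n}" and int: "\<And>k. \<exists>w. of_int w = (\<Sum>i<n. zs i ^ k)"
  shows "norm (det (mat n n (\<lambda>(i, l). zs i ^ l))) \<ge> 1"
proof -
  let ?V = "mat n n (\<lambda>(i, l). zs i ^ l)"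
  obtain w where w: "\<And>k. of_int (w k) = (\<Sum>i<n. zs i ^ k)" using int by metis
  define M where "M = mat n n (\<lambda>(i, j). w (i + j))"
  have "transpose_mat ?V * ?V = map_mat of_int M"
    by (intro eq_matI) (auto simp: M_def w scalar_prod_def atLeast0LessThan power_add)
  then have eq: "det ?V * det ?V = of_int (det M)"
    using det_mult[of "transpose_mat ?V" n ?V] det_transpose[of ?V n] by (simp add: of_int_hom.hom_det)
  then have "norm (det ?V) * norm (det ?V) = of_int \<bar>det M\<bar>"
    unfolding norm_mult[symmetric] by (simp only: norm_of_int)
  moreover have "det M \<noteq> 0"
    using det_vandermonde_nonzero[OF inj] eq by auto
  ultimately have sq: "1 \<le> norm (det ?V) * norm (det ?V)" by simp
  show ?thesis
  proof (rule ccontr)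
    assume "\<not> 1 \<le> norm (det ?V)"
    then have lt: "norm (det ?V) < 1" by simp
    have "norm (det ?V) * norm (det ?V) \<le> norm (det ?V) * 1"
      by (rule mult_left_mono) (use lt in auto)
    with sq lt show False by linarith
  qed
qed

text \<open>Dividing row \<open>i\<close> by \<open>max 1 (norm (zs i)) ^ (n - 1)\<close> brings all
  entries into the unit disc, where \<open>hadamard_bound\<close> applies.\<close>

lemma vandermonde_bound:
  fixes zs :: "nat \<Rightarrow> complex"
  assumes n: "n > 0"
  shows "(norm (det (mat n n (\<lambda>(i, l). zs i ^ l))))\<^sup>2 \<le> real n ^ n * ((\<Prod>i<n. max 1 (norm (zs i))) ^ (n - 1))\<^sup>2"
proof -
  let ?V = "mat n n (\<lambda>(i, l). zs i ^ l)"
  define c where "c i = max 1 (norm (zs i)) ^ (n - 1)" for i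
  have c: "c i > 0" for i by (simp add: c_def)
  define A where "A = mat n n (\<lambda>(i, l). zs i ^ l / of_real (c i))"
  define N where "N = mat n n (\<lambda>(i, j). if i = j then complex_of_real (c i) else 0)"
  have "?V = N * A"
  proof (rule eq_matI)
    fix i j assume "i < dim_row (N * A)" "j < dim_col (N * A)"
    then have ij: "i < n" "j < n" by (auto simp: N_def A_def)
    have "(N * A) $$ (i, j) = (\<Sum>l\<in>{0..<n}. (if i = l then complex_of_real (c i) else 0) * (zs l ^ j / of_real (c l)))"
      using ij by (simp add: N_def A_def scalar_prod_def)
    also have "\<dots> = (\<Sum>l\<in>{0..<n}. if i = l then complex_of_real (c l) * (zs l ^ j / of_real (c l)) else 0)"
      by (intro sum.cong) auto
    also have "\<dots> = zs i ^ j" using ij c[of i] by simp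
    finally show "?V $$ (i, j) = (N * A) $$ (i, j)" using ij by simp
  qed (auto simp: N_def A_def)
  then have "det ?V = det N * det A" by (simp add: det_mult[of _ n] N_def A_def)
  also have "det N = prod_list (diag_mat N)"
    by (rule det_upper_triangular) (auto simp: N_def upper_triangular_def)
  also have "diag_mat N = map (\<lambda>i. complex_of_real (c i)) [0..<n]" by (auto simp: diag_mat_def N_def)
  also have "prod_list \<dots> = of_real (\<Prod>i<n. c i)"
    by (simp add: prod.distinct_set_conv_list[symmetric] atLeast0LessThan)
  finally have "norm (det ?V) = (\<Prod>i<n. c i) * norm (det A)"
    using c by (simp add: norm_mult prod_nonneg less_imp_le flip: prod_norm)
  moreover have "(norm (det A))\<^sup>2 \<le> real n ^ n"
  proof (rule hadamard_bound)
    fix i j assume ij: "i < n" "j < n"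
    have "norm (zs i) ^ j \<le> max 1 (norm (zs i)) ^ j" by (intro power_mono) auto
    also have "\<dots> \<le> c i" unfolding c_def using ij by (intro power_increasing) auto
    finally show "norm (A $$ (i, j)) \<le> 1"
      using ij c[of i] by (simp add: A_def norm_divide norm_power)
  qed (auto simp: A_def n)
  moreover have "(\<Prod>i<n. c i) = (\<Prod>i<n. max 1 (norm (zs i))) ^ (n - 1)"
    by (simp add: c_def prod_power_distrib)
  ultimately show ?thesis by (simp add: power_mult_distrib mult.commute mult_right_mono)
qed

text \<open>Column operations replace the monomials \<open>x ^ (D + j)\<close> by \<open>x ^ j F\<close>; this makes the matrix
  block triangular.\<close>

lemma det_double_vandermonde:
  fixes F :: "complex poly" and xs ys :: "nat \<Rightarrow> complex"
  assumes F: "degree F = D" "lead_coeff F = 1" and xs: "\<And>i. i < D \<Longrightarrow> poly F (xs i) = 0"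
  shows "det (mat (D + D) (D + D) (\<lambda>(i, l). (if i < D then xs i else ys (i - D)) ^ l)) =
    det (mat D D (\<lambda>(i, l). xs i ^ l)) * ((\<Prod>i<D. poly F (ys i)) * det (mat D D (\<lambda>(i, l). ys i ^ l)))"
proof -
  define pt where "pt i = (if i < D then xs i else ys (i - D))" for i
  define b where "b k = (if k < D then monom 1 k else monom 1 (k - D) * F)" for k
  let ?V = "mat (D + D) (D + D) (\<lambda>(i, l). pt i ^ l)"
  define U where "U = mat (D + D) (D + D) (\<lambda>(l, k). coeff (b k) l)"
  define A1 where "A1 = mat D D (\<lambda>(i, l). xs i ^ l)"
  define A3 where "A3 = mat D D (\<lambda>(i, l). ys i ^ l)"
  define A4 where "A4 = mat D D (\<lambda>(i, l). poly F (ys i) * ys i ^ l)"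
  define N where "N = mat D D (\<lambda>(i, j). if i = j then poly F (ys i) else 0)"
  have F0: "F \<noteq> 0" using F(2) by auto
  have db: "degree (b k) = k" "coeff (b k) k = 1" for k
  proof -
    show "degree (b k) = k"
      using F F0 by (auto simp: b_def degree_monom_eq degree_mult_eq monom_eq_0_iff)
    show "coeff (b k) k = 1" using F by (auto simp: b_def coeff_monom_mult)
  qed
  have "det U = prod_list (diag_mat U)"
    by (rule det_upper_triangular) (auto simp: U_def upper_triangular_def coeff_eq_0 db)
  also have "diag_mat U = map (\<lambda>i. 1) [0..<D + D]" by (auto simp: diag_mat_def U_def db)
  also have "prod_list (map (\<lambda>i. 1 :: complex) ns) = 1" for ns :: "nat list" by (induction ns) auto
  finally have U: "det U = 1" .
  have "?V * U = four_block_mat A1 (0\<^sub>m D D) A3 A4"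
  proof (rule eq_matI)
    fix i k assume "i < dim_row (four_block_mat A1 (0\<^sub>m D D) A3 A4)" "k < dim_col (four_block_mat A1 (0\<^sub>m D D) A3 A4)"
    then have ik: "i < D + D" "k < D + D" by (auto simp: A1_def A4_def)
    have "(?V * U) $$ (i, k) = (\<Sum>l<D + D. coeff (b k) l * pt i ^ l)"
      using ik by (simp add: U_def scalar_prod_def atLeast0LessThan mult.commute)
    also have "\<dots> = poly (b k) (pt i)" using ik by (intro poly_eq_sum_lessThan[symmetric]) (simp add: db)
    also have "\<dots> = four_block_mat A1 (0\<^sub>m D D) A3 A4 $$ (i, k)"
      using ik xs by (auto simp: b_def pt_def A1_def A3_def A4_def poly_monom mult.commute)
    finally show "(?V * U) $$ (i, k) = four_block_mat A1 (0\<^sub>m D D) A3 A4 $$ (i, k)" .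
  qed (auto simp: U_def A1_def A4_def)
  then have "det (?V * U) = det A1 * det A4"
    by (simp only:) (rule det_four_block_mat_upper_right_zero[of _ D _ D], auto simp: A1_def A3_def A4_def)
  moreover have "det (?V * U) = det ?V" using U by (simp add: det_mult[of _ "D + D"] U_def)
  moreover have "det A4 = (\<Prod>i<D. poly F (ys i)) * det A3"
  proof -
    have "A4 = N * A3"
    proof (rule eq_matI)
      fix i j assume "i < dim_row (N * A3)" "j < dim_col (N * A3)"
      then have ij: "i < D" "j < D" by (auto simp: N_def A3_def)
      have "(N * A3) $$ (i, j) = (\<Sum>l\<in>{0..<D}. (if i = l then poly F (ys i) else 0) * ys l ^ j)"
        using ij by (simp add: N_def A3_def scalar_prod_def)
      also have "\<dots> = (\<Sum>l\<in>{0..<D}. if i = l then poly F (ys l) * ys l ^ j else 0)"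
        by (intro sum.cong) auto
      also have "\<dots> = poly F (ys i) * ys i ^ j" using ij by simp
      finally show "A4 $$ (i, j) = (N * A3) $$ (i, j)" using ij by (simp add: A4_def)
    qed (auto simp: N_def A3_def A4_def)
    then have "det A4 = det N * det A3" by (simp add: det_mult[of _ D] N_def A3_def)
    also have "det N = prod_list (diag_mat N)"
      by (rule det_upper_triangular) (auto simp: N_def upper_triangular_def)
    also have "diag_mat N = map (\<lambda>i. poly F (ys i)) [0..<D]" by (auto simp: diag_mat_def N_def)
    also have "prod_list \<dots> = (\<Prod>i<D. poly F (ys i))"
      by (simp add: prod.distinct_set_conv_list[symmetric] atLeast0LessThan)
    finally show ?thesis .
  qed
  ultimately show ?thesis unfolding pt_def A1_def A3_def by simp
qed

text \<open>If \<open>z ^ p\<close> were conjugate to \<open>z\<close>, so would be all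
  \<open>z ^ (p ^ k)\<close>. Two of these finitely many numbers coincide, which makes
  \<open>z\<close> a root of unity.\<close>

lemma irreducible_power_not_root:
  fixes F :: "int poly"
  assumes F: "irreducible F" "degree F \<ge> 1" "coeff F 0 \<noteq> 0"
    and nr: "\<And>z n. ipoly F z = 0 \<Longrightarrow> n > 0 \<Longrightarrow> z ^ n \<noteq> 1"
    and p: "p > 1" and z: "ipoly F z = 0"
  shows "ipoly F (z ^ p) \<noteq> 0"
proof
  assume zp: "ipoly F (z ^ p) = 0"
  have step: "ipoly F (w ^ p) = 0" if "ipoly F w = 0" for w
    using irreducible_root_transfer[OF F(1) z that, of "F \<circ>\<^sub>p monom 1 p"] zp
    unfolding ipoly_pcompose_monom by blast
  have it: "ipoly F (z ^ (p ^ k)) = 0" for k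
  proof (induction k)
    case 0 show ?case using z by simp
  next
    case (Suc k)
    from step[OF Suc] show ?case by (simp add: power_mult[symmetric] mult.commute)
  qed
  have "\<not> inj (\<lambda>k. z ^ (p ^ k))"
  proof
    assume "inj (\<lambda>k. z ^ (p ^ k))"
    moreover have "range (\<lambda>k. z ^ (p ^ k)) \<subseteq> iroots F" using it by auto
    ultimately show False
      using irreducible_factorization(2)[OF F(1,2)] finite_subset range_inj_infinite by blast
  qed
  then obtain i j where ij: "i < j" "z ^ (p ^ i) = z ^ (p ^ j)"
    by (metis injI linorder_neqE_nat)
  have z0: "z \<noteq> 0" using z F(3) by (auto simp: poly_0_coeff_0)
  have lt: "p ^ i < p ^ j" using ij(1) p by (simp add: power_strict_increasing)
  then have "z ^ (p ^ j - p ^ i) = 1" using ij(2) z0 by (simp add: power_diff)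
  with nr[OF z] lt show False by auto
qed

lemma mahler_prime_bound:
  fixes F :: "int poly"
  assumes F: "irreducible F" "degree F \<ge> 1" "coeff F 0 \<noteq> 0" "lead_coeff F = 1"
    and nr: "\<And>z n. ipoly F z = 0 \<Longrightarrow> n > 0 \<Longrightarrow> z ^ n \<noteq> 1"
    and p: "prime p" "degree F < p - 1"
    and D: "D = degree F" and M: "M = (\<Prod>z\<in>iroots F. max 1 (norm z))"
  shows "real p ^ (2 * D) \<le> real (2 * D) ^ (2 * D) * (M ^ ((2 * D - 1) * (p + 1)))\<^sup>2"
proof -
  note fac = irreducible_factorization[OF F(1,2)]
  have cD: "card (iroots F) = D" using fac(3) D by simp
  have D1: "D \<ge> 1" using F(2) D by simp
  obtain xs where xs: "bij_betw xs {..<D} (iroots F)"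
    using ex_bij_betw_nat_finite[OF fac(2)] cD by (auto simp: atLeast0LessThan)
  define ys where "ys i = xs i ^ p" for i
  have xr: "ipoly F (xs i) = 0" if "i < D" for i using xs that by (auto simp: bij_betw_def)
  have injx: "inj_on xs {..<D}" using xs by (auto simp: bij_betw_def)
  have "inj_on ((\<lambda>z. z ^ p) \<circ> xs) {..<D}"
    using inj_on_power_roots[OF F(1-3) p] xs by (intro comp_inj_on) (auto simp: bij_betw_def)
  then have injy: "inj_on ys {..<D}" unfolding ys_def o_def .
  have a: "\<bar>lead_coeff F\<bar> = 1" using F(4) by simp
  have sumx: "(\<Sum>i<D. g (xs i)) = (\<Sum>z\<in>iroots F. g z)" for g :: "complex \<Rightarrow> complex"
    by (rule sum.reindex_bij_betw[OF xs])
  have prodx: "(\<Prod>i<D. g (xs i)) = (\<Prod>z\<in>iroots F. g z)" for g :: "complex \<Rightarrow> 'b::comm_monoid_mult"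
    by (rule prod.reindex_bij_betw[OF xs])
  define pt where "pt i = (if i < D then xs i else ys (i - D))" for i
  let ?V = "mat (D + D) (D + D) (\<lambda>(i, l). pt i ^ l)"
  have "det ?V = det (mat D D (\<lambda>(i, l). xs i ^ l)) *
      ((\<Prod>i<D. ipoly F (ys i)) * det (mat D D (\<lambda>(i, l). ys i ^ l)))"
    unfolding pt_def by (rule det_double_vandermonde) (use F(4) D xr in auto)
  moreover have "norm (det (mat D D (\<lambda>(i, l). xs i ^ l))) \<ge> 1"
  proof (rule vandermonde_norm_ge_1[OF injx])
    fix k
    show "\<exists>w. of_int w = (\<Sum>i<D. xs i ^ k)"
      unfolding sumx[of "\<lambda>z. z ^ k"] by (rule power_sum_roots_integral[OF F(1,2) a])
  qed
  moreover have "norm (det (mat D D (\<lambda>(i, l). ys i ^ l))) \<ge> 1"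
  proof (rule vandermonde_norm_ge_1[OF injy])
    fix k
    have "(\<Sum>i<D. ys i ^ k) = (\<Sum>z\<in>iroots F. z ^ (p * k))"
      unfolding sumx[symmetric] ys_def by (simp add: power_mult)
    then show "\<exists>w. of_int w = (\<Sum>i<D. ys i ^ k)" using power_sum_roots_integral[OF F(1,2) a] by metis
  qed
  moreover have "norm (\<Prod>i<D. ipoly F (ys i)) \<ge> real p ^ D"
  proof -
    have "card (iroots F) \<ge> 1" "\<And>z. z \<in> iroots F \<Longrightarrow> ipoly F z = 0" using cD D1 by auto
    from norm_frobenius_dvd[OF p(1) fac(3)[symmetric] fac(2) this a] obtain w where
      w: "of_int (int p ^ D * w) = (\<Prod>z\<in>iroots F. ipoly F (z ^ p))" unfolding cD by blast
    have "(\<Prod>i<D. ipoly F (ys i)) = of_int (int p ^ D * w)" unfolding w ys_def by (rule prodx)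
    then have eq: "norm (\<Prod>i<D. ipoly F (ys i)) = real p ^ D * \<bar>real_of_int w\<bar>"
      by (simp only: norm_of_int) (simp add: abs_mult)
    have "(\<Prod>i<D. ipoly F (ys i)) \<noteq> 0"
      using irreducible_power_not_root[OF F(1-3) nr prime_gt_1_nat[OF p(1)]] xr by (auto simp: ys_def)
    then have "w \<noteq> 0" using eq by auto
    then have "\<bar>real_of_int w\<bar> \<ge> 1" by linarith
    then show ?thesis unfolding eq using mult_left_mono[of 1 "\<bar>real_of_int w\<bar>" "real p ^ D"] by simp
  qed
  ultimately have lower: "real p ^ D \<le> norm (det ?V)"
    using mult_mono[of 1 "norm (det (mat D D (\<lambda>(i, l). xs i ^ l)))" "real p ^ D"
        "norm (\<Prod>i<D. ipoly F (ys i)) * norm (det (mat D D (\<lambda>(i, l). ys i ^ l)))"]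
      mult_mono[of "real p ^ D" "norm (\<Prod>i<D. ipoly F (ys i))" 1 "norm (det (mat D D (\<lambda>(i, l). ys i ^ l)))"]
    by (simp add: norm_mult)
  \<comment> \<open>The roots contribute \<open>M\<close> and their \<open>p\<close>-th powers
    \<open>M ^ p\<close>; this is the origin of the exponent \<open>p + 1\<close>.\<close>
  have "(\<Prod>i<D + D. max 1 (norm (pt i))) = (\<Prod>i<D. max 1 (norm (xs i))) * (\<Prod>i<D. max 1 (norm (ys i)))"
  proof -
    have "(\<Prod>i<D + n. f i) = (\<Prod>i<D. f i) * (\<Prod>i<n. f (D + i))" for f :: "nat \<Rightarrow> real" and n
      by (induction n) (simp_all add: mult.assoc)
    then show ?thesis by (simp add: pt_def)
  qed
  also have "(\<Prod>i<D. max 1 (norm (ys i))) = (\<Prod>i<D. max 1 (norm (xs i))) ^ p"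
  proof -
    have "max 1 (r ^ p) = max 1 r ^ p" if "r \<ge> 0" for r :: real
      using that by (cases "r \<le> 1") (auto simp: max_def power_le_one one_le_power intro: antisym)
    then show ?thesis by (simp add: ys_def norm_power prod_power_distrib)
  qed
  also have "(\<Prod>i<D. max 1 (norm (xs i))) = M" unfolding M by (rule prodx)
  finally have pM: "(\<Prod>i<D + D. max 1 (norm (pt i))) = M ^ (p + 1)" by simp
  have "real p ^ (2 * D) = (real p ^ D)\<^sup>2" by (simp add: power_mult[symmetric] mult.commute)
  also have "\<dots> \<le> (norm (det ?V))\<^sup>2" using lower by (intro power_mono) auto
  also have "\<dots> \<le> real (D + D) ^ (D + D) * ((M ^ (p + 1)) ^ (D + D - 1))\<^sup>2"
    unfolding pM[symmetric] by (rule vandermonde_bound) (use D1 in auto)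
  also have "\<dots> = real (2 * D) ^ (2 * D) * (M ^ ((2 * D - 1) * (p + 1)))\<^sup>2"
    unfolding mult_2[symmetric] power_mult[symmetric] by (simp only: mult.commute)
  finally show ?thesis .
qed

text \<open>After rounding \<open>2 * D - 1\<close> up to \<open>2 * D\<close>, a
  \<open>2 * D\<close>-th root can be taken, and the degree survives only in the quotient
  \<open>p / (2 * D)\<close>.\<close>

lemma mahler_log_prime_bound:
  fixes F :: "int poly"
  assumes F: "irreducible F" "degree F \<ge> 1" "coeff F 0 \<noteq> 0" "lead_coeff F = 1"
    and nr: "\<And>z n. ipoly F z = 0 \<Longrightarrow> n > 0 \<Longrightarrow> z ^ n \<noteq> 1"
    and p: "prime p" "degree F < p - 1"
    and M: "M = (\<Prod>z\<in>iroots F. max 1 (norm z))"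
  shows "ln (real p / real (2 * degree F)) \<le> 2 * real (p + 1) * ln M"
proof -
  define D where "D = degree F"
  have D1: "D \<ge> 1" using F(2) by (simp add: D_def)
  have M1: "M \<ge> 1" unfolding M by (rule prod_ge_1) auto
  have p0: "real p > 0" using p(1) prime_gt_0_nat by auto
  have "real p ^ (2 * D) \<le> real (2 * D) ^ (2 * D) * (M ^ ((2 * D - 1) * (p + 1)))\<^sup>2"
    using mahler_prime_bound[OF F nr p D_def M] by simp
  then have "ln (real p ^ (2 * D)) \<le> ln (real (2 * D) ^ (2 * D) * (M ^ ((2 * D - 1) * (p + 1)))\<^sup>2)"
    using p0 D1 M1 by (subst ln_le_cancel_iff) auto
  also have "\<dots> = real (2 * D) * ln (real (2 * D)) + 2 * (real ((2 * D - 1) * (p + 1)) * ln M)"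
  proof -
    have lnc: "ln (c ^ m * (M ^ n)\<^sup>2) = real m * ln c + 2 * (real n * ln M)" if "c > 0" for c m n
      using that M1 by (simp add: ln_mult_pos ln_realpow power_mult[symmetric])
    show ?thesis by (rule lnc) (use D1 in simp)
  qed
  finally have "real (2 * D) * ln (real p) \<le> real (2 * D) * ln (real (2 * D)) + 2 * (real ((2 * D - 1) * (p + 1)) * ln M)"
    using p0 by (simp add: ln_realpow)
  also have "\<dots> \<le> real (2 * D) * ln (real (2 * D)) + 2 * (real (2 * D * (p + 1)) * ln M)"
  proof -
    have "real ((2 * D - 1) * (p + 1)) \<le> real (2 * D * (p + 1))"
      by (intro of_nat_mono mult_le_mono1) simp
    then show ?thesis using M1 by (intro add_left_mono mult_left_mono mult_right_mono) auto
  qed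
  also have "\<dots> = real (2 * D) * (ln (real (2 * D)) + 2 * real (p + 1) * ln M)"
    by (simp add: algebra_simps)
  finally have "ln (real p) \<le> ln (real (2 * D)) + 2 * real (p + 1) * ln M"
    using D1 by (subst (asm) mult_le_cancel_left_pos) auto
  then show ?thesis using p0 D1 by (simp add: ln_div D_def)
qed

section \<open>Primes in intervals\<close>

text \<open>The entries \<open>1 / ((n + 1) (n choose k))\<close> of the Leibniz harmonic triangle are integer
  combinations of \<open>1, 1/2, \<dots>, 1/(n + 1)\<close>.\<close>

lemma leibniz_triangle_dvd:
  assumes "\<And>j. 1 \<le> j \<Longrightarrow> j \<le> Suc n \<Longrightarrow> j dvd m" "k \<le> n" "m > 0"
  shows "Suc n * (n choose k) dvd m"
proof -
  have "\<exists>w. of_int w = real m / (real (Suc n) * real (n choose k))"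
    using assms(1,2)
  proof (induction k arbitrary: n)
    case 0
    then have "Suc n dvd m" by auto
    then obtain q where "m = Suc n * q" by (elim dvdE)
    then show ?case by (intro exI[of _ "int q"]) (simp add: field_simps)
  next
    case (Suc k)
    then obtain n' where n: "n = Suc n'" by (cases n) auto
    have k: "k \<le> n'" using Suc n by simp
    obtain w1 where w1: "of_int w1 = real m / (real (Suc n') * real (n' choose k))"
      using Suc.IH[of n'] Suc.prems n by auto
    obtain w2 where w2: "of_int w2 = real m / (real (Suc n) * real (n choose k))"
      using Suc.IH[of n] Suc.prems by auto
    have c1: "real (Suc k) * real (n choose Suc k) = real (Suc n') * real (n' choose k)"
      unfolding n of_nat_mult[symmetric] by (simp only: Suc_times_binomial_eq mult.commute)
    have "real (Suc n' - k) * real (n choose k) = real (Suc n') * real (n' choose k)"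
      unfolding n of_nat_mult[symmetric]
      by (metis binomial_absorb_comp diff_Suc_1)
    then have c2: "(real (Suc n') - real k) * real (n choose k) = real (Suc n') * real (n' choose k)"
      using k by (simp add: of_nat_diff)
    define a where "a = real (n choose Suc k)"
    define b where "b = real (n choose k)"
    define c where "c = real (n' choose k)"
    have pos: "a > 0" "b > 0" "c > 0"
      unfolding a_def b_def c_def of_nat_0_less_iff
      by (rule zero_less_binomial, use Suc.prems n k in simp)+
    have rel: "real (Suc k) * a = real (Suc n') * c" "(real (Suc n') - real k) * b = real (Suc n') * c"
      using c1 c2 by (auto simp: a_def b_def c_def)
    have "real m / (real (Suc n) * a) = real m / (real (Suc n') * c) - real m / (real (Suc n) * b)"
    proof -
      have "1 / a = real (Suc k) / (real (Suc n') * c)" unfolding rel(1)[symmetric] using pos by simp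
      moreover have "1 / b = (real (Suc n') - real k) / (real (Suc n') * c)"
        unfolding rel(2)[symmetric] using pos k by simp
      ultimately have "1 / a + 1 / b = (real (Suc k) + (real (Suc n') - real k)) / (real (Suc n') * c)"
        by (simp only: add_divide_distrib)
      then have ab: "1 / a + 1 / b = real (Suc n) / (real (Suc n') * c)" by (simp add: n)
      define S where "S = real (Suc n)"
      have S: "S > 0" by (simp add: S_def)
      have "real m / (S * a) + real m / (S * b) = real m / S * (1 / a + 1 / b)"
        by (simp add: distrib_left)
      also have "\<dots> = real m / (real (Suc n') * c)" unfolding ab S_def[symmetric] using S by simp
      finally show ?thesis unfolding S_def[symmetric] by linarith
    qed
    then show ?case using w1 w2 by (intro exI[of _ "w1 - w2"]) (simp add: a_def b_def c_def)
  qed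
  then obtain w where w: "of_int w = real m / (real (Suc n) * real (n choose k))" by blast
  have pos: "real (Suc n * (n choose k)) > 0"
    unfolding of_nat_0_less_iff using assms(2) by (simp only: nat_0_less_mult_iff zero_less_binomial) simp
  define N where "N = real (Suc n * (n choose k))"
  have "of_int w * N = real m" using pos unfolding w of_nat_mult[symmetric] N_def[symmetric] by simp
  then have "of_int (w * int (Suc n * (n choose k))) = (of_int (int m) :: real)"
    unfolding N_def by simp
  then have "w * int (Suc n * (n choose k)) = int m" by (simp only: of_int_eq_iff)
  then have "int (Suc n * (n choose k)) dvd int m" by (metis dvd_triv_right)
  then show ?thesis by (simp only: of_nat_dvd_iff)
qed

text \<open>Every \<open>Suc n * (n choose k)\<close> is at most \<open>m\<close>; summing over the
  row gives \<open>Suc n * 2 ^ n \<le> Suc n * m\<close>.\<close>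

lemma common_multiple_ge_power2:
  assumes "\<And>j. 1 \<le> j \<Longrightarrow> j \<le> Suc n \<Longrightarrow> j dvd m" "m > 0"
  shows "2 ^ n \<le> m"
proof -
  have le: "Suc n * (n choose k) \<le> m" if "k \<le> n" for k
    using leibniz_triangle_dvd[OF assms(1) that assms(2)] assms(2) by (simp add: dvd_imp_le)
  have "Suc n * 2 ^ n = (\<Sum>k\<le>n. Suc n * (n choose k))"
    by (simp add: choose_row_sum[symmetric] sum_distrib_left)
  also have "\<dots> \<le> (\<Sum>k\<le>n. m)" using le by (intro sum_mono) auto
  also have "\<dots> = Suc n * m" by simp
  finally show ?thesis by (simp only: Suc_mult_le_cancel1)
qed

text \<open>Chebyshev's argument: the product of the largest prime powers not exceeding
  \<open>n + 1\<close> is a common multiple of \<open>1, ..., n + 1\<close>, and each prime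
  contributes at most \<open>n + 1\<close> to it.\<close>

lemma power2_le_power_card_primes:
  assumes "n \<ge> 1"
  shows "2 ^ n \<le> Suc n ^ card {p. prime p \<and> p \<le> Suc n}"
proof -
  let ?P = "{p::nat. prime p \<and> p \<le> Suc n}"
  have fin: "finite ?P" by simp
  define e where "e p = (GREATEST k. p ^ k \<le> Suc n)" for p :: nat
  have e: "p ^ e p \<le> Suc n" and emax: "\<And>k. p ^ k \<le> Suc n \<Longrightarrow> k \<le> e p" if "p \<in> ?P" for p
  proof -
    have p: "p \<ge> 2" using that prime_ge_2_nat by auto
    have b: "k \<le> Suc n" if "p ^ k \<le> Suc n" for k
      using that p self_le_ge2_pow[of p k] by linarith
    show "p ^ e p \<le> Suc n" unfolding e_def by (rule GreatestI_nat[of _ 0 "Suc n"]) (use b in auto)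
    show "k \<le> e p" if "p ^ k \<le> Suc n" for k
      unfolding e_def by (rule Greatest_le_nat[of _ _ "Suc n"]) (use b that in auto)
  qed
  define m where "m = (\<Prod>p\<in>?P. p ^ e p)"
  have m0: "m > 0" unfolding m_def by (intro prod_pos) (auto dest: prime_gt_0_nat)
  have "j dvd m" if j: "1 \<le> j" "j \<le> Suc n" for j
  proof (rule multiplicity_le_imp_dvd)
    show "j \<noteq> 0" using j by simp
    fix p :: nat assume p: "prime p"
    show "multiplicity p j \<le> multiplicity p m"
    proof (cases "p dvd j")
      case False then show ?thesis by (simp add: not_dvd_imp_multiplicity_0)
    next
      case True
      then have pP: "p \<in> ?P" using p j dvd_imp_le[of p j] by auto
      have "p ^ multiplicity p j \<le> j" using j by (intro dvd_imp_le multiplicity_dvd) auto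
      then have "multiplicity p j \<le> e p" using j by (intro emax[OF pP]) auto
      moreover have "p ^ e p dvd m" unfolding m_def using pP fin by (intro dvd_prodI) auto
      ultimately have "multiplicity p j \<le> e p" "e p \<le> multiplicity p m"
        using m0 p prime_gt_1_nat[OF p] by (simp_all add: multiplicity_geI)
      then show ?thesis by simp
    qed
  qed
  then have "2 ^ n \<le> m" by (rule common_multiple_ge_power2[OF _ m0])
  also have "\<dots> \<le> (\<Prod>p\<in>?P. Suc n)" unfolding m_def using e by (intro prod_mono) auto
  also have "\<dots> = Suc n ^ card ?P" by simp
  finally show ?thesis .
qed

lemma card_primes_le_half:
  "card {p::nat. prime p \<and> p \<le> 2 * m} \<le> max 1 m"
proof (cases "m \<le> 1")
  case True
  have "{p::nat. prime p \<and> p \<le> 2 * m} \<subseteq> {2}" using True by (auto dest: prime_ge_2_nat)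
  then have "card {p::nat. prime p \<and> p \<le> 2 * m} \<le> 1" using card_mono[of "{2::nat}"] by fastforce
  then show ?thesis by simp
next
  case False
  have "{p::nat. prime p \<and> p \<le> 2 * m} \<subseteq> insert 2 ((\<lambda>i. 2 * i + 1) ` {1..<m})"
  proof
    fix p assume p: "p \<in> {p::nat. prime p \<and> p \<le> 2 * m}"
    show "p \<in> insert 2 ((\<lambda>i. 2 * i + 1) ` {1..<m})"
    proof (cases "p = 2")
      case False
      have pr: "prime p" using p by simp
      have "2 < p" using prime_ge_2_nat[OF pr] False by simp
      then have "odd p" by (rule prime_odd_nat[OF pr])
      then obtain i where "p = 2 * i + 1" by (elim oddE)
      moreover have "p \<ge> 2" using p prime_ge_2_nat by blast
      ultimately show ?thesis using p by auto
    qed simp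
  qed
  then have "card {p::nat. prime p \<and> p \<le> 2 * m} \<le> card (insert 2 ((\<lambda>i. 2 * i + 1) ` {1..<m}))"
    by (rule card_mono[rotated]) simp
  also have "\<dots> \<le> Suc (card ((\<lambda>i. 2 * i + 1) ` {1..<m}))" by (rule card_insert_le_m1) simp_all
  also have "card ((\<lambda>i::nat. 2 * i + 1) ` {1..<m}) \<le> m - 1" using card_image_le[of "{1..<m}"] by simp
  finally show ?thesis using False by simp
qed

text \<open>Without such a prime, all primes up to \<open>n + 1\<close> lie below
  \<open>2 * m\<close>. They number at most \<open>m\<close>, since apart from 2 they are odd and 1
  is not among them.\<close>

lemma exists_prime_between:
  assumes "n \<ge> 1" "m \<ge> 1" "real (Suc n) ^ m < 2 ^ n"
  shows "\<exists>p. prime p \<and> 2 * m < p \<and> p \<le> Suc n"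
proof (rule ccontr)
  assume no: "\<not> ?thesis"
  have "{p. prime p \<and> p \<le> Suc n} \<subseteq> {p::nat. prime p \<and> p \<le> 2 * m}"
  proof (rule subsetI)
    fix p assume "p \<in> {p. prime p \<and> p \<le> Suc n}"
    then show "p \<in> {p::nat. prime p \<and> p \<le> 2 * m}" using no by (cases "2 * m < p") auto
  qed
  then have "card {p. prime p \<and> p \<le> Suc n} \<le> card {p::nat. prime p \<and> p \<le> 2 * m}"
    by (rule card_mono[rotated]) simp
  also have "\<dots> \<le> m" using card_primes_le_half[of m] assms(2) by simp
  finally have "Suc n ^ card {p. prime p \<and> p \<le> Suc n} \<le> Suc n ^ m" by (intro power_increasing) auto
  then have "2 ^ n \<le> Suc n ^ m" using power2_le_power_card_primes[OF assms(1)] by linarith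
  then have "real (2 ^ n) \<le> real (Suc n ^ m)" by (rule of_nat_mono)
  then show False using assms(3) by simp
qed

section \<open>Lower bound for the Mahler measure\<close>

lemma ln_2_ge: "ln (2::real) \<ge> 693/1000"
  using ln_approx_bounds[of 2 4] by (simp add: eval_nat_numeral)

lemma ln_3_ge: "ln (3::real) \<ge> 1098/1000"
  using ln_approx_bounds[of 3 6] by (simp add: eval_nat_numeral)

lemma ln_ge_pade:
  assumes "x > 1" shows "ln x \<ge> 2 * (x - 1) / (x + 1 :: real)"
  using ln_approx_bounds[OF assms, of 1] by simp

lemma ln_6_ge: "ln (6::real) \<ge> 1791/1000"
proof -
  have "ln (6::real) = ln 2 + ln 3" using ln_mult_pos[of 2 "3::real"] by simp
  then show ?thesis using ln_2_ge ln_3_ge by linarith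
qed

text \<open>35 and 40 lie close to \<open>32 = 2 ^ 5\<close>, so the crude rational bound is applied
  only to a factor close to 1.\<close>

lemma ln_32_times_ge: "y > 1 \<Longrightarrow> ln (32 * y) \<ge> 3465/1000 + 2 * (y - 1) / (y + 1 :: real)"
proof -
  assume y: "y > 1"
  have "ln (32 * y) = ln (32::real) + ln y" using y by (intro ln_mult_pos) auto
  moreover have "ln (32::real) = 5 * ln 2" using ln_realpow[of "2::real" 5] by simp
  ultimately show ?thesis using ln_2_ge ln_ge_pade[OF y] by linarith
qed

lemma ln_35_ge: "ln (35::real) \<ge> 355/100"
  using ln_32_times_ge[of "35/32"] by simp

lemma ln_40_ge: "ln (40::real) \<ge> 368/100"
  using ln_32_times_ge[of "40/32"] by simp

text \<open>With \<open>m = 3 * D\<close> in \<open>exists_prime_between\<close>, the task is to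
  compare \<open>3 * D * ln x\<close> with about \<open>x * ln 2\<close>. Divided by
  \<open>D\<close>, a linear function of \<open>u\<close> faces a cubic one, and
  \<open>D \<ge> 11\<close> ensures \<open>u \<ge> 3\<close>, where the cubic is larger.\<close>

lemma prime_in_window_large:
  assumes D: "D \<ge> 11"
  shows "\<exists>p. prime p \<and> 6 * D < p \<and> 5 * real (p + 1) \<le> 6 * real D * ln (3 * real D) ^ 3"
proof -
  define u where "u = ln (3 * real D)"
  define x where "x = 6/5 * real D * u ^ 3"
  have "exp (3::real) = exp 1 ^ 3" by (simp add: exp_of_nat_mult[symmetric])
  also have "\<dots> \<le> 3 ^ 3" by (intro power_mono exp_le) auto
  finally have "exp 3 \<le> 3 * real D" using D by simp
  then have u: "u \<ge> 3" unfolding u_def using D by (subst ln_ge_iff) auto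
  have u3: "u ^ 3 \<ge> 27" using power_mono[OF u, of 3] by simp
  have x: "x \<ge> 300"
  proof -
    have "6/5 * 11 * 27 \<le> x" unfolding x_def using D u3 by (intro mult_mono) auto
    then show ?thesis by simp
  qed
  \<comment> \<open>Subtracting 2 makes \<open>Suc n \<le> x - 1\<close>, so a prime
    \<open>p \<le> Suc n\<close> still satisfies \<open>p + 1 \<le> x\<close>.\<close>
  define n where "n = nat \<lfloor>x\<rfloor> - 2"
  have n: "real (Suc n) \<le> x - 1" "real n \<ge> x - 3" "n \<ge> 1" using x unfolding n_def by linarith+
  have "ln x = ln (3 * real D) + (ln (2/5) + 3 * ln u)"
  proof -
    have x': "x = (3 * real D) * (2/5 * u ^ 3)" by (simp add: x_def)
    have lnx: "ln (a * (2/5 * b ^ 3)) = ln a + (ln (2/5) + 3 * ln b)" if "a > 0" "b > 0" for a b :: real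
    proof -
      have 1: "ln (a * (2/5 * b ^ 3)) = ln a + ln (2/5 * b ^ 3)" by (rule ln_mult_pos) (use that in auto)
      have 2: "ln (2/5 * b ^ 3) = ln (2/5) + ln (b ^ 3)" by (rule ln_mult_pos) (use that in auto)
      have 3: "ln (b ^ 3) = 3 * ln b" using that by (simp add: ln_realpow)
      show ?thesis unfolding 1 2 3 ..
    qed
    show ?thesis unfolding x' by (rule lnx) (use u D in auto)
  qed
  moreover have "ln (2/5 :: real) \<le> 0" by (subst ln_le_zero_iff) auto
  \<comment> \<open>The tangent of the logarithm at 4, with \<open>ln 4 - 1\<close> rounded
    up.\<close>
  moreover have "ln u \<le> u / 4 + 39/100"
  proof -
    have "ln (u / 4) \<le> u / 4 - 1" using u by (intro ln_le_minus_one) auto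
    moreover have "ln (4::real) = 2 * ln 2" using ln_realpow[of "2::real" 2] by simp
    ultimately show ?thesis using u ln2_le_25_over_36 by (simp add: ln_div)
  qed
  ultimately have lx: "ln x \<le> 7/4 * u + 117/100" unfolding u_def[symmetric] by linarith
  have "real (3 * D) * ln (real (Suc n)) \<le> real (3 * D) * (7/4 * u + 117/100)"
  proof -
    have "ln (real (Suc n)) \<le> ln x" using n(1) by (subst ln_le_cancel_iff) auto
    then show ?thesis using lx by (intro mult_left_mono) auto
  qed
  also have "\<dots> = real D * (21/4 * u + 351/100)" by (simp add: algebra_simps)
  also have "\<dots> < real D * (6/5 * u ^ 3 * (693/1000) - 1)"
  proof -
    have "u ^ 3 = u * u * u" by (simp add: power3_eq_cube)
    moreover have "9 * u \<le> u * u * u" using mult_mono[OF u u] u by (intro mult_right_mono) auto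
    ultimately have "21/4 * u + 351/100 < 6/5 * u ^ 3 * (693/1000) - 1" using u by linarith
    then show ?thesis using D by (intro mult_strict_left_mono) auto
  qed
  also have "\<dots> \<le> (x - 3) * (693/1000)" using D by (simp add: x_def algebra_simps)
  also have "\<dots> \<le> real n * ln 2" using n x ln_2_ge by (intro mult_mono) auto
  finally have "ln (real (Suc n) ^ (3 * D)) < ln (2 ^ n)" by (simp add: ln_realpow)
  then have "real (Suc n) ^ (3 * D) < 2 ^ n" by (subst (asm) ln_less_cancel_iff) auto
  from exists_prime_between[OF n(3) _ this] D obtain p where
    p: "prime p" "2 * (3 * D) < p" "p \<le> Suc n" by auto
  have "real p \<le> x - 1" using p(3) n(1) by linarith
  then have "5 * real (p + 1) \<le> 6 * real D * u ^ 3" by (simp add: x_def)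
  then show ?thesis using p unfolding u_def by auto
qed

text \<open>\<open>272/100\<close> exceeds \<open>e\<close>, so the lower end gives
  \<open>ln (p / (2 * D)) \<ge> 1\<close>; the upper end yields the constant \<open>5/12\<close>.
  For \<open>D \<le> 10\<close> explicit primes serve: 11, 17 and 23 for \<open>D = 2, 3, 4\<close>,
  and 59 for all others.\<close>

lemma prime_in_window:
  assumes D: "D \<ge> 2"
  shows "\<exists>p. prime p \<and> 272/100 * (2 * real D) \<le> real p \<and> 5 * real (p + 1) \<le> 6 * real D * ln (3 * real D) ^ 3"
proof -
  have ln6: "ln (3 * real D) \<ge> 1791/1000"
    using ln_6_ge D ln_le_cancel_iff[of 6 "3 * real D"] by linarith
  have c6: "ln (3 * real D) ^ 3 \<ge> 57/10"
    using power_mono[OF ln6, of 3] by (simp add: power3_eq_cube)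
  show ?thesis
  proof (cases "D \<le> 4")
    case True
    then consider "D = 2" | "D = 3" | "D = 4" using D by linarith
    then show ?thesis
    proof cases
      case 1 then show ?thesis using c6 by (intro exI[of _ 11]) auto
    next
      case 2 then show ?thesis using c6 by (intro exI[of _ 17]) auto
    next
      case 3 then show ?thesis using c6 by (intro exI[of _ 23]) auto
    qed
  next
    case False
    show ?thesis
    proof (cases "D \<le> 10")
      case True
      have "ln (3 * real D) \<ge> ln 9" using False by (subst ln_le_cancel_iff) auto
      moreover have "ln (9::real) = 2 * ln 3" using ln_realpow[of "3::real" 2] by simp
      ultimately have "ln (3 * real D) \<ge> 219/100" using ln_3_ge by linarith
      from power_mono[OF this, of 3] have "ln (3 * real D) ^ 3 \<ge> 10" by (simp add: power3_eq_cube)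
      then have "5 * 10 \<le> real D * ln (3 * real D) ^ 3" using False by (intro mult_mono) auto
      then have "5 * real (59 + 1) \<le> 6 * real D * ln (3 * real D) ^ 3" by simp
      moreover have "272/100 * (2 * real D) \<le> real 59" using True by simp
      ultimately show ?thesis by (intro exI[of _ 59] conjI) simp_all
    next
      case False
      then obtain p where "prime p" "6 * D < p" "5 * real (p + 1) \<le> 6 * real D * ln (3 * real D) ^ 3"
        using prime_in_window_large[of D] by auto
      then show ?thesis by (intro exI[of _ p]) auto
    qed
  qed
qed

text \<open>The roots are taken without multiplicity, which gives the Mahler measure for squarefree \<open>F\<close> only.\<close>

definition mahler :: "int poly \<Rightarrow> real" where
  "mahler F = \<bar>real_of_int (lead_coeff F)\<bar> * (\<Prod>z\<in>iroots F. max 1 (norm z))"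

lemma ln_mahler_ge_of_ge_2:
  assumes "D \<ge> 1" "M \<ge> 2"
  shows "5 / (12 * real D * ln (3 * real D) ^ 3) \<le> ln M"
proof -
  have "ln (3 * real D) \<ge> ln 3" using assms by (subst ln_le_cancel_iff) auto
  then have "ln (3 * real D) \<ge> 1" using ln_3_ge by linarith
  then have "ln (3 * real D) ^ 3 \<ge> 1" by (rule one_le_power)
  then have "12 * 1 * 1 \<le> 12 * real D * ln (3 * real D) ^ 3" using assms by (intro mult_mono) auto
  then have "5 / (12 * real D * ln (3 * real D) ^ 3) \<le> 5 / 12" by (intro divide_left_mono) auto
  also have "\<dots> \<le> ln 2" using ln_2_ge by simp
  also have "\<dots> \<le> ln M" using assms by (subst ln_le_cancel_iff) auto
  finally show ?thesis .
qed

lemma ln_mahler_ge_monic: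
  fixes F :: "int poly"
  assumes F: "irreducible F" "degree F \<ge> 1" "coeff F 0 \<noteq> 0" "lead_coeff F = 1"
    and nr: "\<And>z n. ipoly F z = 0 \<Longrightarrow> n > 0 \<Longrightarrow> z ^ n \<noteq> 1"
  shows "5 / (12 * real (degree F) * ln (3 * real (degree F)) ^ 3) \<le> ln (mahler F)"
proof (cases "degree F = 1")
  \<comment> \<open>For degree 1 the prime window is empty. The only root is then an integer other
    than 0, 1 and -1, so the measure is at least 2.\<close>
  case True
  define b where "b = coeff F 0"
  have F1: "F = [:b, 1:]"
    using True F(4) by (intro poly_eqI) (auto simp: b_def coeff_pCons coeff_eq_0 split: nat.splits)
  have roots: "iroots F = {- of_int b}"
    by (auto simp: F1 of_int_hom.map_poly_pCons_hom add_eq_0_iff)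
  then have "ipoly F (- of_int b) = 0" by blast
  from nr[OF this, of 2] have "(- complex_of_int b) ^ 2 \<noteq> 1" by simp
  then have "b * b \<noteq> 1" by (metis of_int_1 of_int_mult power2_eq_square power2_minus)
  then have "\<bar>b\<bar> \<noteq> 1" by (metis abs_mult_self_eq mult_1)
  moreover have "b \<noteq> 0" using F(3) by (simp add: b_def)
  ultimately have "\<bar>b\<bar> \<ge> 2" by linarith
  then have "real_of_int \<bar>b\<bar> \<ge> 2" by linarith
  then have "mahler F \<ge> 2" unfolding mahler_def roots F(4) by simp
  then show ?thesis using F(2) by (intro ln_mahler_ge_of_ge_2)
next
  case False
  define D where "D = degree F"
  have D: "D \<ge> 2" using False F(2) by (simp add: D_def)
  obtain p where p: "prime p" "272/100 * (2 * real D) \<le> real p"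
    "5 * real (p + 1) \<le> 6 * real D * ln (3 * real D) ^ 3" using prime_in_window[OF D] by blast
  have "real D + 1 < real p" using p(2) D by simp
  then have pD: "degree F < p - 1" by (simp add: D_def)
  have M: "mahler F = (\<Prod>z\<in>iroots F. max 1 (norm z))" by (simp add: mahler_def F(4))
  have "ln (real p / real (2 * degree F)) \<le> 2 * real (p + 1) * ln (mahler F)"
    using mahler_log_prime_bound[OF F nr p(1) pD M] by simp
  moreover have "ln (real p / real (2 * D)) \<ge> 1"
  proof -
    have "272/100 \<le> real p / real (2 * D)" using p(2) D by (simp add: field_simps)
    then have "exp 1 \<le> real p / real (2 * D)" using e_less_272 by linarith
    then show ?thesis by (subst ln_ge_iff) (use exp_gt_zero[of "1::real"] in linarith)+
  qed
  ultimately have le: "1 \<le> 2 * real (p + 1) * ln (mahler F)" unfolding D_def by linarith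
  have lnM: "ln (mahler F) > 0"
  proof (rule ccontr)
    assume "\<not> ln (mahler F) > 0"
    then have "2 * real (p + 1) * ln (mahler F) \<le> 0" by (intro mult_nonneg_nonpos) auto
    with le show False by linarith
  qed
  have ln3: "ln (3 * real D) ^ 3 > 0" using D by (intro zero_less_power ln_gt_zero) auto
  have "5 * 1 \<le> 5 * (2 * real (p + 1) * ln (mahler F))" using le by (intro mult_left_mono) auto
  also have "\<dots> = (5 * real (p + 1)) * (2 * ln (mahler F))" by (simp only: mult_ac)
  also have "\<dots> \<le> (6 * real D * ln (3 * real D) ^ 3) * (2 * ln (mahler F))"
    using p(3) lnM by (intro mult_right_mono) auto
  finally have "5 \<le> (6 * real D * ln (3 * real D) ^ 3) * (2 * ln (mahler F))" by simp
  also have "\<dots> = ln (mahler F) * (12 * real D * ln (3 * real D) ^ 3)" by simp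
  finally have "5 \<le> ln (mahler F) * (12 * real D * ln (3 * real D) ^ 3)" .
  then show ?thesis using D ln3 unfolding D_def[symmetric] by (subst pos_divide_le_eq) auto
qed

lemma mahler_uminus: "mahler (- F) = mahler F"
  by (simp add: mahler_def hom_distribs)

text \<open>Primes are needed only for leading coefficient 1 or -1; otherwise the leading
  coefficient alone makes the measure at least 2, and \<open>ln 2\<close> exceeds the claimed
  bound.\<close>

theorem ln_mahler_ge:
  fixes F :: "int poly"
  assumes F: "irreducible F" "degree F \<ge> 1" "coeff F 0 \<noteq> 0"
    and nr: "\<And>z n. ipoly F z = 0 \<Longrightarrow> n > 0 \<Longrightarrow> z ^ n \<noteq> 1"
  shows "5 / (12 * real (degree F) * ln (3 * real (degree F)) ^ 3) \<le> ln (mahler F)"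
proof -
  have "lead_coeff F \<noteq> 0" using F(2) by auto
  then consider "lead_coeff F = 1" | "lead_coeff F = -1" | "\<bar>lead_coeff F\<bar> \<ge> 2" by linarith
  then show ?thesis
  proof cases
    case 1 then show ?thesis using ln_mahler_ge_monic[OF F _ nr] by simp
  next
    case 2
    have "irreducible (- F)"
    proof (rule irreducibleI)
      fix a b assume "- F = a * b"
      then have "F = (- a) * b" by (metis minus_minus mult_minus_left)
      then show "is_unit a \<or> is_unit b" using irreducibleD[OF F(1)] by fastforce
    qed (use F(1) in \<open>auto simp: irreducible_def\<close>)
    from ln_mahler_ge_monic[OF this] F nr 2 show ?thesis by (simp add: mahler_uminus hom_distribs)
  next
    case 3
    then have "real_of_int \<bar>lead_coeff F\<bar> \<ge> 2" by linarith
    moreover have "(\<Prod>z\<in>iroots F. max 1 (norm z)) \<ge> 1" by (rule prod_ge_1) auto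
    ultimately have "2 * 1 \<le> mahler F" unfolding mahler_def by (intro mult_mono) auto
    then show ?thesis using F(2) by (intro ln_mahler_ge_of_ge_2) auto
  qed
qed

section \<open>The gap bound\<close>

lemma ipoly2_hom:
  "ipoly2 (A + B) z y = ipoly2 A z y + ipoly2 B z y"
  "ipoly2 (A * B) z y = ipoly2 A z y * ipoly2 B z y"
  "ipoly2 (monom 1 u) z y = z ^ u" "ipoly2 1 z y = 1"
proof -
  interpret e: comm_ring_hom "\<lambda>c. ipoly c y" by (rule comm_ring_hom_ipoly)
  interpret m: map_poly_comm_ring_hom "\<lambda>c. ipoly c y" ..
  show "ipoly2 (A + B) z y = ipoly2 A z y + ipoly2 B z y" "ipoly2 (A * B) z y = ipoly2 A z y * ipoly2 B z y"
    "ipoly2 1 z y = 1" by (simp_all add: m.hom_add m.hom_mult)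
  show "ipoly2 (monom 1 u) z y = z ^ u" by (simp add: e.map_poly_hom_monom poly_monom)
qed

text \<open>If \<open>\<gamma> = B z\<close> with \<open>A z = z ^ u * B z\<close> and \<open>degree A \<le> u\<close>, then \<open>\<gamma>\<close> is a polynomial both in
  \<open>z\<close> and in \<open>1/z\<close>, so all powers of \<open>\<gamma>\<close> stay in the span of \<open>z ^ -u, \<dots>, z ^ degree B\<close>.\<close>

lemma laurent_power_representation:
  fixes A B :: "int poly poly"
  assumes A: "degree A \<le> u" and AB: "\<And>z y. z \<in> R \<Longrightarrow> ipoly2 A z y = z ^ u * ipoly2 B z y"
  shows "\<exists>H. degree H \<le> u + degree B \<and> (\<forall>z\<in>R. \<forall>y. ipoly2 B z y ^ N * z ^ u = ipoly2 H z y)"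
proof (induction N)
  case 0
  show ?case by (intro exI[of _ "monom 1 u"]) (auto simp: ipoly2_hom degree_monom_eq)
next
  case (Suc N)
  then obtain H where H: "degree H \<le> u + degree B"
    "\<And>z y. z \<in> R \<Longrightarrow> ipoly2 B z y ^ N * z ^ u = ipoly2 H z y" by blast
  \<comment> \<open>Multiplying \<open>H = L + x ^ u * U\<close> by \<open>B\<close>, the product
    \<open>x ^ u * B\<close> can be replaced by \<open>A\<close>, which keeps the degree within
    \<open>u + degree B\<close>.\<close>
  define L where "L = poly_cutoff u H"
  define U where "U = poly_shift u H"
  have HLU: "H = L + monom 1 u * U"
    unfolding L_def U_def by (intro poly_eqI) (auto simp: coeff_poly_cutoff coeff_poly_shift coeff_monom_mult)
  have dU: "degree U \<le> degree B"
    by (rule degree_le) (use H(1) in \<open>auto simp: U_def coeff_poly_shift coeff_eq_0\<close>)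
  have dL: "degree L \<le> u"
    by (rule degree_le) (auto simp: L_def coeff_poly_cutoff)
  show ?case
  proof (intro exI[of _ "L * B + U * A"] conjI ballI allI)
    show "degree (L * B + U * A) \<le> u + degree B"
      using dU dL A by (intro degree_add_le order.trans[OF degree_mult_le]) auto
    fix z y assume z: "z \<in> R"
    have "ipoly2 B z y ^ Suc N * z ^ u = ipoly2 B z y * ipoly2 H z y"
      using H(2)[OF z, of y] by simp
    also have "\<dots> = ipoly2 (L * B + U * A) z y"
      unfolding HLU ipoly2_hom AB[OF z] by (simp add: algebra_simps)
    finally show "ipoly2 B z y ^ Suc N * z ^ u = ipoly2 (L * B + U * A) z y" .
  qed
qed

text \<open>A fraction whose powers have a common denominator is an integer: for each prime the
  fixed multiplicity in \<open>k\<close> cannot make up for a deficit growing linearly in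
  \<open>N\<close>.\<close>

lemma dvd_of_power_dvd:
  fixes v c k :: nat
  assumes "k > 0" "c > 0" "v > 0" "\<And>N. v ^ N dvd k * c ^ N"
  shows "v dvd c"
proof (rule multiplicity_le_imp_dvd)
  show "v \<noteq> 0" using assms by simp
  fix p :: nat assume p: "prime p"
  have le: "N * multiplicity p v \<le> multiplicity p k + N * multiplicity p c" for N
  proof -
    have "multiplicity p (v ^ N) \<le> multiplicity p (k * c ^ N)"
      using assms by (intro dvd_imp_multiplicity_le) auto
    then show ?thesis using p assms
      by (simp add: prime_elem_multiplicity_mult_distrib prime_elem_multiplicity_power_distrib)
  qed
  show "multiplicity p v \<le> multiplicity p c"
  proof (rule ccontr)
    assume "\<not> ?thesis"
    then have "Suc (multiplicity p c) \<le> multiplicity p v" by simp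
    then have "Suc (multiplicity p k) * Suc (multiplicity p c) \<le> Suc (multiplicity p k) * multiplicity p v"
      by (rule mult_le_mono2)
    with le[of "Suc (multiplicity p k)"] show False by simp
  qed
qed

lemma content_power: "content (p ^ n) = content (p :: int poly) ^ n"
  by (induction n) (simp_all add: content_mult)

lemma content_pos:
  fixes G :: "int poly" assumes "G \<noteq> 0" shows "content G > 0"
proof -
  have "content G \<ge> 0" using abs_ge_zero[of "content G"] normalize_content[of G] by simp
  moreover have "content G \<noteq> 0" using assms by simp
  ultimately show ?thesis by linarith
qed

text \<open>The same principle for the polynomial \<open>W / v\<close>, reduced to integers by the
  multiplicativity of the content.\<close>

lemma poly_power_denominator:
  fixes W :: "int poly"
  assumes "k \<noteq> 0" "v \<noteq> 0" "\<And>N. \<exists>V. smult k (W ^ N) = smult (v ^ N) V"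
  shows "v dvd content W"
proof (cases "W = 0")
  case True then show ?thesis by simp
next
  case False
  have pos: "content W > 0" using False by (rule content_pos)
  have "nat \<bar>v\<bar> dvd nat (content W)"
  proof (rule dvd_of_power_dvd[of "nat \<bar>k\<bar>"])
    fix N
    obtain V where V: "smult k (W ^ N) = smult (v ^ N) V" using assms(3) by blast
    have "content (smult k (W ^ N)) = content (smult (v ^ N) V)" unfolding V ..
    then have "\<bar>k\<bar> * content W ^ N = \<bar>v\<bar> ^ N * content V"
      by (simp add: content_power power_abs)
    then have "\<bar>v\<bar> ^ N dvd \<bar>k\<bar> * content W ^ N" by simp
    then have "nat (\<bar>v\<bar> ^ N) dvd nat (\<bar>k\<bar> * content W ^ N)" by (simp add: nat_dvd_iff)
    then show "nat \<bar>v\<bar> ^ N dvd nat \<bar>k\<bar> * nat (content W) ^ N"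
      using pos by (simp add: nat_power_eq nat_mult_distrib)
  qed (use assms(1,2) pos in auto)
  then show ?thesis using pos by (simp add: nat_dvd_iff)
qed

lemma irreducible_content_1:
  fixes F :: "int poly"
  assumes "irreducible F" "degree F \<ge> 1"
  shows "content F = 1"
proof -
  have "F = [:content F:] * primitive_part F" by simp
  then have "is_unit [:content F:] \<or> is_unit (primitive_part F)" using irreducibleD[OF assms(1)] by blast
  moreover have "\<not> is_unit (primitive_part F)"
  proof
    assume "is_unit (primitive_part F)"
    then have "degree (primitive_part F) \<le> degree (1 :: int poly)" by (rule dvd_imp_degree_le) simp
    then show False using assms(2) by simp
  qed
  ultimately have "is_unit (content F)" by (simp add: is_unit_const_poly_iff)
  then have "normalize (content F) = 1" by (rule is_unit_normalize)
  then show ?thesis unfolding normalize_content .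
qed

text \<open>The norm of \<open>B z (y - z) ^ s\<close> over the roots of \<open>F\<close> equals
  \<open>(\<Prod>B z) / a ^ s\<close> times the primitive polynomial \<open>F y ^ s\<close>. Its powers have bounded denominators, so it is
  integral and Gauss' lemma shows that \<open>a ^ s\<close> divides \<open>\<Prod>B z\<close>.\<close>

lemma norm_divisible_by_lead_power:
  fixes F A B :: "int poly"
  assumes F: "irreducible F" "degree F \<ge> 1" "coeff F 0 \<noteq> 0"
    and A: "degree A + s \<le> u" and AB: "F dvd A - monom 1 u * B"
  shows "\<exists>w. (\<Prod>z\<in>iroots F. ipoly B z) = of_int (lead_coeff F) ^ s * of_int w"
proof -
  define R where "R = iroots F"
  define D where "D = card R"
  define a where "a = lead_coeff F"
  note fac = irreducible_factorization[OF F(1,2), folded R_def]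
  have card: "card R \<ge> 1" using F(2) fac(3) by simp
  have a0: "a \<noteq> 0" using F(2) by (auto simp: a_def)
  have rt: "z \<in> R \<Longrightarrow> ipoly F z = 0" for z by (simp add: R_def)
  interpret c: inj_comm_ring_hom "\<lambda>c::int. [:c:]" by unfold_locales (auto simp: one_pCons)
  define lift where "lift = map_poly (\<lambda>c::int. [:c:])"
  have lift: "ipoly2 (lift U) z y = ipoly U z" for U z y
    unfolding lift_def by (subst map_poly_map_poly) (auto simp: o_def of_int_hom.map_poly_pCons_hom)
  \<comment> \<open>The slack \<open>s\<close> between \<open>degree A\<close> and \<open>u\<close>
    is spent on this factor: after multiplication by it, \<open>A1\<close> still has degree at most
    \<open>u\<close>.\<close>
  define Y :: "int poly poly" where "Y = [:[:0, 1:], -1:] ^ s"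
  have Y: "ipoly2 Y z y = (y - z) ^ s" for z y
  proof -
    interpret e: comm_ring_hom "\<lambda>c. ipoly c y" by (rule comm_ring_hom_ipoly)
    interpret m: map_poly_comm_ring_hom "\<lambda>c. ipoly c y" ..
    show ?thesis unfolding Y_def
      by (simp add: m.hom_power e.map_poly_pCons_hom of_int_hom.map_poly_pCons_hom hom_distribs)
  qed
  define A1 where "A1 = lift A * Y"
  define B1 where "B1 = lift B * Y"
  have dA1: "degree A1 \<le> u"
  proof -
    have "degree Y \<le> s" unfolding Y_def using degree_power_le[of "[:[:0, 1:], -1:] :: int poly poly" s] by simp
    then show ?thesis using degree_mult_le[of "lift A" Y] A unfolding A1_def lift_def by simp
  qed
  have A1B1: "ipoly2 A1 z y = z ^ u * ipoly2 B1 z y" if "z \<in> R" for z y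
  proof -
    have "ipoly (A - monom 1 u * B) z = 0" using AB rt[OF that] by (auto simp: ipoly_mult)
    then have "ipoly A z = z ^ u * ipoly B z" unfolding ipoly_diff ipoly_mult by (simp add: poly_monom)
    then show ?thesis by (simp add: A1_def B1_def ipoly2_hom lift)
  qed
  obtain H where H: "\<And>N. degree (H N) \<le> u + degree B1"
    "\<And>N z y. z \<in> R \<Longrightarrow> ipoly2 B1 z y ^ N * z ^ u = ipoly2 (H N) z y"
    using laurent_power_representation[OF dA1 A1B1] by metis
  define K where "K = u + degree B1"
  have "\<exists>V. \<forall>y. ipoly V y = of_int a ^ (K * D) * (\<Prod>z\<in>R. ipoly2 (H N) z y)" for N
    using norm_integral2[OF fac(3)[symmetric] fac(2) card rt, of "H N" K] H(1)[of N]
    unfolding K_def a_def D_def by blast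
  then obtain V where V: "\<And>N y. ipoly (V N) y = of_int a ^ (K * D) * (\<Prod>z\<in>R. ipoly2 (H N) z y)" by metis
  obtain b where b: "of_int b = of_int a ^ (degree B * D) * (\<Prod>z\<in>R. ipoly B z)"
    using norm_integral[OF fac(3)[symmetric] fac(2) card rt order.refl, of B] unfolding a_def D_def by blast
  have Fy: "ipoly F y = of_int a * (\<Prod>z\<in>R. y - z)" for y
    unfolding fac(1) by (simp add: a_def poly_prod)
  have F0: "of_int (coeff F 0) = (of_int a :: complex) * (\<Prod>z\<in>R. - z)"
    using Fy[of 0] by (simp add: poly_0_coeff_0)
  define f0 where "f0 = coeff F 0"
  \<comment> \<open>Up to sign, the constant coefficient is \<open>a\<close> times the product of
    the roots. So the factor \<open>z ^ u\<close> in the Laurent representation costs only an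
    integer that is independent of \<open>N\<close>.\<close>
  define g where "g = (-1) ^ D * f0"
  have prodR: "of_int a * (\<Prod>z\<in>R. z) = (of_int g :: complex)"
  proof -
    have "(\<Prod>z\<in>R. - z) = (-1) ^ D * (\<Prod>z\<in>R. z)" by (simp add: D_def prod_uminus)
    then have "of_int a * (\<Prod>z\<in>R. z) = (-1) ^ D * (of_int a * (\<Prod>z\<in>R. - z) :: complex)"
      by (simp add: power_mult_distrib[symmetric] mult.left_commute mult.assoc[symmetric])
    then show ?thesis unfolding F0[symmetric] by (simp add: g_def f0_def)
  qed
  \<comment> \<open>The norm of \<open>B1\<close> is \<open>W / v\<close>, and
    \<open>a ^ (K * D) * g ^ u\<close> is a common denominator of all its powers.\<close>
  define W where "W = smult b (F ^ s)"
  define v where "v = a ^ (degree B * D + s)"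
  have prodB1: "(of_int v :: complex) * (\<Prod>z\<in>R. ipoly2 B1 z y) = ipoly W y" for y
  proof -
    have "(\<Prod>z\<in>R. ipoly2 B1 z y) = (\<Prod>z\<in>R. ipoly B z) * (\<Prod>z\<in>R. y - z) ^ s"
      by (simp add: B1_def ipoly2_hom lift Y prod.distrib prod_power_distrib)
    moreover have "ipoly W y = of_int b * (of_int a * (\<Prod>z\<in>R. y - z)) ^ s"
      by (simp add: W_def hom_distribs Fy[symmetric])
    ultimately show ?thesis by (simp add: b v_def power_add power_mult_distrib)
  qed
  have "v dvd content W"
  proof (rule poly_power_denominator[of "a ^ (K * D) * g ^ u"])
    show "a ^ (K * D) * g ^ u \<noteq> 0" using a0 F(3) by (simp add: g_def f0_def)
    show "v \<noteq> 0" using a0 by (simp add: v_def)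
    fix N
    have "ipoly (smult (a ^ (K * D) * g ^ u) (W ^ N)) y = ipoly (smult (v ^ N) (smult (a ^ u) (V N))) y" for y
    proof -
      have "(\<Prod>z\<in>R. ipoly2 (H N) z y) = (\<Prod>z\<in>R. ipoly2 B1 z y) ^ N * (\<Prod>z\<in>R. z) ^ u"
        using H(2) by (simp add: prod.distrib[symmetric] prod_power_distrib)
      then have "ipoly (smult (v ^ N) (smult (a ^ u) (V N))) y =
          of_int a ^ (K * D) * ((of_int v * (\<Prod>z\<in>R. ipoly2 B1 z y)) ^ N * (of_int a * (\<Prod>z\<in>R. z)) ^ u)"
        by (simp add: hom_distribs V power_mult_distrib mult_ac)
      also have "\<dots> = ipoly (smult (a ^ (K * D) * g ^ u) (W ^ N)) y"
        unfolding prodB1 prodR by (simp add: hom_distribs)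
      finally show ?thesis by simp
    qed
    then have "poly (of_int_poly (smult (a ^ (K * D) * g ^ u) (W ^ N)) :: complex poly) =
        poly (of_int_poly (smult (v ^ N) (smult (a ^ u) (V N))))" by (rule ext)
    then have "(of_int_poly (smult (a ^ (K * D) * g ^ u) (W ^ N)) :: complex poly) =
        of_int_poly (smult (v ^ N) (smult (a ^ u) (V N)))" by (simp only: poly_eq_poly_eq_iff)
    then have "smult (a ^ (K * D) * g ^ u) (W ^ N) = smult (v ^ N) (smult (a ^ u) (V N))"
      by (simp only: of_int_poly_hom.eq_iff)
    then show "\<exists>V. smult (a ^ (K * D) * g ^ u) (W ^ N) = smult (v ^ N) V" by blast
  qed
  moreover have "content F = 1" using irreducible_content_1 F by blast
  ultimately have "v dvd b" by (simp add: W_def content_power)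
  then obtain w where w: "b = v * w" by (elim dvdE)
  have "of_int a ^ (degree B * D) * (\<Prod>z\<in>R. ipoly B z) = of_int a ^ (degree B * D) * (of_int a ^ s * of_int w)"
    unfolding b[symmetric] w v_def by (simp add: power_add)
  then have "(\<Prod>z\<in>R. ipoly B z) = of_int a ^ s * of_int w" using a0 by simp
  then show ?thesis unfolding R_def a_def by blast
qed

lemma ipoly_norm_le:
  assumes r: "r = max 1 (norm z)" and d: "degree A \<le> e"
  shows "norm (ipoly A z) \<le> (\<Sum>i\<le>degree A. \<bar>real_of_int (coeff A i)\<bar>) * r ^ e"
proof -
  have "ipoly A z = (\<Sum>i\<le>degree A. of_int (coeff A i) * z ^ i)"
    by (simp add: poly_altdef)
  then have "norm (ipoly A z) \<le> (\<Sum>i\<le>degree A. norm (of_int (coeff A i) * z ^ i))"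
    by (simp only: norm_sum)
  also have "\<dots> \<le> (\<Sum>i\<le>degree A. \<bar>real_of_int (coeff A i)\<bar> * r ^ e)"
  proof (intro sum_mono)
    fix i assume "i \<in> {..degree A}"
    then have i: "i \<le> e" using d by simp
    have "norm z ^ i \<le> r ^ i" unfolding r by (intro power_mono) auto
    also have "\<dots> \<le> r ^ e" using i unfolding r by (intro power_increasing) auto
    finally show "norm (of_int (coeff A i) * z ^ i) \<le> \<bar>real_of_int (coeff A i)\<bar> * r ^ e"
      by (simp add: norm_mult norm_power mult_left_mono)
  qed
  finally show ?thesis by (simp add: sum_distrib_right)
qed

text \<open>At a root outside the unit disc, \<open>A z = - z ^ u * B z\<close> forces
  \<open>norm (B z) \<le> C / norm z ^ s\<close>; elsewhere it is at most \<open>C\<close>. The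
  product of these values is a nonzero multiple of \<open>lead_coeff F ^ s\<close>, and comparing
  both estimates produces the full Mahler measure.\<close>

theorem gap_bound:
  fixes F A B :: "int poly"
  assumes F: "irreducible F" "degree F \<ge> 1" "coeff F 0 \<noteq> 0"
    and dvd: "F dvd A + monom 1 u * B" and ndvd: "\<not> F dvd A"
    and A: "degree A \<le> e" "e + s = u"
    and CA: "(\<Sum>i\<le>degree A. \<bar>real_of_int (coeff A i)\<bar>) \<le> C"
    and CB: "(\<Sum>i\<le>degree B. \<bar>real_of_int (coeff B i)\<bar>) \<le> C"
  shows "mahler F ^ s \<le> C ^ degree F"
proof -
  note fac = irreducible_factorization[OF F(1,2)]
  define a where "a = lead_coeff F"
  have a0: "a \<noteq> 0" using F(2) by (auto simp: a_def)
  define r where "r z = max 1 (norm z)" for z :: complex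
  have r1: "r z \<ge> 1" for z by (simp add: r_def)
  define P where "P = (\<Prod>z\<in>iroots F. r z)"
  have P1: "P \<ge> 1" unfolding P_def by (rule prod_ge_1) (use r1 in auto)
  have rel: "ipoly A z = - (z ^ u * ipoly B z)" if "z \<in> iroots F" for z
  proof -
    have "ipoly (A + monom 1 u * B) z = 0" using dvd that by (auto simp: ipoly_mult)
    then show ?thesis by (simp add: hom_distribs poly_monom add_eq_0_iff2)
  qed
  have bound: "norm (ipoly B z) \<le> C / r z ^ s" if z: "z \<in> iroots F" for z
  proof (cases "norm z \<le> 1")
    case True
    then have "r z = 1" by (simp add: r_def)
    then show ?thesis using ipoly_norm_le[OF r_def[of z], of B "degree B"] CB by simp
  next
    case False
    then have rz: "r z = norm z" by (simp add: r_def)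
    have "norm (ipoly A z) = r z ^ u * norm (ipoly B z)" using rel[OF z] by (simp add: norm_mult norm_power rz)
    moreover have "norm (ipoly A z) \<le> C * r z ^ e"
      using ipoly_norm_le[OF r_def[of z] A(1)] CA r1[of z]
      by (meson dual_order.trans mult_right_mono zero_le_power order_trans zero_le_one)
    ultimately have "r z ^ e * (r z ^ s * norm (ipoly B z)) \<le> r z ^ e * C"
      by (simp add: A(2)[symmetric] power_add mult_ac)
    then have "r z ^ s * norm (ipoly B z) \<le> C"
      using r1[of z] by (subst (asm) mult_le_cancel_left_pos) auto
    then show ?thesis using r1[of z] by (subst pos_le_divide_eq) (auto simp: mult.commute)
  qed
  have "F dvd A - monom 1 u * (- B)" using dvd by simp
  from norm_divisible_by_lead_power[OF F _ this, of s] A obtain w where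
    w: "(\<Prod>z\<in>iroots F. ipoly (- B) z) = of_int a ^ s * of_int w" unfolding a_def by auto
  have nB: "norm (\<Prod>z\<in>iroots F. ipoly (- B) z) = (\<Prod>z\<in>iroots F. norm (ipoly B z))"
    by (simp add: hom_distribs flip: prod_norm)
  \<comment> \<open>The only use of \<open>\<not> F dvd A\<close>: a zero of \<open>B\<close> at one
    root would be a zero of \<open>A\<close>.\<close>
  have "ipoly B z \<noteq> 0" if "z \<in> iroots F" for z
  proof
    assume "ipoly B z = 0"
    then have "ipoly A z = 0" using rel[OF that] by simp
    then show False using irreducible_dvd_of_common_root[OF F(1)] that ndvd by blast
  qed
  then have "(\<Prod>z\<in>iroots F. norm (ipoly B z)) \<noteq> 0" using fac(2) by simp
  then have "w \<noteq> 0" using nB w by auto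
  then have "1 \<le> \<bar>real_of_int w\<bar>" by linarith
  then have "\<bar>real_of_int a\<bar> ^ s * 1 \<le> \<bar>real_of_int a\<bar> ^ s * \<bar>real_of_int w\<bar>" by (intro mult_left_mono) auto
  also have "\<dots> = (\<Prod>z\<in>iroots F. norm (ipoly B z))" unfolding nB[symmetric] w by (simp add: norm_mult norm_power)
  also have "\<dots> \<le> (\<Prod>z\<in>iroots F. C / r z ^ s)" using bound by (intro prod_mono) auto
  also have "\<dots> = C ^ degree F / P ^ s" by (simp add: prod_dividef fac(3) P_def prod_power_distrib)
  finally have "\<bar>real_of_int a\<bar> ^ s * P ^ s \<le> C ^ degree F" using P1 by (simp add: pos_le_divide_eq)
  moreover have "mahler F = \<bar>real_of_int a\<bar> * P" by (simp add: mahler_def a_def P_def r_def)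
  ultimately show ?thesis by (simp add: power_mult_distrib)
qed

section \<open>Sparse multiples of bounded height\<close>

lemma clear_denominators:
  fixes g :: "rat poly"
  shows "\<exists>b G. b > 0 \<and> smult (of_int b) g = of_int_poly G"
proof (induction g)
  case 0 show ?case by (intro exI[of _ 1] exI[of _ 0]) simp
next
  case (pCons a g)
  then obtain b G where b: "b > 0" "smult (of_int b) g = of_int_poly G" by blast
  obtain x y where xy: "quotient_of a = (x, y)" by (cases "quotient_of a")
  have y: "y > 0" and a: "a = of_int x / of_int y"
    using quotient_of_denom_pos[OF xy] quotient_of_div[OF xy] by auto
  have "smult (of_int (b * y)) (pCons a g) = of_int_poly (pCons (b * x) (smult y G))"
    using y by (simp add: a of_int_hom.map_poly_pCons_hom hom_distribs b(2)[symmetric] mult.commute)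
  then show ?case using b(1) y by (metis mult_pos_pos)
qed

lemma primitive_form:
  fixes g :: "rat poly"
  assumes "g \<noteq> 0"
  shows "\<exists>q G. q > 0 \<and> g = smult q (of_int_poly G) \<and> content G = 1"
proof -
  obtain b G where b: "b > 0" "smult (of_int b) g = of_int_poly G" using clear_denominators by blast
  have G0: "G \<noteq> 0" using b assms by auto
  have "smult (of_int b) g = of_int_poly (smult (content G) (primitive_part G))" using b by simp
  then have "smult (of_int b) g = smult (of_int (content G)) (of_int_poly (primitive_part G))"
    by (simp only: of_int_hom.map_poly_hom_smult)
  then have "smult (1 / of_int b) (smult (of_int b) g) =
    smult (1 / of_int b) (smult (of_int (content G)) (of_int_poly (primitive_part G)))" by (simp only:)
  then have "g = smult (of_int (content G) / of_int b) (of_int_poly (primitive_part G))" using b(1) by simp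
  moreover have "of_int (content G) / of_int b > (0::rat)" using b(1) content_pos[OF G0] by simp
  ultimately show ?thesis using G0 by (metis content_primitive_part)
qed

text \<open>Gauss' lemma: as \<open>F\<close> is primitive, the common denominator of the quotient
  divides the content of its numerator.\<close>

lemma rat_poly_dvd_iff:
  fixes F G :: "int poly"
  assumes F: "content F = 1"
  shows "(of_int_poly F :: rat poly) dvd of_int_poly G \<longleftrightarrow> F dvd G"
proof
  assume "F dvd G" then show "(of_int_poly F :: rat poly) dvd of_int_poly G" by (auto simp: hom_distribs)
next
  assume "(of_int_poly F :: rat poly) dvd of_int_poly G"
  then obtain h where h: "of_int_poly G = of_int_poly F * (h :: rat poly)" by (elim dvdE)
  show "F dvd G"
  proof (cases "G = 0")
    case False
    then have "h \<noteq> 0" using h by auto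
    obtain b H where b: "b > 0" "smult (of_int b) h = of_int_poly H" using clear_denominators by blast
    have "of_int_poly (smult b G) = smult (of_int b) (of_int_poly F * h)"
      by (simp only: of_int_hom.map_poly_hom_smult h)
    also have "\<dots> = of_int_poly F * smult (of_int b) h" by simp
    also have "\<dots> = of_int_poly (F * H)" unfolding b(2) by (simp add: hom_distribs)
    finally have eq: "smult b G = F * H" by (simp only: of_int_poly_hom.eq_iff)
    have "content (smult b G) = content (F * H)" by (simp only: eq)
    then have "\<bar>b\<bar> * content G = content H" using F by (simp add: content_mult)
    then have "b dvd content H" using b(1) by (metis abs_of_pos dvd_triv_left)
    then have "[:b:] dvd H" by (simp add: const_poly_dvd_iff_dvd_content)
    then obtain H' where "H = [:b:] * H'" by (elim dvdE)
    then have "H = smult b H'" by simp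
    then have "smult b G = smult b (F * H')" using eq by simp
    then have "smult b (G - F * H') = 0" by (simp add: smult_diff_right)
    then have "G = F * H'" using b(1) by simp
    then show ?thesis by simp
  qed simp
qed

text \<open>\<open>LEAST\<close> on the rationals makes sense only if the minimum is attained. Here
  the denominator of an admissible \<open>r * q\<close> divides every coefficient of
  \<open>G\<close>, so \<open>r * q\<close> is a positive integer.\<close>

lemma int_scale_primitive:
  fixes G :: "int poly"
  assumes q: "q > 0" and G: "content G = 1"
  shows "int_scale (smult q (of_int_poly G)) = 1 / q"
  unfolding int_scale_def
proof (rule Least_equality)
  show "1 / q > 0 \<and> (\<forall>i. coeff (smult (1 / q) (smult q (of_int_poly G))) i \<in> \<int>)" using q by simp
next
  fix r assume r: "r > 0 \<and> (\<forall>i. coeff (smult r (smult q (of_int_poly G))) i \<in> \<int>)"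
  obtain x y where xy: "quotient_of (r * q) = (x, y)" by (cases "quotient_of (r * q)")
  have y: "y > 0" and a: "r * q = of_int x / of_int y" and cop: "coprime x y"
    using quotient_of_denom_pos[OF xy] quotient_of_div[OF xy] quotient_of_coprime[OF xy] by auto
  have "y dvd coeff G i" for i
  proof -
    have "r * q * of_int (coeff G i) \<in> \<int>" using r by (simp add: mult.assoc)
    then obtain k where "r * q * of_int (coeff G i) = of_int k" by (elim Ints_cases)
    then have "of_int x / of_int y * of_int (coeff G i) = (of_int k :: rat)" unfolding a .
    then have "of_int (x * coeff G i) = (of_int (y * k) :: rat)" using y by (simp add: field_simps)
    then have "x * coeff G i = y * k" by (simp only: of_int_eq_iff)
    then have "y dvd x * coeff G i" by simp
    then show ?thesis using cop by (simp add: coprime_commute coprime_dvd_mult_right_iff)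
  qed
  then have "[:y:] dvd G" by (simp add: const_poly_dvd_iff)
  then have "y dvd content G" by (simp add: const_poly_dvd_iff_dvd_content)
  then have "y = 1" using y G by (simp add: zdvd1_eq)
  then have rq: "r * q = of_int x" using a by simp
  then have "of_int x > (0::rat)" using r q by (metis mult_pos_pos)
  then have "x \<ge> 1" by simp
  then have "r * q \<ge> 1" unfolding rq by simp
  then show "1 / q \<le> r" using q by (simp add: pos_divide_le_eq)
qed

lemma height_le_iff:
  fixes G :: "int poly"
  assumes q: "q > 0" and G: "content G = 1"
  shows "height (smult q (of_int_poly G)) \<le> of_nat c \<longleftrightarrow> (\<forall>i. \<bar>coeff G i\<bar> \<le> int c)"
proof -
  have "height (smult q (of_int_poly G)) \<le> of_nat c \<longleftrightarrow>
      (\<forall>i\<le>degree G. \<bar>of_int (coeff G i)\<bar> \<le> (of_nat c :: rat))"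
    unfolding height_def int_scale_primitive[OF q G] using q by simp auto
  also have "\<dots> \<longleftrightarrow> (\<forall>i\<le>degree G. \<bar>coeff G i\<bar> \<le> int c)"
  proof -
    have "\<bar>of_int z\<bar> \<le> (of_nat c :: rat) \<longleftrightarrow> \<bar>z\<bar> \<le> int c" for z
      by (metis of_int_abs of_int_le_iff of_int_of_nat_eq)
    then show ?thesis by simp
  qed
  also have "\<dots> \<longleftrightarrow> (\<forall>i. \<bar>coeff G i\<bar> \<le> int c)" by (metis abs_zero coeff_eq_0 linorder_not_le of_nat_0_le_iff)
  finally show ?thesis .
qed

text \<open>The bound concerns the coefficients of \<open>G\<close> itself, not of its primitive
  part as in \<open>height\<close>. It is thus inherited by truncations, which need not be
  primitive.\<close>

definition small_multiple :: "int poly \<Rightarrow> nat \<Rightarrow> nat \<Rightarrow> int poly \<Rightarrow> bool" where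
  "small_multiple f t c G \<longleftrightarrow> G \<noteq> 0 \<and> f dvd G \<and> card {i. coeff G i \<noteq> 0} \<le> t \<and> (\<forall>i. \<bar>coeff G i\<bar> \<le> int c)"

text \<open>Rational multiples are represented by their primitive forms; conversely, removing the
  content of \<open>G\<close> can only shrink its coefficients.\<close>

lemma small_multiple_transfer:
  fixes f :: "int poly"
  assumes f: "content f = 1" and q: "q > 0"
  shows "(\<exists>g. g \<noteq> 0 \<and> smult q (of_int_poly f) dvd g \<and> sparse t g \<and> height g \<le> of_nat c \<and> degree g = m) \<longleftrightarrow>
    (\<exists>G. small_multiple f t c G \<and> degree G = m)"
proof
  assume "\<exists>g. g \<noteq> 0 \<and> smult q (of_int_poly f) dvd g \<and> sparse t g \<and> height g \<le> of_nat c \<and> degree g = m"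
  then obtain g where g: "g \<noteq> 0" "smult q (of_int_poly f) dvd g" "sparse t g" "height g \<le> of_nat c" "degree g = m"
    by blast
  obtain r G where r: "r > 0" "g = smult r (of_int_poly G)" "content G = 1" using primitive_form[OF g(1)] by blast
  have "(of_int_poly f :: rat poly) dvd of_int_poly G"
    using g(2) q r(1) unfolding r(2) by (simp add: smult_dvd_iff dvd_smult_iff)
  then have "f dvd G" using rat_poly_dvd_iff[OF f] by simp
  moreover have "G \<noteq> 0" using r(3) by auto
  moreover have "\<forall>i. \<bar>coeff G i\<bar> \<le> int c" using g(4) height_le_iff[OF r(1,3)] r(2) by simp
  moreover have "card {i. coeff G i \<noteq> 0} \<le> t" using g(3) r(1) unfolding sparse_def r(2) by simp
  moreover have "degree G = m" using g(5) r(1) unfolding r(2) by simp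
  ultimately show "\<exists>G. small_multiple f t c G \<and> degree G = m" unfolding small_multiple_def by blast
next
  assume "\<exists>G. small_multiple f t c G \<and> degree G = m"
  then obtain G where G: "G \<noteq> 0" "f dvd G" "card {i. coeff G i \<noteq> 0} \<le> t" "\<forall>i. \<bar>coeff G i\<bar> \<le> int c" "degree G = m"
    unfolding small_multiple_def by blast
  define P where "P = primitive_part G"
  define r where "r = content G"
  have r: "r > 0" using content_pos[OF G(1)] by (simp add: r_def)
  have GP: "G = smult r P" by (simp add: r_def P_def)
  have P: "content P = 1" using G(1) by (simp add: P_def content_primitive_part)
  have eq: "of_int_poly G = smult (of_int r :: rat) (of_int_poly P)"
    unfolding GP by (simp add: hom_distribs)
  have "\<bar>coeff P i\<bar> \<le> int c" for i
  proof -
    have "1 * \<bar>coeff P i\<bar> \<le> r * \<bar>coeff P i\<bar>" using r by (intro mult_right_mono) auto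
    also have "\<dots> = \<bar>coeff G i\<bar>" using r by (simp add: GP abs_mult)
    finally show ?thesis using G(4) by (metis mult_1 order_trans)
  qed
  then have "height (of_int_poly G) \<le> of_nat c" unfolding eq using height_le_iff[of "of_int r" P] r P by simp
  moreover have "smult q (of_int_poly f) dvd (of_int_poly G :: rat poly)"
    using q G(2) rat_poly_dvd_iff[OF f] by (simp add: smult_dvd_iff)
  ultimately show "\<exists>g. g \<noteq> 0 \<and> smult q (of_int_poly f) dvd g \<and> sparse t g \<and> height g \<le> of_nat c \<and> degree g = m"
    using G by (intro exI[of _ "of_int_poly G"]) (auto simp: sparse_def)
qed

section \<open>The Euler operator and multiplicities\<close>

definition theta :: "int poly \<Rightarrow> int poly" where
  "theta p = monom 1 1 * pderiv p"

lemma coeff_theta: "coeff (theta p) i = int i * coeff p i"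
  by (cases i) (auto simp: theta_def coeff_monom_mult coeff_pderiv)

lemma theta_mult: "theta (p * q) = theta p * q + p * theta q"
  by (simp add: theta_def pderiv_mult algebra_simps)

lemma coeff_theta_power: "coeff ((theta ^^ k) p) i = int i ^ k * coeff p i"
  by (induction k) (simp_all add: coeff_theta mult.assoc)

lemma theta_power_Suc: "theta (F ^ Suc j) = smult (int (Suc j)) (F ^ j * theta F)"
  by (simp only: theta_def pderiv_power_Suc) (simp add: mult_ac)

text \<open>By the product rule, each application loses at most one factor \<open>F\<close>.\<close>

lemma theta_power_dvd:
  "F ^ (j + k) dvd p \<Longrightarrow> F ^ j dvd (theta ^^ k) p"
proof (induction k arbitrary: j)
  case (Suc k)
  from Suc.prems have "F ^ (Suc j + k) dvd p" by simp
  then have "F ^ Suc j dvd (theta ^^ k) p" by (rule Suc.IH)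
  then obtain q where q: "(theta ^^ k) p = F ^ Suc j * q" by (elim dvdE)
  have "(theta ^^ Suc k) p = F ^ j * (smult (int (Suc j)) (theta F * q) + F * theta q)"
    by (simp only: funpow.simps o_apply q theta_mult theta_power_Suc) (simp add: algebra_simps)
  then show ?case by simp
qed simp

text \<open>Each application loses exactly one factor: modulo \<open>F\<close>, the new cofactor is
  \<open>(k + 1) * theta F * q\<close>. The prime \<open>F\<close> divides neither the constant, nor
  \<open>x\<close> (as \<open>F\<close> does not vanish at 0), nor its own derivative.\<close>

lemma theta_power_not_dvd:
  fixes F :: "int poly"
  assumes F: "irreducible F" "degree F \<ge> 1" "coeff F 0 \<noteq> 0" and q: "\<not> F dvd q"
  shows "\<not> F dvd (theta ^^ k) (F ^ k * q)"
  using q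
proof (induction k arbitrary: q)
  case (Suc k)
  have P: "prime_elem F" using F(1) by (rule irreducible_imp_prime_elem)
  have F0: "F \<noteq> 0" using F(2) by auto
  have nc: "\<not> F dvd [:int (Suc k):]"
    using F(2) dvd_imp_degree_le[of F "[:int (Suc k):]"] by auto
  have "\<not> F dvd monom 1 1"
  proof
    assume "F dvd monom 1 1"
    then obtain h where "monom 1 1 = F * h" by (elim dvdE)
    then have h: "coeff (F * h) 0 = 0" "coeff (F * h) 1 = 1" by (metis coeff_monom zero_neq_one)+
    have "degree F \<le> 1" using dvd_imp_degree_le[OF \<open>F dvd monom 1 1\<close>] by (simp add: degree_monom_eq monom_eq_0_iff)
    have "h = 0 \<or> degree h = 0"
      using F(2) \<open>monom 1 1 = F * h\<close> F0 degree_mult_eq[of F h] degree_monom_eq[of "1::int" 1] by force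
    then obtain c where "h = [:c:]" by (metis degree_eq_zeroE degree_0)
    with h F(3) show False by simp
  qed
  moreover have "\<not> F dvd pderiv F"
  proof
    assume "F dvd pderiv F"
    moreover have "pderiv F \<noteq> 0" using F(2) by (simp add: pderiv_eq_0_iff)
    ultimately have "degree F \<le> degree (pderiv F)" by (rule dvd_imp_degree_le)
    then show False using F(2) by (simp add: degree_pderiv)
  qed
  ultimately have "\<not> F dvd theta F" unfolding theta_def using P by (simp only: prime_elem_dvd_mult_iff simp_thms)
  then have "\<not> F dvd [:int (Suc k):] * (theta F * q)" using nc Suc.prems P by (simp only: prime_elem_dvd_mult_iff simp_thms)
  then have "\<not> F dvd smult (int (Suc k)) (theta F * q)" by simp
  then have "\<not> F dvd smult (int (Suc k)) (theta F * q) + F * theta q" by (simp add: dvd_add_left_iff)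
  from Suc.IH[OF this]
  have "\<not> F dvd (theta ^^ k) (F ^ k * (smult (int (Suc k)) (theta F * q) + F * theta q))" .
  moreover have "F ^ k * (smult (int (Suc k)) (theta F * q) + F * theta q) = theta (F ^ Suc k * q)"
    by (simp only: theta_mult theta_power_Suc) (simp add: algebra_simps)
  ultimately show ?case by (simp add: funpow_Suc_right del: funpow.simps)
qed simp

text \<open>Some prime occurs in \<open>f\<close> more often than in \<open>A\<close>, and
  \<open>k\<close> is its multiplicity in \<open>A\<close>. It is not a constant because
  \<open>f\<close> is primitive.\<close>

lemma primitive_not_dvd_witness:
  fixes f A :: "int poly"
  assumes f: "content f = 1" and A: "A \<noteq> 0" "\<not> f dvd A"
  shows "\<exists>F k q. irreducible F \<and> degree F \<ge> 1 \<and> F ^ Suc k dvd f \<and> A = F ^ k * q \<and> \<not> F dvd q"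
proof -
  have f0: "f \<noteq> 0" using f by auto
  have "\<not> (\<forall>p. prime p \<longrightarrow> multiplicity p f \<le> multiplicity p A)"
    using multiplicity_le_imp_dvd[of f A] f0 A by blast
  then obtain F where F: "prime F" "multiplicity F A < multiplicity F f" by force
  define k where "k = multiplicity F A"
  have irr: "irreducible F" using F(1) by (intro prime_elem_imp_irreducible prime_imp_prime_elem)
  have nu: "\<not> is_unit F" using irr by (simp add: irreducible_def)
  have Ff: "F ^ Suc k dvd f" using F(2) unfolding k_def by (intro multiplicity_dvd') simp
  obtain q where q: "A = F ^ k * q" "\<not> F dvd q"
    using multiplicity_decompose'[of A F] A(1) nu unfolding k_def by metis
  have "degree F \<ge> 1"
  proof (rule ccontr)
    assume "\<not> degree F \<ge> 1"
    then have "degree F = 0" by simp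
    then obtain b where b: "F = [:b:]" by (rule degree_eq_zeroE)
    have "F dvd f" using Ff by (metis dvd_mult_left power_Suc)
    then have "b dvd content f" by (simp add: b const_poly_dvd_iff_dvd_content)
    then have "is_unit F" using f by (simp add: b is_unit_const_poly_iff)
    with nu show False ..
  qed
  with irr Ff q show ?thesis by blast
qed

lemma degree_power:
  fixes p :: "'a::idom poly"
  assumes "degree p \<ge> 1" shows "degree (p ^ n) = n * degree p"
proof (induction n)
  case (Suc n)
  have "p \<noteq> 0" using assms by auto
  then have "degree (p * p ^ n) = degree p + degree (p ^ n)" by (intro degree_mult_eq) auto
  then show ?case using Suc by simp
qed simp

lemma sum_abs_coeffs_le:
  fixes P :: "int poly"
  assumes "S = {i. coeff P i \<noteq> 0}" "card S \<le> m" "\<And>i. \<bar>real_of_int (coeff P i)\<bar> \<le> b" "b \<ge> 0"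
  shows "(\<Sum>i\<le>degree P. \<bar>real_of_int (coeff P i)\<bar>) \<le> real m * b"
proof -
  have "(\<Sum>i\<le>degree P. \<bar>real_of_int (coeff P i)\<bar>) = (\<Sum>i\<in>S. \<bar>real_of_int (coeff P i)\<bar>)"
    using le_degree by (intro sum.mono_neutral_right) (auto simp: assms(1))
  also have "\<dots> \<le> (\<Sum>i\<in>S. b)" by (intro sum_mono assms)
  also have "\<dots> \<le> real m * b" using assms(2,4) by (simp add: mult_right_mono)
  finally show ?thesis .
qed

text \<open>The Euler operator \<open>theta = x d/dx\<close> reduces divisibility by \<open>F ^ (k + 1)\<close> to divisibility by
  \<open>F\<close> without changing the exponents that occur.\<close>

lemma gap_of_small_multiple:
  fixes f G :: "int poly"
  assumes f: "content f = 1" and G: "small_multiple f t c G" and t: "t \<ge> 2" and c: "c \<ge> 1"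
    and eu: "coeff G e \<noteq> 0" "coeff G u \<noteq> 0" "e < u" "\<And>i. e < i \<Longrightarrow> i < u \<Longrightarrow> coeff G i = 0"
    and ndvd: "\<not> f dvd poly_cutoff u G"
    and nr: "\<And>z n. z \<noteq> 0 \<Longrightarrow> ipoly f z = 0 \<Longrightarrow> n > 0 \<Longrightarrow> z ^ n \<noteq> 1"
  shows "\<exists>D k. D \<ge> 1 \<and> D * Suc k \<le> degree f \<and>
    real (u - e) * (5 / (12 * real D * ln (3 * real D) ^ 3)) \<le>
      real D * (ln (real c * real (t - 1)) + real k * ln (real (degree G)))"
proof -
  define A where "A = poly_cutoff u G"
  have cA: "coeff A i = (if i < u then coeff G i else 0)" for i by (simp add: A_def coeff_poly_cutoff)
  have A0: "A \<noteq> 0" using eu(1,3) cA[of e] by auto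
  have Gd: "G \<noteq> 0" "f dvd G" "card {i. coeff G i \<noteq> 0} \<le> t" "\<And>i. \<bar>coeff G i\<bar> \<le> int c"
    using G unfolding small_multiple_def by auto
  obtain F k q where F: "irreducible F" "degree F \<ge> 1" "F ^ Suc k dvd f" "A = F ^ k * q" "\<not> F dvd q"
    using primitive_not_dvd_witness[OF f A0] ndvd unfolding A_def by blast
  have FG: "F ^ Suc k dvd G" using F(3) Gd(2) by (rule dvd_trans)
  have Ff: "F dvd f" using F(3) by (metis dvd_mult_left power_Suc)
  have f0: "f \<noteq> 0" using f by auto
  \<comment> \<open>If \<open>F\<close> were associated to \<open>x\<close>, then
    \<open>x ^ (k + 1)\<close> would divide \<open>G\<close>, hence also its low part
    \<open>A\<close>, against the choice of \<open>k\<close>.\<close>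
  have F0: "coeff F 0 \<noteq> 0"
  proof
    assume "coeff F 0 = 0"
    then have x: "F = monom 1 1 * poly_shift 1 F"
      by (intro poly_eqI) (auto simp: coeff_monom_mult coeff_poly_shift not_le)
    then have "is_unit (monom 1 1 :: int poly) \<or> is_unit (poly_shift 1 F)" using irreducibleD[OF F(1)] by blast
    moreover have "\<not> is_unit (monom 1 1 :: int poly)"
    proof
      assume "is_unit (monom 1 1 :: int poly)"
      then have "degree (monom 1 1 :: int poly) \<le> degree (1 :: int poly)" by (rule dvd_imp_degree_le) simp
      then show False by (simp add: degree_monom_eq)
    qed
    ultimately have "is_unit (poly_shift 1 F)" by blast
    then obtain v where v: "1 = poly_shift 1 F * v" by (elim dvdE)
    have xF: "monom 1 1 ^ Suc k dvd F ^ Suc k" by (subst x) (simp only: power_mult_distrib dvd_triv_left)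
    have Fx: "F ^ Suc k dvd monom 1 1 ^ Suc k"
    proof -
      have "F * v = monom 1 1" by (subst x) (simp only: mult.assoc v[symmetric] mult_1_right)
      then have "F dvd monom 1 1" by (metis dvd_triv_left)
      then show ?thesis by (rule dvd_power_same)
    qed
    have xk: "monom 1 1 ^ Suc k = (monom 1 (Suc k) :: int poly)" by (simp only: monom_power power_one mult_1)
    have "monom 1 (Suc k) dvd G" using dvd_trans[OF xF FG] unfolding xk .
    then obtain G' where "G = monom 1 (Suc k) * G'" by (elim dvdE)
    then have "coeff A i = 0" if "i < Suc k" for i using that by (simp add: cA coeff_monom_mult)
    then have "A = monom 1 (Suc k) * poly_shift (Suc k) A"
      by (intro poly_eqI) (auto simp: coeff_monom_mult coeff_poly_shift)
    then have "monom 1 1 ^ Suc k dvd A" unfolding xk by (rule dvdI)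
    then have "F ^ Suc k dvd A" using Fx dvd_trans by blast
    then have "F ^ k * F dvd F ^ k * q" unfolding F(4) by (simp only: power_Suc2)
    moreover have "F ^ k \<noteq> 0" using F(2) by auto
    ultimately show False using F(5) by (simp only: dvd_mult_cancel_left) simp
  qed
  define T where "T = (theta ^^ k) G"
  define TA where "TA = (theta ^^ k) A"
  define TB where "TB = poly_shift u T"
  have cT: "coeff T i = int i ^ k * coeff G i" for i by (simp add: T_def coeff_theta_power)
  have T: "T = TA + monom 1 u * TB"
    by (intro poly_eqI) (auto simp: TA_def TB_def coeff_theta_power cT cA coeff_monom_mult coeff_poly_shift)
  have FT: "F dvd TA + monom 1 u * TB"
    using theta_power_dvd[of F 1 k G] FG unfolding T[symmetric] T_def by simp
  have nFA: "\<not> F dvd TA" unfolding TA_def F(4) by (rule theta_power_not_dvd[OF F(1,2) F0 F(5)])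
  define n where "n = degree G"
  have un: "u \<le> n" unfolding n_def using eu(2) by (rule le_degree)
  have n1: "n \<ge> 1" using un eu(3) by simp
  have dTA: "degree TA \<le> e"
  proof (rule degree_le, intro allI impI)
    fix i assume "e < i"
    then show "coeff TA i = 0" using eu(4)[of i] by (auto simp: TA_def coeff_theta_power cA)
  qed
  \<comment> \<open>The low part lacks the exponent \<open>u\<close> and the high part lacks
    \<open>e\<close>, hence \<open>t - 1\<close> terms each; \<open>k\<close> Euler operators
    enlarge a coefficient by at most \<open>n ^ k\<close>.\<close>
  define C where "C = real (t - 1) * (real c * real n ^ k)"
  have cb: "\<bar>real_of_int (coeff T i)\<bar> \<le> real c * real n ^ k" for i
  proof (cases "i \<le> n")
    case True
    have "\<bar>real_of_int (coeff T i)\<bar> = real i ^ k * \<bar>real_of_int (coeff G i)\<bar>" by (simp add: cT abs_mult)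
    also have "\<dots> \<le> real n ^ k * real c"
    proof (rule mult_mono)
      show "real i ^ k \<le> real n ^ k" using True by (intro power_mono) auto
      show "\<bar>real_of_int (coeff G i)\<bar> \<le> real c"
        using Gd(4)[of i] by (metis of_int_abs of_int_le_iff of_int_of_nat_eq)
    qed auto
    finally show ?thesis by (simp add: mult.commute)
  next
    case False
    then have "coeff G i = 0" by (simp add: n_def coeff_eq_0)
    then show ?thesis by (simp add: cT)
  qed
  have fin: "finite {i. coeff G i \<noteq> 0}" by (rule finite_subset[of _ "{..degree G}"]) (auto intro: le_degree)
  have card_le: "card ({i. coeff G i \<noteq> 0} - {j}) \<le> t - 1" if "coeff G j \<noteq> 0" for j
    using that Gd(3) fin by (subst card_Diff_singleton) auto
  have "(\<Sum>i\<le>degree TA. \<bar>real_of_int (coeff TA i)\<bar>) \<le> C"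
    unfolding C_def
  proof (rule sum_abs_coeffs_le[OF refl])
    have "{i. coeff TA i \<noteq> 0} \<subseteq> {i. coeff G i \<noteq> 0} - {u}" by (auto simp: TA_def coeff_theta_power cA split: if_splits)
    then show "card {i. coeff TA i \<noteq> 0} \<le> t - 1" using card_mono[OF finite_Diff[OF fin]] card_le[OF eu(2)] le_trans by blast
    show "\<bar>real_of_int (coeff TA i)\<bar> \<le> real c * real n ^ k" for i
      using cb[of i] by (auto simp: TA_def coeff_theta_power cA cT)
  qed simp
  moreover have "(\<Sum>i\<le>degree TB. \<bar>real_of_int (coeff TB i)\<bar>) \<le> C"
    unfolding C_def
  proof (rule sum_abs_coeffs_le[OF refl])
    have "(\<lambda>i. i + u) ` {i. coeff TB i \<noteq> 0} \<subseteq> {i. coeff G i \<noteq> 0} - {e}"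
      using eu(3) by (auto simp: TB_def coeff_poly_shift cT)
    then have "card ((\<lambda>i. i + u) ` {i. coeff TB i \<noteq> 0}) \<le> t - 1"
      using card_mono[OF finite_Diff[OF fin]] card_le[OF eu(1)] le_trans by blast
    then show "card {i. coeff TB i \<noteq> 0} \<le> t - 1" by (simp add: card_image)
    show "\<bar>real_of_int (coeff TB i)\<bar> \<le> real c * real n ^ k" for i
      using cb by (simp add: TB_def coeff_poly_shift)
  qed simp
  moreover have "e + (u - e) = u" using eu(3) by simp
  ultimately have main: "mahler F ^ (u - e) \<le> C ^ degree F"
    using gap_bound[OF F(1,2) F0 FT nFA dTA] by blast
  define D where "D = degree F"
  have nrF: "z ^ n \<noteq> 1" if "ipoly F z = 0" "n > 0" for z n
  proof -
    have "z \<noteq> 0" using that F0 by (auto simp: poly_0_coeff_0)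
    moreover have "ipoly f z = 0" using Ff that(1) by (auto simp: ipoly_mult)
    ultimately show ?thesis using nr that(2) by blast
  qed
  define lb where "lb = 5 / (12 * real D * ln (3 * real D) ^ 3)"
  have lb: "lb \<le> ln (mahler F)" unfolding lb_def D_def using ln_mahler_ge[OF F(1,2) F0 nrF] by simp
  have D1: "D \<ge> 1" using F(2) by (simp add: D_def)
  have "ln (3 * real D) > 0" using D1 by (intro ln_gt_zero) auto
  then have "lb > 0" unfolding lb_def using D1 by (intro divide_pos_pos mult_pos_pos) auto
  then have "ln (mahler F) > 0" using lb by linarith
  then have M0: "mahler F > 0"
    unfolding mahler_def by (intro mult_pos_pos prod_pos) (use F(2) in auto)
  have "C > 0" unfolding C_def using t c n1 by auto
  have "real (u - e) * lb \<le> real (u - e) * ln (mahler F)" using lb by (intro mult_left_mono) auto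
  also have "\<dots> = ln (mahler F ^ (u - e))" using M0 by (simp add: ln_realpow)
  also have "\<dots> \<le> ln (C ^ D)" using main M0 \<open>C > 0\<close> unfolding D_def by (subst ln_le_cancel_iff) auto
  also have "\<dots> = real D * ln C" using \<open>C > 0\<close> by (simp add: ln_realpow)
  also have "ln C = ln (real c * real (t - 1)) + real k * ln (real n)"
  proof -
    have "C = (real c * real (t - 1)) * real n ^ k" by (simp add: C_def)
    moreover have "real c * real (t - 1) > 0" "real n ^ k > 0" using t c n1 by auto
    ultimately have "ln C = ln (real c * real (t - 1)) + ln (real n ^ k)" by (simp only: ln_mult_pos)
    then show ?thesis using n1 by (simp add: ln_realpow)
  qed
  finally have "real (u - e) * lb \<le> real D * (ln (real c * real (t - 1)) + real k * ln (real n))" .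
  moreover have "D * Suc k \<le> degree f"
  proof -
    have "degree (F ^ Suc k) \<le> degree f" using F(3) f0 by (rule dvd_imp_degree_le)
    moreover have "degree (F ^ Suc k) = Suc k * D" unfolding D_def using F(2) by (rule degree_power)
    ultimately show ?thesis by (simp add: mult.commute)
  qed
  ultimately show ?thesis using D1 unfolding lb_def n_def by blast
qed

section \<open>Gaps and shifts of the exponents\<close>

text \<open>Pigeonhole: the span is a sum of at most \<open>m\<close> gaps. The induction removes
  the maximum and keeps the larger of the last gap and the gap found before it.\<close>

lemma large_gap_exists:
  fixes S :: "nat set"
  assumes "finite S" "S \<noteq> {}" "card S \<le> Suc m" "Min S < Max S"
  shows "\<exists>e\<in>S. \<exists>u\<in>S. e < u \<and> (\<forall>i. e < i \<and> i < u \<longrightarrow> i \<notin> S) \<and> Max S - Min S \<le> m * (u - e)"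
  using assms
proof (induction m arbitrary: S)
  case 0
  then obtain x where "S = {x}" by (metis One_nat_def card_0_eq card_1_singletonE le_antisym less_one linorder_not_less not_less_eq_eq le_zero_eq le_Suc_eq)
  then show ?case using 0 by simp
next
  case (Suc m)
  define b where "b = Max S"
  define S' where "S' = S - {b}"
  have bS: "b \<in> S" unfolding b_def using Suc.prems by simp
  have S': "finite S'" "card S' \<le> Suc m" using Suc.prems bS by (auto simp: S'_def)
  have mS: "Min S \<in> S'" using Suc.prems by (auto simp: S'_def b_def)
  then have ne: "S' \<noteq> {}" by auto
  have min: "Min S' = Min S"
    using mS S'(1) Suc.prems(1) by (intro Min_eqI) (auto simp: S'_def)
  define e where "e = Max S'"
  have eS: "e \<in> S'" unfolding e_def using S'(1) ne by simp
  have eb: "e < b" using eS Suc.prems(1) by (auto simp: S'_def b_def order_less_le)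
  have gap: "\<forall>i. e < i \<and> i < b \<longrightarrow> i \<notin> S"
  proof (intro allI impI notI)
    fix i assume i: "e < i \<and> i < b" "i \<in> S"
    then have "i \<in> S'" by (auto simp: S'_def)
    then have "i \<le> e" unfolding e_def using S'(1) by simp
    with i show False by simp
  qed
  have me: "Min S \<le> e" unfolding e_def using S'(1) mS by simp
  show ?case
  proof (cases "b - Min S \<le> Suc m * (b - e)")
    case True
    then show ?thesis using eS bS eb gap unfolding b_def S'_def by blast
  next
    case False
    have lt: "Min S' < Max S'"
    proof (rule ccontr)
      assume "\<not> Min S' < Max S'"
      then have "e = Min S" using me min by (simp add: e_def)
      then show False using False by simp
    qed
    from Suc.IH[OF S'(1) ne S'(2) lt] obtain e' u' where
      eu: "e' \<in> S'" "u' \<in> S'" "e' < u'" "\<forall>i. e' < i \<and> i < u' \<longrightarrow> i \<notin> S'" "Max S' - Min S' \<le> m * (u' - e')" by blast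
    have "u' \<le> e" unfolding e_def using eu(2) S'(1) by simp
    then have gap': "\<forall>i. e' < i \<and> i < u' \<longrightarrow> i \<notin> S" using eu(4) eb by (auto simp: S'_def)
    have "b - Min S \<le> Suc m * (u' - e')"
    proof -
      have "b - Min S = (b - e) + (e - Min S)" using eb me by simp
      moreover have "e - Min S \<le> m * (u' - e')" using eu(5) min by (simp add: e_def)
      ultimately have le: "b - Min S \<le> (b - e) + m * (u' - e')" by simp
      show ?thesis
      proof (cases "b - e \<le> u' - e'")
        case True then show ?thesis using le by simp
      next
        case False
        then have "m * (u' - e') \<le> m * (b - e)" by (intro mult_le_mono2) simp
        then have "b - Min S \<le> (b - e) + m * (b - e)" using le by linarith
        then have "b - Min S \<le> Suc m * (b - e)" by simp
        with \<open>\<not> b - Min S \<le> Suc m * (b - e)\<close> show ?thesis by simp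
      qed
    qed
    then show ?thesis using eu gap' unfolding b_def S'_def by blast
  qed
qed

text \<open>Shifting by \<open>x ^ m\<close> affects only the prime \<open>x\<close>, whose
  multiplicity in \<open>f\<close> is at most \<open>degree f\<close>.\<close>

lemma dvd_reduce_shift:
  fixes f P :: "int poly"
  assumes "f \<noteq> 0" "P \<noteq> 0" "f dvd monom 1 m * P"
  shows "f dvd monom 1 (degree f) * P"
proof (rule multiplicity_le_imp_dvd[OF assms(1)])
  fix p :: "int poly" assume p: "prime p"
  have pe: "prime_elem p" using p by (rule prime_imp_prime_elem)
  have nu: "\<not> is_unit p" using pe by (simp add: prime_elem_def)
  have m0: "monom 1 k \<noteq> (0 :: int poly)" for k by (simp add: monom_eq_0_iff)
  have mult: "multiplicity p (monom 1 k * P) = k * multiplicity p (monom 1 1) + multiplicity p P" for k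
  proof -
    have "monom 1 k = (monom 1 1 :: int poly) ^ k" by (simp only: monom_power power_one mult_1)
    then show ?thesis using pe assms(2) m0
      by (simp add: prime_elem_multiplicity_mult_distrib prime_elem_multiplicity_power_distrib)
  qed
  show "multiplicity p f \<le> multiplicity p (monom 1 (degree f) * P)"
  proof (cases "p dvd monom 1 1")
    case False
    then have "multiplicity p (monom 1 1) = 0" by (rule not_dvd_imp_multiplicity_0)
    moreover have "multiplicity p f \<le> multiplicity p (monom 1 m * P)"
      using assms m0 by (intro dvd_imp_multiplicity_le) auto
    ultimately show ?thesis unfolding mult by simp
  next
    case True
    then have "multiplicity p (monom 1 1) \<ge> 1"
      using nu m0 by (intro multiplicity_geI) auto
    moreover have "multiplicity p f \<le> degree f"
    proof -
      have "degree p \<noteq> 0"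
      proof
        assume "degree p = 0"
        then obtain b where b: "p = [:b:]" by (rule degree_eq_zeroE)
        with True have "b dvd 1" by (auto simp: const_poly_dvd_iff coeff_monom dest: spec[of _ 1])
        then show False using nu by (simp add: b is_unit_const_poly_iff)
      qed
      have "p ^ multiplicity p f dvd f" by (rule multiplicity_dvd)
      then have "degree (p ^ multiplicity p f) \<le> degree f" using assms(1) by (rule dvd_imp_degree_le)
      moreover have "degree (p ^ multiplicity p f) = multiplicity p f * degree p"
        using \<open>degree p \<noteq> 0\<close> by (intro degree_power) auto
      ultimately show ?thesis using \<open>degree p \<noteq> 0\<close> by (metis One_nat_def Suc_leI le_trans mult.right_neutral mult_le_mono2 neq0_conv)
    qed
    ultimately show ?thesis unfolding mult
      by (metis le_add1 le_trans mult.right_neutral mult_le_mono2)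
  qed
qed

text \<open>The tangent line inequality \<open>ln n \<le> ln X + (n - X) / X\<close> turns the bound for the gap, which
  involves \<open>ln n\<close>, into a bound for \<open>n\<close>.\<close>

lemma final_estimate:
  fixes d D k t c n \<kappa> \<gamma> :: nat
  assumes d: "d \<ge> 2" and D: "D \<ge> 1" "D * Suc k \<le> d" and t: "t \<ge> 2" and c: "c \<ge> 1" and \<kappa>: "\<kappa> \<le> d"
    and gap: "n - \<kappa> \<le> (t - 1) * \<gamma>"
    and \<gamma>: "real \<gamma> * (5 / (12 * real D * ln (3 * real D) ^ 3)) \<le>
        real D * (ln (real c * real (t - 1)) + real k * ln (real n))"
    and B: "B = 1/2 * (real d)\<^sup>2 * (ln (3 * real d)) ^ 3 * ln (real (max c 35) * (real t - 1) ^ d)"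
  shows "real n \<le> 2 * (real t - 1) * B * ln B"
proof -
  define s where "s = real t - 1"
  define L where "L = ln (3 * real d)"
  define l where "l = ln (real (max c 35)) + real d * ln s"
  define b where "b = ln B"
  define X where "X = 2 * s * B * b"
  have s: "s \<ge> 1" "real (t - 1) = s" using t by (auto simp: s_def of_nat_diff)
  have L: "L \<ge> 1791/1000" unfolding L_def using ln_6_ge d ln_le_cancel_iff[of 6 "3 * real d"] by linarith
  have L3: "L ^ 3 \<ge> 57/10" using power_mono[OF L, of 3] by (simp add: power3_eq_cube)
  have lns: "ln s \<ge> 0" using s by simp
  have l35: "ln (real (max c 35)) \<ge> 355/100"
    using ln_35_ge ln_le_cancel_iff[of 35 "real (max c 35)"] by linarith
  have l: "l \<ge> 355/100" unfolding l_def using l35 lns by (simp add: add_increasing2)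
  have Bl: "B = 1/2 * (real d)\<^sup>2 * L ^ 3 * l"
    unfolding B L_def l_def s_def[symmetric] using s by (simp add: ln_mult_pos ln_realpow)
  have d2: "(real d)\<^sup>2 \<ge> 4" using power_mono[of 2 "real d" 2] d by simp
  have d2L: "(real d)\<^sup>2 * L ^ 3 \<ge> 228/10"
  proof -
    have "4 * (57/10) \<le> (real d)\<^sup>2 * L ^ 3" using d2 L3 by (intro mult_mono) auto
    then show ?thesis by simp
  qed
  have B40: "B \<ge> 40"
  proof -
    have "(228/10) * (355/100) \<le> ((real d)\<^sup>2 * L ^ 3) * l" using d2L l by (intro mult_mono) auto
    then show ?thesis unfolding Bl by simp
  qed
  have b: "b \<ge> 368/100" unfolding b_def using ln_40_ge B40 ln_le_cancel_iff[of 40 B] by linarith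
  have X0: "X > 0" unfolding X_def using s B40 b by simp
  show ?thesis
  proof (rule ccontr)
    assume "\<not> ?thesis"
    then have nX: "X < real n" by (simp add: X_def s_def b_def)
    have n0: "real n > 0" using nX X0 by linarith
    \<comment> \<open>\<open>12/5\<close> is the reciprocal of the Mahler constant
      \<open>5/12\<close>, and \<open>ln (3 D)\<close> is replaced by the larger
      \<open>L\<close>.\<close>
    define U where "U = 12/5 * (real D)\<^sup>2 * L ^ 3"
    have LD: "ln (3 * real D) > 0" using D by (intro ln_gt_zero) auto
    have "D \<le> d" using D(2) by (metis le_trans mult.commute mult_Suc le_add1)
    then have "ln (3 * real D) \<le> L" unfolding L_def using D by (subst ln_le_cancel_iff) auto
    then have LDL: "ln (3 * real D) ^ 3 \<le> L ^ 3" using LD by (intro power_mono) auto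
    define q where "q = ln (real c * s) + real k * ln (real n)"
    have "real c * s \<ge> 1" using c s mult_mono[of 1 "real c" 1 s] by simp
    then have cs0: "ln (real c * s) \<ge> 0" by simp
    have lnn: "ln (real n) \<ge> 0" using n0 by (cases n) auto
    have q0: "q \<ge> 0" unfolding q_def using cs0 lnn by simp
    have gU: "real \<gamma> \<le> U * q"
    proof -
      define w where "w = 12 * real D * ln (3 * real D) ^ 3"
      have w: "w > 0" unfolding w_def using D LD by simp
      have "real \<gamma> * (5 / w) \<le> real D * q" using \<gamma> unfolding w_def q_def s(2) .
      then have "real \<gamma> * 5 \<le> real D * q * w" using w by (simp add: pos_divide_le_eq)
      also have "\<dots> = 12 * ((real D)\<^sup>2 * q) * ln (3 * real D) ^ 3" by (simp add: w_def power2_eq_square)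
      also have "\<dots> \<le> 12 * ((real D)\<^sup>2 * q) * L ^ 3" using LDL q0 by (intro mult_left_mono) auto
      finally show ?thesis by (simp add: U_def algebra_simps)
    qed
    have lnn_le: "ln (real n) \<le> ln X + (real n - X) / X"
    proof -
      have "ln (real n / X) \<le> real n / X - 1" using n0 X0 by (intro ln_le_minus_one) auto
      then show ?thesis using n0 X0 by (simp add: ln_div diff_divide_distrib)
    qed
    have lnX: "ln X \<le> ln s + 2 * b"
    proof -
      have X: "X = s * (2 * (B * b))" by (simp add: X_def)
      have "ln X = ln s + ln (2 * (B * b))" unfolding X using s B40 b by (intro ln_mult_pos) auto
      moreover have "2 * b \<le> B"
      proof -
        have "ln (B / 2) \<le> B / 2 - 1" using B40 by (intro ln_le_minus_one) auto
        then show ?thesis using B40 ln2_le_25_over_36 by (simp add: ln_div b_def)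
      qed
      then have "2 * (B * b) \<le> B * B" using B40 by (simp add: mult.left_commute)
      then have "ln (2 * (B * b)) \<le> ln (B * B)" using B40 b by (subst ln_le_cancel_iff) auto
      moreover have "ln (B * B) = 2 * b" using B40 by (simp add: ln_mult_pos b_def)
      ultimately show ?thesis by linarith
    qed
    have kd: "real k + 1 \<le> real d"
    proof -
      have "1 * Suc k \<le> D * Suc k" using D(1) by (rule mult_le_mono1)
      from order_trans[OF this D(2)] have "Suc k \<le> d" by (simp only: mult_1)
      then show ?thesis by linarith
    qed
    have main: "real \<kappa> + U * (l + 2 * real k * b) \<le> (real d)\<^sup>2 * L ^ 3 * l * b"
    proof -
      have Dd: "real D * (real k + 1) \<le> real d" using D(2) by (metis of_nat_Suc of_nat_le_iff of_nat_mult add.commute)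
      have sq: "(real D * (real k + 1))\<^sup>2 \<le> (real d)\<^sup>2" using Dd by (intro power_mono) auto
      have D1: "(real D)\<^sup>2 \<le> (real d)\<^sup>2" using \<open>D \<le> d\<close> by (intro power_mono) auto
      \<comment> \<open>\<open>4 k \<le> (k + 1) ^ 2\<close> together with
        \<open>D (k + 1) \<le> d\<close>: high multiplicity is paid for by low degree of the
        factor.\<close>
      have D2: "4 * ((real D)\<^sup>2 * real k) \<le> (real d)\<^sup>2"
      proof -
        have "4 * real k \<le> (real k + 1)\<^sup>2" using zero_le_power2[of "real k - 1"] by (simp add: power2_eq_square algebra_simps)
        then have "(real D)\<^sup>2 * (4 * real k) \<le> (real D)\<^sup>2 * (real k + 1)\<^sup>2" by (rule mult_left_mono) simp
        also have "\<dots> \<le> (real d)\<^sup>2" using sq by (simp add: power_mult_distrib)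
        finally show ?thesis by simp
      qed
      have "U * (l + 2 * real k * b) = 12/5 * L ^ 3 * ((real D)\<^sup>2 * l + 1/2 * (4 * ((real D)\<^sup>2 * real k)) * b)"
        by (simp add: U_def algebra_simps)
      also have "\<dots> \<le> 12/5 * L ^ 3 * ((real d)\<^sup>2 * l + 1/2 * (real d)\<^sup>2 * b)"
        using D1 D2 L l b by (intro mult_left_mono add_mono mult_right_mono) auto
      also have "\<dots> = (real d)\<^sup>2 * L ^ 3 * (12/5 * l + 6/5 * b)" by (simp add: algebra_simps)
      finally have 1: "U * (l + 2 * real k * b) \<le> (real d)\<^sup>2 * L ^ 3 * (12/5 * l + 6/5 * b)" .
      have 2: "real \<kappa> \<le> (real d)\<^sup>2 * L ^ 3 * (1/10)"
      proof -
        have "2 * real d \<le> (real d)\<^sup>2" using d by (simp add: power2_eq_square)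
        moreover have "(real d)\<^sup>2 * (57/10) \<le> (real d)\<^sup>2 * L ^ 3" using L3 by (intro mult_left_mono) auto
        moreover have "real \<kappa> \<le> real d" using \<kappa> by simp
        ultimately show ?thesis by linarith
      qed
      \<comment> \<open>The right side is \<open>l * b - 12/5 * l - 6/5 * b + 288/100\<close>. The
        lower bounds for \<open>l\<close> and \<open>b\<close>, which come from 35 and
        \<open>d \<ge> 2\<close>, leave the \<open>1/10\<close> that covers
        \<open>\<kappa>\<close>.\<close>
      have "(235/100) * (128/100) \<le> (l - 12/10) * (b - 24/10)" using l b by (intro mult_mono) auto
      then have "12/5 * l + 6/5 * b + 1/10 \<le> l * b" by (simp add: algebra_simps)
      then have "(real d)\<^sup>2 * L ^ 3 * (12/5 * l + 6/5 * b + 1/10) \<le> (real d)\<^sup>2 * L ^ 3 * (l * b)"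
        using d2L by (intro mult_left_mono) auto
      then show ?thesis using 1 2 by (simp add: algebra_simps)
    qed
    have cq: "ln (real c * s) + real k * ln X \<le> l + 2 * real k * b"
    proof -
      have "ln (real c * s) = ln (real c) + ln s" using c s by (subst ln_mult_pos) auto
      moreover have "ln (real c) \<le> ln (real (max c 35))" using c by (subst ln_le_cancel_iff) auto
      moreover have "real k * ln X \<le> real k * (ln s + 2 * b)" using lnX by (intro mult_left_mono) auto
      moreover have "(real k + 1) * ln s \<le> real d * ln s" using kd lns by (intro mult_right_mono) auto
      ultimately show ?thesis by (simp add: l_def algebra_simps)
    qed
    have Upos: "U > 0" unfolding U_def using D L by simp
    have q_le: "q \<le> (l + 2 * real k * b) + real k * ((real n - X) / X)"
    proof -
      have "real k * ln (real n) \<le> real k * (ln X + (real n - X) / X)" using lnn_le by (intro mult_left_mono) auto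
      then show ?thesis using cq unfolding q_def by (simp add: algebra_simps)
    qed
    have "real n \<le> real \<kappa> + s * real \<gamma>"
    proof -
      have "n \<le> \<kappa> + (t - 1) * \<gamma>" using gap by linarith
      then have "real n \<le> real (\<kappa> + (t - 1) * \<gamma>)" by (rule of_nat_mono)
      then show ?thesis using s(2) by simp
    qed
    also have "\<dots> \<le> s * real \<kappa> + s * (U * q)"
      using gU s by (intro add_mono mult_left_mono mult_right_mono[of 1 s, simplified]) auto
    also have "\<dots> \<le> s * real \<kappa> + s * (U * ((l + 2 * real k * b) + real k * ((real n - X) / X)))"
      using q_le Upos s by (intro add_left_mono mult_left_mono) auto
    also have "\<dots> = s * (real \<kappa> + U * (l + 2 * real k * b)) + s * U * real k * ((real n - X) / X)"
      by (simp add: algebra_simps)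
    also have "\<dots> \<le> X + s * U * real k * ((real n - X) / X)"
    proof -
      have "X = s * ((real d)\<^sup>2 * L ^ 3 * l * b)" by (simp add: X_def Bl)
      then show ?thesis using main s by simp
    qed
    \<comment> \<open>Dividing by \<open>n - X > 0\<close> gives \<open>X \<le> s * U * k\<close>,
      which contradicts \<open>main\<close>, where \<open>U\<close> has the larger factor
      \<open>l + 2 * k * b\<close>.\<close>
    finally have "real n - X \<le> s * U * real k * ((real n - X) / X)" by linarith
    then have "(real n - X) * X \<le> (real n - X) * (s * U * real k)" using X0 by (simp add: pos_le_divide_eq mult_ac)
    then have "X \<le> s * U * real k" using nX by (subst (asm) mult_le_cancel_left_pos) auto
    moreover have "s * U * real k < X"
    proof -
      have "U * real k \<le> U * (2 * real k * b)"
        using Upos b mult_left_mono[of 1 "2 * b" "real k"] by (intro mult_left_mono) (auto simp: mult_ac)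
      also have "\<dots> < U * (l + 2 * real k * b)" using Upos l by simp
      also have "\<dots> \<le> (real d)\<^sup>2 * L ^ 3 * l * b" using main by linarith
      finally have "s * (U * real k) < s * ((real d)\<^sup>2 * L ^ 3 * l * b)" using s by simp
      then show ?thesis by (simp add: X_def Bl mult_ac)
    qed
    ultimately show False by linarith
  qed
qed

section \<open>Roots of unity and cyclotomic factors\<close>

lemma root_of_unity_cis:
  assumes "z ^ n = 1" "n > 0"
  shows "\<exists>m j. m \<ge> 1 \<and> j \<ge> 1 \<and> coprime j m \<and> z = cis (2 * pi * real j / real m)"
proof -
  have "z \<in> (\<lambda>k. cis (2 * pi * real k / real n)) ` {..<n}"
    using Complex.bij_betw_roots_unity[OF assms(2)] assms(1) by (auto simp: bij_betw_def)
  then obtain k where k: "z = cis (2 * pi * real k / real n)" by blast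
  \<comment> \<open>The cyclotomic index set starts at 1, so the exponent 0 is replaced by
    \<open>n\<close>.\<close>
  define k' where "k' = (if k = 0 then n else k)"
  have k': "k' \<ge> 1" using assms(2) by (auto simp: k'_def)
  have z: "z = cis (2 * pi * real k' / real n)" using k assms(2) by (auto simp: k'_def)
  define g where "g = gcd k' n"
  have g: "g > 0" using assms(2) by (simp add: g_def)
  obtain j m where jm: "k' = g * j" "n = g * m"
    by (metis dvdE g_def gcd_dvd1 gcd_dvd2)
  have "coprime j m"
  proof -
    have "gcd (g * j) (g * m) = g * 1" using g_def jm by simp
    then have "gcd j m = 1" using g by (simp add: gcd_mult_distrib_nat[symmetric])
    then show ?thesis by (simp add: coprime_iff_gcd_eq_1)
  qed
  moreover have "z = cis (2 * pi * real j / real m)"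
    unfolding z jm using g by (simp add: mult.assoc)
  moreover have "m \<ge> 1" "j \<ge> 1" using jm assms(2) k' by (auto simp: Suc_le_eq intro!: gr0I)
  ultimately show ?thesis by blast
qed

text \<open>An irreducible factor vanishing at one primitive \<open>m\<close>-th root of unity
  vanishes at all of them, so the product of their linear factors, the cyclotomic polynomial,
  divides \<open>f\<close>.\<close>

lemma cyclotomic_free_roots:
  fixes f :: "int poly"
  assumes free: "\<And>n. n \<ge> 1 \<Longrightarrow> \<not> cyclotomic_poly n dvd of_int_poly f" and f0: "f \<noteq> 0"
    and z: "ipoly f z = 0" and n: "n > 0"
  shows "z ^ n \<noteq> 1"
proof
  assume "z ^ n = 1"
  then obtain m j where m: "m \<ge> 1" "j \<ge> 1" "coprime j m" "z = cis (2 * pi * real j / real m)"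
    using root_of_unity_cis n by blast
  obtain F where F: "irreducible F" "F dvd f" "ipoly F z = 0"
    using exists_irreducible_factor_of_root[OF f0 z] by blast
  have d: "degree F \<ge> 1" using irreducible_degree_pos F by blast
  define w where "w = cis (2 * pi / real m)"
  have wk: "cis (2 * pi * real k / real m) = w ^ k" for k
  proof -
    have "2 * pi * real k / real m = real k * (2 * pi / real m)" by simp
    then show ?thesis by (simp only: w_def Complex.DeMoivre)
  qed
  have wm: "w ^ m = 1" unfolding wk[symmetric] using m(1) by simp
  have zw: "z = w ^ j" using m(4) wk by simp
  have zm: "z ^ m = 1" unfolding zw by (metis mult.commute power_mult power_one wm)
  have "gcd j m = 1" using m(3) by simp
  \<comment> \<open>\<open>x\<close> inverts \<open>j\<close> modulo \<open>m\<close>, so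
    \<open>z ^ x\<close> is the standard primitive root \<open>w\<close>.\<close>
  then obtain x y where xy: "j * x = m * y + 1" using bezout_nat[of j m] m(2) by auto
  have xm: "coprime x m"
  proof (rule coprimeI)
    fix c assume c: "c dvd x" "c dvd m"
    then have "c dvd m * y + 1" "c dvd m * y" unfolding xy[symmetric] by auto
    then show "is_unit c" by (metis dvd_add_right_iff)
  qed
  have "x > 0" using xy by (cases x) auto
  have "z ^ x = w" unfolding zw power_mult[symmetric] xy by (simp add: power_mult wm)
  then have Fw: "ipoly F w = 0"
    using irreducible_root_of_unity_coprime_power[OF F(1,3) _ zm \<open>x > 0\<close> xm] m(1) by simp
  define S where "S = {k. 1 \<le> k \<and> k \<le> m \<and> coprime k m}"
  have SR: "(\<lambda>k. w ^ k) ` S \<subseteq> iroots F"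
    using irreducible_root_of_unity_coprime_power[OF F(1) Fw _ wm] m(1) by (auto simp: S_def)
  have inj: "inj_on (\<lambda>k. w ^ k) S"
  proof (cases "m = 1")
    case True then show ?thesis by (auto simp: S_def inj_on_def)
  next
    case False
    then have "S \<subseteq> {..<m}" by (auto simp: S_def order_less_le)
    moreover have "inj_on (\<lambda>k. w ^ k) {..<m}"
      using Complex.bij_betw_roots_unity[of m] m(1) unfolding wk bij_betw_def by simp
    ultimately show ?thesis by (rule inj_on_subset[rotated])
  qed
  have "cyclotomic_poly m = (\<Prod>k\<in>S. [:- (w ^ k), 1:])"
    unfolding cyclotomic_poly_def S_def wk ..
  also have "\<dots> = (\<Prod>r\<in>(\<lambda>k. w ^ k) ` S. [:- r, 1:])" using inj by (simp add: prod.reindex)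
  also have "\<dots> dvd (\<Prod>r\<in>iroots F. [:- r, 1:])"
    using SR irreducible_factorization(2)[OF F(1) d] by (intro prod_dvd_prod_subset)
  also have "\<dots> dvd of_int_poly F" by (subst irreducible_factorization(1)[OF F(1) d]) (simp add: dvd_smult)
  also have "\<dots> dvd of_int_poly f" using F(2) by (auto simp: hom_distribs)
  finally show False using free m(1) by blast
qed

section \<open>Linear polynomials and consequences of minimality\<close>

text \<open>A linear \<open>f\<close> is a small multiple of itself, so only
  \<open>n \<le> 1\<close> has to be covered. The general estimate relies on
  \<open>B \<ge> 40\<close>, whereas here \<open>B\<close> may be below 3.\<close>

lemma linear_bound_ge_1:
  assumes "t \<ge> 2" and B: "B = 1/2 * (ln 3) ^ 3 * ln (real (max c 35) * (real t - 1))"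
  shows "1 \<le> 2 * (real t - 1) * B * ln B"
proof -
  have "ln (real (max c 35) * (real t - 1)) \<ge> ln 35"
  proof -
    have "35 * 1 \<le> real (max c 35) * (real t - 1)" using assms(1) by (intro mult_mono) auto
    then show ?thesis by (subst ln_le_cancel_iff) auto
  qed
  then have l: "ln (real (max c 35) * (real t - 1)) \<ge> 355/100" using ln_35_ge by linarith
  have "ln (3::real) ^ 3 \<ge> (1098/1000) ^ 3" using ln_3_ge by (intro power_mono) auto
  then have "ln (3::real) ^ 3 \<ge> 132/100" by (simp add: power3_eq_cube)
  then have "(132/100) * (355/100) \<le> ln 3 ^ 3 * ln (real (max c 35) * (real t - 1))"
    using l by (intro mult_mono) auto
  then have B2: "B \<ge> 234/100" unfolding B by simp
  then have "ln B \<ge> ln (234/100)" by (subst ln_le_cancel_iff) auto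
  moreover have "ln (234/100 :: real) \<ge> 4/5" using ln_ge_pade[of "234/100"] by simp
  ultimately have "ln B \<ge> 4/5" by linarith
  then have "(234/100) * (4/5) \<le> B * ln B" using B2 by (intro mult_mono) auto
  then have "1 * 1 \<le> (2 * (real t - 1)) * (B * ln B)" using assms(1) by (intro mult_mono) auto
  then show ?thesis by (simp add: mult.assoc)
qed

text \<open>A primitive linear polynomial divides \<open>G\<close> only if its coefficients divide the extreme
  coefficients of \<open>G\<close>, so it has itself the smallest height among its multiples.\<close>

lemma linear_small_multiple:
  fixes f G :: "int poly"
  assumes f: "degree f = 1" and G: "small_multiple f t c G" and t: "t \<ge> 2"
  shows "small_multiple f t c f"
proof -
  have Gd: "G \<noteq> 0" "f dvd G" "\<And>i. \<bar>coeff G i\<bar> \<le> int c" using G by (auto simp: small_multiple_def)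
  obtain H where H: "G = f * H" using Gd(2) by (elim dvdE)
  have H0: "H \<noteq> 0" using H Gd(1) by auto
  have f0: "f \<noteq> 0" using f by auto
  have le: "\<bar>x\<bar> \<le> \<bar>x * y\<bar>" if "y \<noteq> 0" for x y :: int
    using that mult_left_mono[of 1 "\<bar>y\<bar>" "\<bar>x\<bar>"] by (simp add: abs_mult)
  have "lead_coeff G = lead_coeff f * lead_coeff H" by (simp add: H lead_coeff_mult)
  then have c1: "\<bar>coeff f 1\<bar> \<le> int c" using le[of "lead_coeff H" "lead_coeff f"] H0 Gd(3)[of "degree G"] f by simp
  define v where "v = (LEAST i. coeff H i \<noteq> 0)"
  have v: "coeff H v \<noteq> 0" unfolding v_def by (rule LeastI_ex) (use H0 in \<open>auto simp: poly_eq_iff\<close>)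
  have v0: "coeff H i = 0" if "i < v" for i using not_less_Least[of i] that unfolding v_def by blast
  have "coeff G v = (\<Sum>i\<le>v. coeff f i * coeff H (v - i))" by (simp add: H coeff_mult)
  also have "\<dots> = (\<Sum>i\<in>{0}. coeff f i * coeff H (v - i))"
    by (rule sum.mono_neutral_right) (auto simp: v0)
  finally have "coeff G v = coeff f 0 * coeff H v" by simp
  then have "\<bar>coeff f 0\<bar> \<le> int c" using le[OF v, of "coeff f 0"] Gd(3)[of v] by simp
  then have "\<bar>coeff f i\<bar> \<le> int c" for i
    using c1 f coeff_eq_0[of f i] by (cases "i = 0 \<or> i = 1") auto
  moreover have "{i. coeff f i \<noteq> 0} \<subseteq> {0, 1}" using f le_degree[of f] by force
  then have "card {i. coeff f i \<noteq> 0} \<le> card {0, 1 :: nat}" by (intro card_mono) auto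
  then have "card {i. coeff f i \<noteq> 0} \<le> t" using t by simp
  ultimately show ?thesis using f0 by (simp add: small_multiple_def)
qed

lemma poly_cutoff_small_multiple:
  assumes G: "small_multiple f t c G" and u: "u \<le> degree G" and e: "e < u" "coeff G e \<noteq> 0"
    and dvd: "f dvd poly_cutoff u G"
  shows "\<exists>A. small_multiple f t c A \<and> degree A < degree G"
proof -
  define A where "A = poly_cutoff u G"
  have cA: "coeff A i = (if i < u then coeff G i else 0)" for i by (simp add: A_def coeff_poly_cutoff)
  have fin: "finite {i. coeff G i \<noteq> 0}" by (rule finite_subset[of _ "{..degree G}"]) (auto intro: le_degree)
  have "card {i. coeff A i \<noteq> 0} \<le> card {i. coeff G i \<noteq> 0}" by (rule card_mono[OF fin]) (auto simp: cA)
  moreover have "A \<noteq> 0" using e cA[of e] by auto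
  moreover have "degree A < degree G"
  proof -
    have "degree A \<le> u - 1" by (rule degree_le) (auto simp: cA)
    then show ?thesis using u e by linarith
  qed
  ultimately show ?thesis using G dvd unfolding small_multiple_def A_def[symmetric]
    by (intro exI[of _ A]) (auto simp: cA)
qed

text \<open>A cyclotomic-free \<open>f\<close> may be divisible by \<open>x\<close>, so a minimal
  multiple can have order above 0. Beyond \<open>degree f\<close>, however, one factor
  \<open>x\<close> can be cancelled, which lowers the degree.\<close>

lemma minimal_multiple_order_le:
  fixes f G :: "int poly"
  assumes f: "f \<noteq> 0" and G: "small_multiple f t c G"
    and min: "\<And>H. small_multiple f t c H \<Longrightarrow> degree G \<le> degree H"
  shows "Min {i. coeff G i \<noteq> 0} \<le> degree f"
proof (rule ccontr)
  define S where "S = {i. coeff G i \<noteq> 0}"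
  define v where "v = Min S"
  assume "\<not> Min {i. coeff G i \<noteq> 0} \<le> degree f"
  then have v: "v > degree f" by (simp add: v_def S_def)
  have Gd: "G \<noteq> 0" "f dvd G" "card S \<le> t" "\<And>i. \<bar>coeff G i\<bar> \<le> int c"
    using G unfolding small_multiple_def S_def by auto
  have fin: "finite S" unfolding S_def by (rule finite_subset[of _ "{..degree G}"]) (auto intro: le_degree)
  have z: "coeff G i = 0" if "i < v" for i
    using Min_le[OF fin, of i] that by (force simp: v_def S_def)
  define P where "P = poly_shift v G"
  have GP: "G = monom 1 v * P"
    by (intro poly_eqI) (auto simp: P_def coeff_monom_mult coeff_poly_shift z)
  have P0: "P \<noteq> 0" using GP Gd(1) by auto
  have "f dvd monom 1 (degree f) * P" using dvd_reduce_shift[OF f P0] Gd(2) GP by simp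
  define H where "H = monom 1 (v - 1) * P"
  have "monom 1 (v - 1) = monom 1 (v - 1 - degree f) * (monom 1 (degree f) :: int poly)"
    using v by (simp add: mult_monom)
  then have "H = monom 1 (v - 1 - degree f) * (monom 1 (degree f) * P)" by (simp add: H_def mult.assoc)
  then have fH: "f dvd H" using \<open>f dvd monom 1 (degree f) * P\<close> by simp
  have cH: "coeff H i = coeff G (Suc i)" for i
    using v by (auto simp: H_def GP coeff_monom_mult)
  have "Suc ` {i. coeff H i \<noteq> 0} \<subseteq> S" by (auto simp: cH S_def)
  then have "card (Suc ` {i. coeff H i \<noteq> 0}) \<le> t" using card_mono[OF fin] Gd(3) le_trans by blast
  then have "card {i. coeff H i \<noteq> 0} \<le> t" by (simp add: card_image)
  moreover have "H \<noteq> 0" using P0 by (simp add: H_def monom_eq_0_iff)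
  ultimately have "small_multiple f t c H" using fH Gd(4) by (simp add: small_multiple_def cH)
  then have "degree G \<le> degree H" by (rule min)
  moreover have "degree H = v - 1 + degree P" "degree G = v + degree P"
    using P0 unfolding H_def GP by (simp_all add: degree_mult_eq degree_monom_eq monom_eq_0_iff)
  ultimately show False using v by simp
qed

theorem theorem4p5:
  fixes f :: "rat poly" and t c n :: nat
  assumes "degree f \<ge> 1"
    and "cyclotomic_free f"
    and "t \<ge> 2"
    and "\<exists>g. g \<noteq> 0 \<and> f dvd g \<and> sparse t g \<and> height g \<le> of_nat c"
    and "n = (LEAST m. \<exists>g. g \<noteq> 0 \<and> f dvd g \<and> sparse t g \<and> height g \<le> of_nat c
                          \<and> degree g = m)"
  shows "let d = real (degree f); ch = real (max c 35);
             B = 1/2 * d^2 * (ln (3*d))^3 * ln (ch * (real t - 1) ^ degree f)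
         in real n \<le> 2 * (real t - 1) * B * ln B"
proof -
  have "f \<noteq> 0" using assms(1) by auto
  then obtain q p where q: "q > 0" "f = smult q (of_int_poly p)" "content p = 1"
    using primitive_form by blast
  have p0: "p \<noteq> 0" using q(3) by auto
  have deg: "degree f = degree p" using q(1,2) by simp
  note transfer = small_multiple_transfer[OF q(3,1), folded q(2), of t c]
  have n: "n = (LEAST m. \<exists>G. small_multiple p t c G \<and> degree G = m)"
    unfolding assms(5) transfer ..
  have ex: "\<exists>m G. small_multiple p t c G \<and> degree G = m"
    using assms(4) transfer by metis
  obtain G where G: "small_multiple p t c G" "degree G = n"
    using LeastI_ex[OF ex] unfolding n[symmetric] by blast
  have min: "n \<le> degree H" if "small_multiple p t c H" for H
    unfolding n by (rule Least_le) (use that in blast)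
  have Gd: "G \<noteq> 0" "p dvd G" "card {i. coeff G i \<noteq> 0} \<le> t" "\<And>i. \<bar>coeff G i\<bar> \<le> int c"
    using G unfolding small_multiple_def by auto
  have c: "c \<ge> 1"
  proof -
    have "\<bar>lead_coeff G\<bar> \<ge> 1" using Gd(1) by (simp add: int_one_le_iff_zero_less)
    then show ?thesis using Gd(4)[of "degree G"] by linarith
  qed
  have nr: "z ^ k \<noteq> 1" if "ipoly p z = 0" "k > 0" for z k
  proof (rule cyclotomic_free_roots[OF _ p0 that])
    fix m :: nat assume "m \<ge> 1"
    then have "\<not> cyclotomic_poly m dvd map_poly of_rat f"
      using assms(2) by (simp add: cyclotomic_free_def)
    moreover have "map_poly of_rat f = smult (of_rat q) (of_int_poly p :: complex poly)"
      unfolding q(2) by (simp add: hom_distribs map_poly_map_poly o_def)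
    ultimately show "\<not> cyclotomic_poly m dvd of_int_poly p" by (auto simp: dvd_smult)
  qed
  define B where "B = 1/2 * (real (degree f))\<^sup>2 * (ln (3 * real (degree f))) ^ 3 *
      ln (real (max c 35) * (real t - 1) ^ degree f)"
  have "real n \<le> 2 * (real t - 1) * B * ln B"
  proof (cases "degree f = 1")
    case True
    then have "small_multiple p t c p" using linear_small_multiple[OF _ G(1) assms(3)] deg by simp
    then have "n \<le> 1" using min[of p] True deg by simp
    moreover have "1 \<le> 2 * (real t - 1) * B * ln B"
      by (rule linear_bound_ge_1[OF assms(3)]) (simp add: B_def True)
    ultimately show ?thesis by linarith
  next
    case False
    then have d2: "degree p \<ge> 2" using assms(1) deg by simp
    define S where "S = {i. coeff G i \<noteq> 0}"
    have fin: "finite S" unfolding S_def by (rule finite_subset[of _ "{..degree G}"]) (auto intro: le_degree)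
    have nS: "n \<in> S" using G(2) Gd(1) by (auto simp: S_def)
    have maxS: "Max S = n" using fin nS G(2) by (intro Max_eqI) (auto simp: S_def le_degree)
    have minS: "Min S \<le> degree p"
      unfolding S_def by (rule minimal_multiple_order_le[OF p0 G(1)]) (use min G(2) in simp)
    note est = final_estimate[OF d2 _ _ assms(3) c minS, where B = B and n = n, OF _ _ _ _ B_def[unfolded deg]]
    show ?thesis
    proof (cases "Min S < Max S")
      \<comment> \<open>All exponents coincide, so \<open>G\<close> is a monomial of degree at most
        \<open>degree p\<close>; the estimate is used with \<open>D = 1\<close>,
        \<open>k = 0\<close> and gap 0.\<close>
      case False
      then have "n \<le> Min S" using maxS by simp
      moreover have "1 * 1 \<le> real c * (real t - 1)" using c assms(3) by (intro mult_mono) auto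
      ultimately show ?thesis
        using c assms(3) by (intro est[of 1 0 0]) (use d2 in auto)
    next
      case True
      have "card S \<le> Suc (t - 1)" using Gd(3) assms(3) by (simp add: S_def)
      then obtain e u where eu: "e \<in> S" "u \<in> S" "e < u" "\<forall>i. e < i \<and> i < u \<longrightarrow> i \<notin> S"
        "n - Min S \<le> (t - 1) * (u - e)"
        using large_gap_exists[OF fin _ _ True, of "t - 1"] nS unfolding maxS by blast
      have un: "u \<le> degree G" using eu(2) by (auto simp: S_def intro: le_degree)
      have ndvd: "\<not> p dvd poly_cutoff u G"
        using poly_cutoff_small_multiple[OF G(1) un eu(3)] eu(1) min G(2) by (auto simp: S_def not_less[symmetric])
      have "\<exists>D k. D \<ge> 1 \<and> D * Suc k \<le> degree p \<and>
        real (u - e) * (5 / (12 * real D * ln (3 * real D) ^ 3)) \<le>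
          real D * (ln (real c * real (t - 1)) + real k * ln (real (degree G)))"
        by (rule gap_of_small_multiple[OF q(3) G(1) assms(3) c _ _ eu(3) _ ndvd])
          (use eu nr in \<open>auto simp: S_def\<close>)
      then obtain D k where Dk: "D \<ge> 1" "D * Suc k \<le> degree p"
        "real (u - e) * (5 / (12 * real D * ln (3 * real D) ^ 3)) \<le>
          real D * (ln (real c * real (t - 1)) + real k * ln (real n))"
        unfolding G(2) by blast
      show ?thesis by (rule est[OF Dk(1,2) eu(5) Dk(3)])
    qed
  qed
  then show ?thesis unfolding Let_def B_def by simp
qed

end
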